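(* Let $0<r<1$. For every bounded holomorphic function $\phi\in H^{\infty}(A_r)$, $$\sup_{T\in\mathcal{F}_r}\|\phi(T)\|=\|\phi\|_{\mathrm{Mult}(\mathscr{H}^2(A_r))}\le\sqrt{2}\,\|\phi\|_{\infty}.$$ Moreover, the constant $\sqrt{2}$ is the best possible: there is no constant $C<\sqrt{2}$ such that $\|\phi\|_{\mathrm{Mult}(\mathscr{H}^2(A_r))}\le C\|\phi\|_\infty$ for all $\phi\in H^\infty(A_r)$.
   Context: For $0<r<1$, $A_r=\{z\in\mathbb{C}: r<|z|<1\}$, $H^\infty(A_r)$ is the algebra of bounded holomorphic functions on $A_r$, and $\|\phi\|_\infty=\sup_{z\in A_r}|\phi(z)|$. The class $\mathcal{F}_r$ consists of all bounded (invertible) operators $T\in\mathcal{B}(H)$, where $H$ is any complex Hilbert space, such that the spectrum satisfies $\sigma(T)\subset A_r$ and $r^2T^{-1}(T^{-1})^*+TT^*\le (r^2+1)I$ (in the order of self-adjoint operators). For $\phi=\sum_{n\in\mathbb{Z}}a_nz^n$ holomorphic on $A_r$ and $T\in\mathcal{B}(H)$ with $\sigma(T)\subset A_r$, the operator $\phi(T)$ is defined by the Riesz–Dunford functional calculus, equivalently by the norm-convergent series $\phi(T)=\sum_{n\in\mathbb{Z}}a_nT^n$. $\|\phi(T)\|$ is the operator norm. $\mathscr{H}^2(A_r)$ is the Hilbert space of holomorphic functions on $A_r$ with reproducing kernel $$k_{A_r}(\lambda,\mu)=\frac{1-r^2}{(1-\lambda\bar\mu)(1-r^2/(\lambda\bar\mu))},\qquad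 \lambda,\mu\in A_r;$$ equivalently, it is the space of holomorphic $f=\sum_{n\in\mathbb{Z}}a_nz^n$ on $A_r$ with $\|f\|^2_{\mathscr{H}^2(A_r)}=\sum_{n\le -1}r^{2n}|a_n|^2+\sum_{n\ge 0}|a_n|^2<\infty$. $\mathrm{Mult}(\mathscr{H}^2(A_r))$ is the set of functions $\phi:A_r\to\mathbb{C}$ for which $M_\phi f:=\phi f$ defines a bounded operator $M_\phi$ on $\mathscr{H}^2(A_r)$, and $\|\phi\|_{\mathrm{Mult}(\mathscr{H}^2(A_r))}$ is the operator norm of $M_\phi$. *)

theory Defs
  imports "HOL-Complex_Analysis.Complex_Analysis"
begin

section \<open>Functions on the annulus\<close>

definition annulus :: "real \<Rightarrow> complex set" where
  "annulus r = {z. r < cmod z \<and> cmod z < 1}"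

definition H_infty :: "real \<Rightarrow> (complex \<Rightarrow> complex) set" where
  "H_infty r = {\<phi>. \<phi> holomorphic_on annulus r \<and> bounded (\<phi> ` annulus r)}"

definition H_infty_norm :: "real \<Rightarrow> (complex \<Rightarrow> complex) \<Rightarrow> real" where
  "H_infty_norm r \<phi> = (SUP z\<in>annulus r. cmod (\<phi> z))"

text \<open>The coefficients \<open>a\<^sub>n\<close> of the Laurent expansion of \<open>f\<close> on the annulus. They exist and
  are unique for every \<open>f\<close> that is holomorphic there (\<open>0 < r < 1\<close>).\<close>

definition laurent_coeff :: "real \<Rightarrow> (complex \<Rightarrow> complex) \<Rightarrow> int \<Rightarrow> complex" where
  "laurent_coeff r f =
     (THE a. \<forall>z\<in>annulus r. ((\<lambda>n. a n * z powi n) has_sum f z) UNIV)"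

text \<open>The space with reproducing kernel \<open>(1 - r\<^sup>2) / ((1 - t) (1 - r\<^sup>2 / t))\<close>, \<open>t = \<lambda> cnj \<mu>\<close>:
  for \<open>r\<^sup>2 < cmod t < 1\<close> the Laurent coefficient of \<open>t\<^sup>n\<close> in the kernel is the reciprocal of the
  weight of \<open>a\<^sub>n\<close> below.\<close>

definition H2_weight :: "real \<Rightarrow> int \<Rightarrow> real" where
  "H2_weight r n = (if n \<le> -1 then r powi (2 * n) else 1)"

definition H2 :: "real \<Rightarrow> (complex \<Rightarrow> complex) set" where
  "H2 r = {f. f holomorphic_on annulus r \<and>
              (\<lambda>n. H2_weight r n * (cmod (laurent_coeff r f n))\<^sup>2) summable_on UNIV}"

definition H2_norm :: "real \<Rightarrow> (complex \<Rightarrow> complex) \<Rightarrow> real" where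
  "H2_norm r f = sqrt (\<Sum>\<^sub>\<infinity>n. H2_weight r n * (cmod (laurent_coeff r f n))\<^sup>2)"

definition Mult :: "real \<Rightarrow> (complex \<Rightarrow> complex) set" where
  "Mult r = {\<phi>. (\<forall>f\<in>H2 r. (\<lambda>z. \<phi> z * f z) \<in> H2 r) \<and>
                (\<exists>C. \<forall>f\<in>H2 r. H2_norm r (\<lambda>z. \<phi> z * f z) \<le> C * H2_norm r f)}"

definition Mult_norm :: "real \<Rightarrow> (complex \<Rightarrow> complex) \<Rightarrow> real" where
  "Mult_norm r \<phi> = (SUP f\<in>{f \<in> H2 r. H2_norm r f \<le> 1}. H2_norm r (\<lambda>z. \<phi> z * f z))"


section \<open>Complex Hilbert spaces and their bounded operators\<close>

text \<open>A Hilbert space is given by a linear subspace \<open>H\<close> of an ambient complex vector space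
  and a complete inner product \<open>ip\<close> on \<open>H\<close>, linear in the first argument. The ambient space
  carries no topology; it only provides a supply of vectors, so that one can quantify over
  all Hilbert spaces inside a formula. Any Hilbert space whose vectors form a type is covered
  by taking \<open>H = UNIV\<close>.\<close>

locale complex_inner_space = vector_space smul
  for smul :: "complex \<Rightarrow> 'v::ab_group_add \<Rightarrow> 'v" +
  fixes H :: "'v set" and ip :: "'v \<Rightarrow> 'v \<Rightarrow> complex"
  assumes subspace_H: "subspace H"
    and ip_add: "\<lbrakk>x \<in> H; y \<in> H; z \<in> H\<rbrakk> \<Longrightarrow> ip (x + y) z = ip x z + ip y z"
    and ip_smul: "\<lbrakk>x \<in> H; y \<in> H\<rbrakk> \<Longrightarrow> ip (smul c x) y = c * ip x y"
    and ip_cnj: "\<lbrakk>x \<in> H; y \<in> H\<rbrakk> \<Longrightarrow> ip y x = cnj (ip x y)"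
    and ip_nonneg: "x \<in> H \<Longrightarrow> 0 \<le> Re (ip x x)"
    and ip_definite: "\<lbrakk>x \<in> H; ip x x = 0\<rbrakk> \<Longrightarrow> x = 0"
begin

definition hnorm :: "'v \<Rightarrow> real" where
  "hnorm x = sqrt (Re (ip x x))"

text \<open>Operators are extended by \<open>0\<close> outside \<open>H\<close>, so that equality of operators on \<open>H\<close> is
  equality of functions.\<close>

definition bounded_ops :: "('v \<Rightarrow> 'v) set" where
  "bounded_ops = {T. (\<forall>x\<in>H. T x \<in> H) \<and> (\<forall>x. x \<notin> H \<longrightarrow> T x = 0) \<and>
      (\<forall>x\<in>H. \<forall>y\<in>H. T (x + y) = T x + T y) \<and>
      (\<forall>c. \<forall>x\<in>H. T (smul c x) = smul c (T x)) \<and>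
      (\<exists>K. \<forall>x\<in>H. hnorm (T x) \<le> K * hnorm x)}"

definition op_norm :: "('v \<Rightarrow> 'v) \<Rightarrow> real" where
  "op_norm T = (SUP x\<in>{x \<in> H. hnorm x \<le> 1}. hnorm (T x))"

definition id_op :: "'v \<Rightarrow> 'v" where
  "id_op x = (if x \<in> H then x else 0)"

definition invertible_op :: "('v \<Rightarrow> 'v) \<Rightarrow> bool" where
  "invertible_op T \<longleftrightarrow> (\<exists>S\<in>bounded_ops. S \<circ> T = id_op \<and> T \<circ> S = id_op)"

definition inverse_op :: "('v \<Rightarrow> 'v) \<Rightarrow> 'v \<Rightarrow> 'v" where
  "inverse_op T = (THE S. S \<in> bounded_ops \<and> S \<circ> T = id_op \<and> T \<circ> S = id_op)"

definition adjoint_op :: "('v \<Rightarrow> 'v) \<Rightarrow> 'v \<Rightarrow> 'v" where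
  "adjoint_op T = (THE S. S \<in> bounded_ops \<and> (\<forall>x\<in>H. \<forall>y\<in>H. ip (T x) y = ip x (S y)))"

definition spectrum_op :: "('v \<Rightarrow> 'v) \<Rightarrow> complex set" where
  "spectrum_op T = {c. \<not> invertible_op (\<lambda>x. T x - smul c (id_op x))}"

definition op_le :: "('v \<Rightarrow> 'v) \<Rightarrow> ('v \<Rightarrow> 'v) \<Rightarrow> bool" where
  "op_le A B \<longleftrightarrow> (\<forall>x\<in>H. ip (B x - A x) x \<in> \<real> \<and> 0 \<le> Re (ip (B x - A x) x))"

definition op_powi :: "('v \<Rightarrow> 'v) \<Rightarrow> int \<Rightarrow> 'v \<Rightarrow> 'v" where
  "op_powi T n = (if 0 \<le> n then T ^^ nat n else inverse_op T ^^ nat (- n)) \<circ> id_op"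

text \<open>\<open>\<phi>(T)\<close> is the sum of \<open>a\<^sub>n T\<^sup>n\<close> over all integers \<open>n\<close>, as an unconditional limit in operator
  norm.\<close>

definition fun_calc :: "real \<Rightarrow> (complex \<Rightarrow> complex) \<Rightarrow> ('v \<Rightarrow> 'v) \<Rightarrow> 'v \<Rightarrow> 'v" where
  "fun_calc r \<phi> T = (THE S. S \<in> bounded_ops \<and>
     ((\<lambda>F. op_norm (\<lambda>x. (\<Sum>n\<in>F. smul (laurent_coeff r \<phi> n) (op_powi T n x)) - S x))
        \<longlongrightarrow> 0) (finite_subsets_at_top UNIV))"

end

locale complex_hilbert_space = complex_inner_space smul H ip
  for smul :: "complex \<Rightarrow> 'v::ab_group_add \<Rightarrow> 'v" and H ip +
  assumes complete_H:
    "\<lbrakk>\<And>n. X n \<in> H; \<And>e. e > 0 \<Longrightarrow> \<exists>M. \<forall>m\<ge>M. \<forall>n\<ge>M. hnorm (X m - X n) < e\<rbrakk>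
      \<Longrightarrow> \<exists>x\<in>H. (\<lambda>n. hnorm (X n - x)) \<longlonglongrightarrow> 0"
begin

definition class_F_on :: "real \<Rightarrow> ('v \<Rightarrow> 'v) set" where
  "class_F_on r = {T \<in> bounded_ops. invertible_op T \<and> spectrum_op T \<subseteq> annulus r \<and>
     op_le (\<lambda>x. smul (of_real (r\<^sup>2)) (inverse_op T (adjoint_op (inverse_op T) x))
                 + T (adjoint_op T x))
           (\<lambda>x. smul (of_real (r\<^sup>2 + 1)) (id_op x))}"

end

text \<open>The operators of the class on all Hilbert spaces carried by subspaces of the given vector
  space. If that space is not finitely generated, Hilbert spaces of every finite dimension occur,
  which a supremum over the class needs.\<close>

definition class_F ::
  "(complex \<Rightarrow> 'v::ab_group_add \<Rightarrow> 'v) \<Rightarrow> real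
     \<Rightarrow> ('v set \<times> ('v \<Rightarrow> 'v \<Rightarrow> complex) \<times> ('v \<Rightarrow> 'v)) set" where
  "class_F smul r = {(H, ip, T). complex_hilbert_space smul H ip \<and>
                        T \<in> complex_hilbert_space.class_F_on smul H ip r}"

definition fun_calc_norm ::
  "(complex \<Rightarrow> 'v::ab_group_add \<Rightarrow> 'v) \<Rightarrow> real \<Rightarrow> (complex \<Rightarrow> complex)
     \<Rightarrow> 'v set \<times> ('v \<Rightarrow> 'v \<Rightarrow> complex) \<times> ('v \<Rightarrow> 'v) \<Rightarrow> real" where
  "fun_calc_norm smul r \<phi> = (\<lambda>(H, ip, T).
     complex_inner_space.op_norm H ip (complex_inner_space.fun_calc smul H ip r \<phi> T))"

end

theory Submission imports Defs "HOL-Library.Function_Algebras" begin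

text \<open>Write \<open>w\<^sub>n\<close> for the weights of the space, \<open>w\<^sub>n = 1\<close> for \<open>n \<ge> 0\<close> and \<open>w\<^sub>n = r\<^sup>2\<^sup>n\<close> for \<open>n < 0\<close>.

The bound by \<open>sqrt 2\<close> comes from \<open>w\<^sub>n \<le> 1 + r\<^sup>2\<^sup>n \<le> 2 w\<^sub>n\<close>. By Parseval, the sum of the
\<open>(1 + r\<^sup>2\<^sup>n) \<bar>a\<^sub>n\<bar>\<^sup>2\<close> is the sum of the means of \<open>\<bar>f\<bar>\<^sup>2\<close> over the two boundary circles, and there
multiplication by \<open>\<phi>\<close> has norm at most the supremum of \<open>\<bar>\<phi>\<bar>\<close> (\<open>H_infty_multiplication\<close>).
Multiplication by \<open>z\<^sup>n + r\<^sup>n z\<^sup>-\<^sup>n\<close> maps the unit vector \<open>1\<close> to a vector of norm \<open>sqrt 2\<close>, and this function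
is bounded by \<open>1 + r\<^sup>n\<close>, so that no smaller constant works (\<open>sqrt2_sharp\<close>).

Let \<open>T\<close> be in the class and let \<open>S\<close> be its adjoint. The class condition says that the defect form
\<open>q x = (r\<^sup>2 + 1) \<parallel>x\<parallel>\<^sup>2 - r\<^sup>2 \<parallel>S\<^sup>-\<^sup>1 x\<parallel>\<^sup>2 - \<parallel>S x\<parallel>\<^sup>2\<close> is nonnegative. The sum of \<open>q (S\<^sup>n x) / w\<^sub>n\<close> over all
integers telescopes to \<open>(1 - r\<^sup>2) \<parallel>x\<parallel>\<^sup>2\<close> (\<open>defect_sum_limit\<close>). Hence \<open>x \<mapsto> (S\<^sup>n x / w\<^sub>n)\<^sub>n\<close> is, up to a constant,
an isometry into the tensor product of the function space with \<open>(H, q)\<close>, and it carries the adjoint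
of \<open>\<phi>(T)\<close> to the adjoint of multiplication by \<open>\<phi>\<close>. A tensor factor does not increase the norm of an
operator; the factorization of Gram matrices (\<open>gram_factorization\<close>) reduces this to scalar sequences.
The result is \<open>fun_calc_norm_upper\<close>. The telescoping and the convergence of the calculus rest on the
exponential decay of \<open>S\<^sup>n\<close> and of \<open>r\<^sup>n S\<^sup>-\<^sup>n\<close>: the class condition bounds these powers, and the spectrum
avoids the boundary circles (\<open>power_bounded_decay\<close>).

Conversely, compress the shift \<open>f \<mapsto> z f\<close> to the span of finitely many reproducing kernels. The
adjoint of the compression is diagonal in the kernels, its defect form is a multiple of the squared
modulus of the sum of the coordinates, and the adjoint of \<open>\<phi>\<close> of the compression is the restriction of
the adjoint of multiplication by \<open>\<phi>\<close>. So the compressions lie in the class, and they exhaust the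
multiplier norm because kernels span a dense subspace (\<open>kernel_vectors_dense\<close>). They act on
finite-dimensional spaces and can therefore be placed on subspaces of any vector space of infinite
dimension (\<open>kernel_model\<close>).\<close>

section \<open>Laurent series on the annulus\<close>

lemma has_integral_cis_period:
  fixes n :: int
  shows "((\<lambda>x. cis (2 * pi * of_int n * x)) has_integral (if n = 0 then 1 else 0)) {0..1}"
proof (cases "n = 0")
  case True
  have "((\<lambda>x::real. 1::complex) has_integral 1) {0..1}"
    using has_integral_const_real[of "1::complex" 0 1] by simp
  then show ?thesis using True by (simp add: cis_zero)
next
  case False
  define c where "c = 2 * pi * of_int n"
  have c: "c \<noteq> 0" using False by (simp add: c_def)
  have "((\<lambda>x. cis (c * x)) has_integral (cis (c * 1) / (\<i> * c) - cis (c * 0) / (\<i> * c))) {0..1}"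
  proof (rule fundamental_theorem_of_calculus)
    fix x :: real assume "x \<in> {0..1}"
    have "((\<lambda>z. exp (\<i> * c * z) / (\<i> * c)) has_field_derivative exp (\<i> * c * of_real x)) (at (of_real x))"
      using c by (auto intro!: derivative_eq_intros)
    then have "((\<lambda>x. exp (\<i> * c * of_real x) / (\<i> * c)) has_vector_derivative exp (\<i> * c * of_real x)) (at x within {0..1})"
      by (rule has_vector_derivative_real_field)
    then show "((\<lambda>x. cis (c * x) / (\<i> * c)) has_vector_derivative cis (c * x)) (at x within {0..1})"
      by (simp add: cis_conv_exp mult.assoc)
  qed simp
  moreover have "cis (c * 1) = 1"
    unfolding c_def using cis_multiple_2pi[of "of_int n"] by simp
  ultimately show ?thesis using False by (simp add: c_def)
qed

lemma trig_polynomial_norm_square_integral: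
  fixes a :: "int \<Rightarrow> complex"
  assumes "finite F"
  shows "((\<lambda>x. (\<Sum>n\<in>F. a n * cis (2 * pi * of_int n * x)) * cnj (\<Sum>n\<in>F. a n * cis (2 * pi * of_int n * x)))
          has_integral of_real (\<Sum>n\<in>F. (cmod (a n))\<^sup>2)) {0..1}"
proof -
  have "((\<lambda>x. \<Sum>n\<in>F. \<Sum>m\<in>F. a n * cnj (a m) * cis (2 * pi * of_int (n - m) * x))
          has_integral (\<Sum>n\<in>F. \<Sum>m\<in>F. a n * cnj (a m) * (if n - m = 0 then 1 else 0))) {0..1}"
    by (intro has_integral_sum has_integral_mult_right has_integral_cis_period assms)
  moreover have "(\<Sum>n\<in>F. \<Sum>m\<in>F. a n * cnj (a m) * (if n - m = 0 then 1 else 0))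
      = of_real (\<Sum>n\<in>F. (cmod (a n))\<^sup>2)"
    using assms by (simp add: if_distrib[of "\<lambda>x. _ * x"] complex_norm_square[symmetric] cong: if_cong)
  moreover have "(\<Sum>n\<in>F. \<Sum>m\<in>F. a n * cnj (a m) * cis (2 * pi * of_int (n - m) * x))
     = (\<Sum>n\<in>F. a n * cis (2 * pi * of_int n * x)) * cnj (\<Sum>n\<in>F. a n * cis (2 * pi * of_int n * x))" for x
    by (simp add: sum_product cnj_sum cis_cnj cis_mult algebra_simps cong: sum.cong)
  ultimately show ?thesis by simp
qed

text \<open>Absolute convergence makes the partial sums converge uniformly on the circle, so the identity for
trigonometric polynomials passes to the limit.\<close>

lemma parseval_circle:
  fixes a :: "int \<Rightarrow> complex"
  assumes abs: "(\<lambda>n. cmod (a n)) summable_on UNIV"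
    and g: "\<And>x. ((\<lambda>n. a n * cis (2 * pi * of_int n * x)) has_sum g x) UNIV"
  obtains J where "((\<lambda>x. (cmod (g x))\<^sup>2) has_integral J) {0..1}" "((\<lambda>n. (cmod (a n))\<^sup>2) has_sum J) UNIV"
proof -
  define h where "h F x = (\<Sum>n\<in>F. a n * cis (2 * pi * of_int n * x))" for F x
  have u: "uniform_limit {0..1} h g (finite_subsets_at_top UNIV)"
    unfolding h_def
    by (rule Weierstrass_m_test_general'[where M = "\<lambda>n. cmod (a n)"])
       (use abs g in \<open>auto simp: norm_mult\<close>)
  have bg: "bounded (g ` {0..1})"
  proof (rule boundedI)
    fix z assume "z \<in> g ` {0..1}"
    then obtain x where z: "z = g x" by blast
    have "cmod (infsum (\<lambda>n. a n * cis (2 * pi * of_int n * x)) UNIV) \<le> (\<Sum>\<^sub>\<infinity>n. cmod (a n * cis (2 * pi * of_int n * x)))"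
      by (rule norm_infsum_bound) (use abs in \<open>simp add: norm_mult\<close>)
    then show "cmod z \<le> (\<Sum>\<^sub>\<infinity>n. cmod (a n))"
      using g[of x] z by (simp add: norm_mult infsumI)
  qed
  have cbg: "bounded ((\<lambda>x. cnj (g x)) ` {0..1})"
    using bg unfolding bounded_iff by auto
  have uc: "uniform_limit {0..1} (\<lambda>F x. cnj (h F x)) (\<lambda>x. cnj (g x)) (finite_subsets_at_top UNIV)"
    using u by (simp add: uniform_limit_iff dist_norm flip: complex_cnj_diff)
  have "uniform_limit {0..1} (\<lambda>F x. h F x * cnj (h F x)) (\<lambda>x. g x * cnj (g x)) (finite_subsets_at_top UNIV)"
    by (rule uniform_lim_mult[OF u uc bg cbg])
  moreover have "continuous_on {0..1} (\<lambda>x. h F x * cnj (h F x))" for F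
    unfolding h_def by (intro continuous_intros)
  ultimately obtain I J where I: "\<And>F. ((\<lambda>x. h F x * cnj (h F x)) has_integral I F) {0..1}"
    and J: "((\<lambda>x. g x * cnj (g x)) has_integral J) {0..1}"
    and lim: "(I \<longlongrightarrow> J) (finite_subsets_at_top UNIV)"
    by (rule uniform_limit_integral) auto
  have IF: "I F = of_real (\<Sum>n\<in>F. (cmod (a n))\<^sup>2)" if "finite F" for F
    using I[of F] trig_polynomial_norm_square_integral[OF that, of a]
    unfolding h_def by (rule has_integral_unique)
  have "\<forall>\<^sub>F F in finite_subsets_at_top UNIV. Re (I F) = (\<Sum>n\<in>F. (cmod (a n))\<^sup>2)"
    by (rule eventually_finite_subsets_at_top_weakI) (simp add: IF)
  then have "((\<lambda>F. \<Sum>n\<in>F. (cmod (a n))\<^sup>2) \<longlongrightarrow> Re J) (finite_subsets_at_top UNIV)"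
    by (rule Lim_transform_eventually[OF tendsto_Re[OF lim]])
  then have 1: "((\<lambda>n. (cmod (a n))\<^sup>2) has_sum Re J) UNIV"
    by (simp add: has_sum_def)
  have "((\<lambda>x. Re (g x * cnj (g x))) has_integral Re J) {0..1}"
    using has_integral_Re[OF J] .
  then have 2: "((\<lambda>x. (cmod (g x))\<^sup>2) has_integral Re J) {0..1}"
    by (simp add: complex_mult_cnj cmod_power2)
  show ?thesis using that 1 2 by blast
qed

lemma powi_polar:
  fixes t :: real and n :: int
  shows "(of_real t * cis (2 * pi * x)) powi n = of_real (t powi n) * cis (2 * pi * of_int n * x)"
  by (simp add: power_int_mult_distrib cis_power_int of_real_power_int mult.assoc)
     (simp add: mult.left_commute)

lemma in_annulus_polar: "0 \<le> r \<Longrightarrow> r < t \<Longrightarrow> t < 1 \<Longrightarrow> of_real t * cis x \<in> annulus r"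
  by (simp add: annulus_def norm_mult)

lemma laurent_abs_summable:
  assumes "\<And>z. cmod z = t \<Longrightarrow> (\<lambda>n. a n * z powi n) summable_on UNIV" "t > 0"
  shows "(\<lambda>n. cmod (a n) * t powi n) summable_on (UNIV::int set)"
proof -
  have "(\<lambda>n. cmod (a n * (of_real t) powi n)) summable_on (UNIV::int set)"
    using assms(1)[of "of_real t"] assms(2) by (simp flip: summable_on_iff_abs_summable_on_complex)
  then show ?thesis using assms(2) by (simp add: norm_mult norm_power_int)
qed

lemma laurent_parseval:
  fixes a :: "int \<Rightarrow> complex"
  assumes t: "0 < t" and f: "\<And>z. cmod z = t \<Longrightarrow> ((\<lambda>n. a n * z powi n) has_sum f z) UNIV"
  obtains J where "((\<lambda>x. (cmod (f (of_real t * cis (2 * pi * x))))\<^sup>2) has_integral J) {0..1}"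
    "((\<lambda>n. t powi (2 * n) * (cmod (a n))\<^sup>2) has_sum J) UNIV"
proof -
  have abs: "(\<lambda>n. cmod (a n * of_real (t powi n))) summable_on UNIV"
    using laurent_abs_summable[of t a] f t by (force simp: norm_mult has_sum_imp_summable norm_power_int)
  have "((\<lambda>n. a n * of_real (t powi n) * cis (2 * pi * of_int n * x)) has_sum f (of_real t * cis (2 * pi * x))) UNIV" for x
    using f[of "of_real t * cis (2 * pi * x)"] t unfolding powi_polar by (simp add: norm_mult mult.assoc)
  from parseval_circle[OF abs this] obtain J where
    "((\<lambda>x. (cmod (f (of_real t * cis (2 * pi * x))))\<^sup>2) has_integral J) {0..1}"
    "((\<lambda>n. (cmod (a n * of_real (t powi n)))\<^sup>2) has_sum J) UNIV" .
  moreover have "(cmod (a n * of_real (t powi n)))\<^sup>2 = t powi (2 * n) * (cmod (a n))\<^sup>2" for n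
    using t by (simp add: norm_mult power_mult_distrib norm_power_int power_int_mult mult.commute)
  ultimately show ?thesis using that by simp
qed

text \<open>By Parseval, the values on a single circle determine all coefficients.\<close>

lemma laurent_zero_unique:
  fixes a :: "int \<Rightarrow> complex"
  assumes t: "0 < t" and f: "\<And>z. cmod z = t \<Longrightarrow> ((\<lambda>n. a n * z powi n) has_sum 0) UNIV"
  shows "a n = 0"
proof -
  obtain J where J: "((\<lambda>x::real. (cmod 0)\<^sup>2) has_integral J) {0..1}"
    "((\<lambda>n. t powi (2 * n) * (cmod (a n))\<^sup>2) has_sum J) UNIV"
    by (rule laurent_parseval[OF t f]) auto
  have "J = 0" using J(1) by simp
  have "t powi (2 * n) * (cmod (a n))\<^sup>2 \<le> J"
    using finite_sum_le_has_sum[OF J(2), of "{n}"] t by simp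
  with \<open>J = 0\<close> have "t powi (2 * n) * (cmod (a n))\<^sup>2 = 0" using t
    by (smt (verit) mult_nonneg_nonneg zero_le_power2 zero_le_power_int)
  then show ?thesis using t by (simp)
qed

lemma laurent_unique:
  fixes a b :: "int \<Rightarrow> complex"
  assumes t: "0 < t" and "\<And>z. cmod z = t \<Longrightarrow> ((\<lambda>n. a n * z powi n) has_sum f z) UNIV"
    "\<And>z. cmod z = t \<Longrightarrow> ((\<lambda>n. b n * z powi n) has_sum f z) UNIV"
  shows "a = b"
proof
  fix n
  have "((\<lambda>n. (a n - b n) * z powi n) has_sum 0) UNIV" if "cmod z = t" for z
    using has_sum_add[OF assms(2)[OF that] has_sum_uminusI[OF assms(3)[OF that]]] by (simp add: algebra_simps)
  from laurent_zero_unique[OF t this, of n] show "a n = b n" by simp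
qed

text \<open>Radial segments join the two circles inside the closed annulus, so the circles are homotopic in \<open>S\<close>.\<close>

lemma contour_integral_circlepath_annulus:
  assumes "g holomorphic_on S" "open S" "0 < \<rho>" "\<rho> \<le> R"
    and sub: "{z. \<rho> \<le> cmod z \<and> cmod z \<le> R} \<subseteq> S"
  shows "contour_integral (circlepath 0 \<rho>) g = contour_integral (circlepath 0 R) g"
proof (rule Cauchy_theorem_homotopic_loops)
  show "homotopic_loops S (circlepath 0 \<rho>) (circlepath 0 R)"
  proof (rule homotopic_loops_linear)
    fix t :: real
    have "closed_segment (circlepath 0 \<rho> t) (circlepath 0 R t) \<subseteq> {z. \<rho> \<le> cmod z \<and> cmod z \<le> R}"
    proof
      fix x assume "x \<in> closed_segment (circlepath 0 \<rho> t) (circlepath 0 R t)"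
      then obtain u where u: "0 \<le> u" "u \<le> 1" and x: "x = (1 - u) *\<^sub>R circlepath 0 \<rho> t + u *\<^sub>R circlepath 0 R t"
        by (auto simp: closed_segment_def)
      have "x = of_real ((1 - u) * \<rho> + u * R) * exp (2 * of_real pi * \<i> * of_real t)"
        unfolding x circlepath by (simp add: scaleR_conv_of_real algebra_simps)
      then have "cmod x = \<bar>(1 - u) * \<rho> + u * R\<bar>" by (simp only: norm_mult norm_of_real norm_exp_eq_Re) simp
      moreover have "\<rho> \<le> (1 - u) * \<rho> + u * R" "(1 - u) * \<rho> + u * R \<le> R"
        using mult_left_mono[OF assms(4) u(1)] mult_left_mono[OF assms(4), of "1 - u"] u(2)
        by (auto simp: algebra_simps)
      ultimately show "x \<in> {z. \<rho> \<le> cmod z \<and> cmod z \<le> R}" using assms(3) by auto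
    qed
    with sub show "closed_segment (circlepath 0 \<rho> t) (circlepath 0 R t) \<subseteq> S" by blast
  qed auto
qed (use assms in auto)

text \<open>The difference quotient of \<open>f\<close> at \<open>w\<close> extends holomorphically over \<open>w\<close>, so its integrals over both
circles agree. The integral of \<open>1 / (z - w)\<close> is \<open>2 \<pi> \<i>\<close> over the outer circle and \<open>0\<close> over the inner one.\<close>

lemma cauchy_formula_annulus:
  assumes f: "f holomorphic_on S" "open S" and \<rho>: "0 < \<rho>" "\<rho> < cmod w" "cmod w < R"
    and sub: "{z. \<rho> \<le> cmod z \<and> cmod z \<le> R} \<subseteq> S"
  shows "contour_integral (circlepath 0 R) (\<lambda>z. f z / (z - w)) - contour_integral (circlepath 0 \<rho>) (\<lambda>z. f z / (z - w))
          = 2 * of_real pi * \<i> * f w"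
proof -
  define g where "g z = (if z = w then deriv f w else (f z - f w) / (z - w))" for z
  have g: "g holomorphic_on S" unfolding g_def using pole_lemma_open[OF f] by simp
  have eq: "contour_integral (circlepath 0 \<rho>) g = contour_integral (circlepath 0 R) g"
    by (rule contour_integral_circlepath_annulus[OF g f(2)]) (use \<rho> sub in auto)
  have R: "0 < R" using \<rho> by linarith
  have split: "contour_integral (circlepath 0 s) g = contour_integral (circlepath 0 s) (\<lambda>z. f z / (z - w)) - f w * contour_integral (circlepath 0 s) (\<lambda>z. 1 / (z - w))"
    if s: "s = \<rho> \<or> s = R" for s
  proof -
    have sw: "z \<noteq> w" if "z \<in> sphere 0 s" for z using that s \<rho> by auto
    have sp: "sphere 0 s \<subseteq> S" using s \<rho> R sub by auto
    have s0: "0 < s" using s \<rho> R by auto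
    have c: "continuous_on (sphere 0 s) f"
      using f(1) sp by (meson holomorphic_on_imp_continuous_on continuous_on_subset)
    have i1: "(\<lambda>z. f z / (z - w)) contour_integrable_on circlepath 0 s"
      using sw s0 by (intro contour_integrable_continuous_circlepath) (auto intro!: continuous_intros c)
    have i2: "(\<lambda>z. 1 / (z - w)) contour_integrable_on circlepath 0 s"
      using sw s0 by (intro contour_integrable_continuous_circlepath) (auto intro!: continuous_intros)
    have "contour_integral (circlepath 0 s) g = contour_integral (circlepath 0 s) (\<lambda>z. f z / (z - w) - f w * (1 / (z - w)))"
      by (rule contour_integral_cong) (use sw s0 in \<open>auto simp: g_def path_image_circlepath diff_divide_distrib\<close>)
    also have "\<dots> = contour_integral (circlepath 0 s) (\<lambda>z. f z / (z - w)) - f w * contour_integral (circlepath 0 s) (\<lambda>z. 1 / (z - w))"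
      using i1 i2 by (simp only: contour_integral_diff contour_integrable_lmul contour_integral_lmul)
    finally show ?thesis .
  qed
  have "contour_integral (circlepath 0 R) (\<lambda>z. 1 / (z - w)) = 2 * of_real pi * \<i>"
    using Cauchy_integral_circlepath_simple[of "\<lambda>_. 1" 0 R w] \<rho>
    by (auto intro!: contour_integral_unique)
  moreover have "contour_integral (circlepath 0 \<rho>) (\<lambda>z. 1 / (z - w)) = 0"
  proof (rule contour_integral_unique, rule Cauchy_theorem_disc_simple)
    show "(\<lambda>z. 1 / (z - w)) holomorphic_on ball 0 (cmod w)"
      by (intro holomorphic_intros) auto
    show "path_image (circlepath 0 \<rho>) \<subseteq> ball 0 (cmod w)" using \<rho> by (auto simp: path_image_circlepath)
  qed auto
  ultimately show ?thesis using eq split[of \<rho>] split[of R] by (simp add: algebra_simps)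
qed

text \<open>With \<open>q z = w / z\<close> on the outer circle this yields the regular part of the Laurent series, with
\<open>q z = z / w\<close> on the inner circle the principal part.\<close>

lemma contour_integral_geometric:
  assumes c: "continuous_on (sphere 0 s) f" "continuous_on (sphere 0 s) q" and s: "0 < s"
    and q: "\<And>z. cmod z = s \<Longrightarrow> cmod (q z) = p" "p < 1"
  shows "(\<lambda>k. contour_integral (circlepath 0 s) (\<lambda>z. f z * q z ^ k)) sums
            contour_integral (circlepath 0 s) (\<lambda>z. f z / (1 - q z))"
proof -
  have q1: "q z \<noteq> 1" if "cmod z = s" for z using q(1)[OF that] q(2) by auto
  obtain M where "\<forall>z\<in>sphere 0 s. cmod (f z) \<le> M"
    using compact_imp_bounded[OF compact_continuous_image[OF c(1)]] by (auto simp: bounded_iff)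
  then have M: "\<And>z. z \<in> sphere 0 s \<Longrightarrow> cmod (f z) \<le> M" by blast
  have p: "0 \<le> p" using q(1)[of "of_real s"] s by (auto simp: abs_if split: if_splits)
  have "uniform_limit (sphere 0 s) (\<lambda>n z. \<Sum>k<n. f z * q z ^ k) (\<lambda>z. \<Sum>k. f z * q z ^ k) sequentially"
  proof (rule Weierstrass_m_test)
    show "cmod (f z * q z ^ n) \<le> M * p ^ n" if "z \<in> sphere 0 s" for n z
      using that M[OF that] q(1)[of z] p by (auto simp: norm_mult norm_power intro!: mult_right_mono)
    show "summable (\<lambda>n. M * p ^ n)" using p q(2) by (intro summable_mult summable_geometric) auto
  qed
  moreover have "(\<Sum>k. f z * q z ^ k) = f z / (1 - q z)" if "z \<in> sphere 0 s" for z
  proof -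
    have "cmod (q z) < 1" using that q by auto
    then show ?thesis using suminf_mult[OF summable_geometric[of "q z"]] suminf_geometric[of "q z"] by simp
  qed
  ultimately have ul: "uniform_limit (sphere 0 s) (\<lambda>n z. \<Sum>k<n. f z * q z ^ k) (\<lambda>z. f z / (1 - q z)) sequentially"
    using uniform_limit_cong'[of "sphere 0 s" "\<lambda>n z. \<Sum>k<n. f z * q z ^ k" "\<lambda>n z. \<Sum>k<n. f z * q z ^ k"
        "\<lambda>z. \<Sum>k. f z * q z ^ k" "\<lambda>z. f z / (1 - q z)"] by simp
  have int: "(\<lambda>z. f z * q z ^ k) contour_integrable_on circlepath 0 s" for k
    using s by (intro contour_integrable_continuous_circlepath) (auto intro!: continuous_intros c)
  have "(\<lambda>n. contour_integral (circlepath 0 s) (\<lambda>z. \<Sum>k<n. f z * q z ^ k)) \<longlonglongrightarrow>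
            contour_integral (circlepath 0 s) (\<lambda>z. f z / (1 - q z))"
    by (rule contour_integral_uniform_limit_circlepath(2)[OF _ ul])
       (use s int in \<open>auto intro!: contour_integrable_sum always_eventually\<close>)
  then show ?thesis unfolding sums_def by (simp add: contour_integral_sum int)
qed

lemma has_sum_int_split:
  fixes f :: "int \<Rightarrow> complex"
  assumes "((\<lambda>k. f (int k)) has_sum p) UNIV" "((\<lambda>k. f (- int k - 1)) has_sum q) UNIV"
  shows "(f has_sum (p + q)) UNIV"
proof -
  have u: "UNIV = range int \<union> range (\<lambda>k. - int k - 1)"
  proof -
    have "x \<in> range int \<union> range (\<lambda>k. - int k - 1)" for x :: int
    proof (cases "x \<ge> 0")
      case True then show ?thesis by (metis UnI1 nat_0_le rangeI)
    next
      case False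
      then have "x = - int (nat (- x - 1)) - 1" by simp
      then show ?thesis by blast
    qed
    then show ?thesis by blast
  qed
  have "(f has_sum p) (range int)" using assms(1)
    by (subst has_sum_reindex) (auto simp: o_def inj_on_def)
  moreover have "(f has_sum q) (range (\<lambda>k. - int k - 1))" using assms(2)
    by (subst has_sum_reindex) (auto simp: o_def inj_on_def)
  moreover have "range int \<inter> range (\<lambda>k. - int k - 1) = {}" by auto
  ultimately show ?thesis using has_sum_Un_disjoint u by metis
qed

lemma powser_has_sum:
  fixes c :: "nat \<Rightarrow> complex"
  assumes "(\<lambda>k. c k * w ^ k) sums s" "summable (\<lambda>k. c k * v ^ k)" "cmod w < cmod v"
  shows "((\<lambda>k. c k * w ^ k) has_sum s) UNIV"
  by (rule norm_summable_imp_has_sum[OF powser_insidea[OF assms(2,3)] assms(1)])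

text \<open>The coefficient integrals do not depend on the radius of the circle. Each \<open>w\<close> may therefore use its own
pair of circles in Cauchy's formula and still gets the same coefficients.\<close>

lemma laurent_expansion_exists:
  assumes f: "f holomorphic_on annulus r" and r: "0 < r" "r < 1"
  obtains a where "\<And>w. w \<in> annulus r \<Longrightarrow> ((\<lambda>n. a n * w powi n) has_sum f w) UNIV"
proof -
  have op: "open (annulus r)"
  proof -
    have "annulus r = {z. r < cmod z} \<inter> {z. cmod z < 1}" by (auto simp: annulus_def)
    then show ?thesis by (auto intro!: open_Int open_Collect_less continuous_intros)
  qed
  define I where "I s n = contour_integral (circlepath 0 s) (\<lambda>z. f z * z powi (- n - 1))" for s :: real and n :: int
  have I: "I s n = I s' n" if "r < s" "s \<le> s'" "s' < 1" for s s' n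
    unfolding I_def
  proof (rule contour_integral_circlepath_annulus[OF _ op])
    show "(\<lambda>z. f z * z powi (- n - 1)) holomorphic_on annulus r"
      using r by (intro holomorphic_intros f) (auto simp: annulus_def)
  qed (use that r in \<open>auto simp: annulus_def\<close>)
  define s0 where "s0 = (r + 1) / 2"
  have I0: "I s n = I s0 n" if "r < s" "s < 1" for s n
  proof (cases "s \<le> s0")
    case True
    then show ?thesis by (rule I[OF that(1)]) (use r in \<open>simp add: s0_def\<close>)
  next
    case False
    then have "I s0 n = I s n" by (intro I) (use r that in \<open>auto simp: s0_def\<close>)
    then show ?thesis by simp
  qed
  have cont: "continuous_on (sphere 0 s) f" if "r < s" "s < 1" for s
    using holomorphic_on_imp_continuous_on[OF f] that
    by (rule_tac continuous_on_subset) (auto simp: annulus_def)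
  have outer: "(\<lambda>k. I s0 (int k) * w ^ k) sums contour_integral (circlepath 0 R) (\<lambda>z. f z / (z - w))"
    if R: "r < R" "R < 1" "cmod w < R" for w R
  proof -
    have R0: "0 < R" using R r by linarith
    have "(\<lambda>k. contour_integral (circlepath 0 R) (\<lambda>z. (f z / z) * (w / z) ^ k)) sums
       contour_integral (circlepath 0 R) (\<lambda>z. (f z / z) / (1 - w / z))"
      by (rule contour_integral_geometric[where p = "cmod w / R"])
         (use R R0 in \<open>auto intro!: continuous_on_divide continuous_on_id continuous_on_const cont simp: norm_divide\<close>)
    moreover have "contour_integral (circlepath 0 R) (\<lambda>z. (f z / z) / (1 - w / z)) = contour_integral (circlepath 0 R) (\<lambda>z. f z / (z - w))"
      by (rule contour_integral_cong) (use R R0 in \<open>auto simp: path_image_circlepath field_simps\<close>)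
    moreover have "contour_integral (circlepath 0 R) (\<lambda>z. (f z / z) * (w / z) ^ k) = I s0 (int k) * w ^ k" for k
    proof -
      have "contour_integral (circlepath 0 R) (\<lambda>z. (f z / z) * (w / z) ^ k) = contour_integral (circlepath 0 R) (\<lambda>z. f z * z powi (- int k - 1) * w ^ k)"
        by (rule contour_integral_cong)
           (use R R0 in \<open>auto simp: path_image_circlepath field_simps power_int_diff power_int_minus\<close>)
      also have "\<dots> = I R (int k) * w ^ k"
        unfolding I_def using R R0
        by (intro contour_integral_rmul contour_integrable_continuous_circlepath) (auto intro!: continuous_intros cont)
      finally show ?thesis using I0[of R] R by simp
    qed
    ultimately show ?thesis by simp
  qed
  have inner: "(\<lambda>k. I s0 (- int k - 1) * (1 / w) ^ Suc k) sums (- contour_integral (circlepath 0 \<rho>) (\<lambda>z. f z / (z - w)))"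
    if R: "r < \<rho>" "\<rho> < 1" "\<rho> < cmod w" for w \<rho>
  proof -
    have R0: "0 < \<rho>" and w0: "w \<noteq> 0" using R r by auto
    have "(\<lambda>k. contour_integral (circlepath 0 \<rho>) (\<lambda>z. (f z / w) * (z / w) ^ k)) sums
       contour_integral (circlepath 0 \<rho>) (\<lambda>z. (f z / w) / (1 - z / w))"
      by (rule contour_integral_geometric[where p = "\<rho> / cmod w"])
         (use R R0 w0 in \<open>auto intro!: continuous_intros cont simp: norm_divide field_simps\<close>)
    moreover have "contour_integral (circlepath 0 \<rho>) (\<lambda>z. (f z / w) / (1 - z / w)) = contour_integral (circlepath 0 \<rho>) (\<lambda>z. - (f z / (z - w)))"
    proof (rule contour_integral_cong)
      fix z assume "z \<in> path_image (circlepath 0 \<rho>)"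
      then have "z \<noteq> w" using R R0 by (auto simp: path_image_circlepath)
      then show "(f z / w) / (1 - z / w) = - (f z / (z - w))" using w0
        by (simp add: divide_simps) (simp add: algebra_simps)
    qed simp
    moreover have "contour_integral (circlepath 0 \<rho>) (\<lambda>z. - (f z / (z - w))) = - contour_integral (circlepath 0 \<rho>) (\<lambda>z. f z / (z - w))"
      by (rule contour_integral_neg)
    moreover have "contour_integral (circlepath 0 \<rho>) (\<lambda>z. (f z / w) * (z / w) ^ k) = I s0 (- int k - 1) * (1 / w) ^ Suc k" for k
    proof -
      have "contour_integral (circlepath 0 \<rho>) (\<lambda>z. (f z / w) * (z / w) ^ k) = contour_integral (circlepath 0 \<rho>) (\<lambda>z. f z * z powi (- (- int k - 1) - 1) * (1 / w) ^ Suc k)"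
        by (rule contour_integral_cong)
           (use w0 in \<open>auto simp: field_simps\<close>)
      also have "\<dots> = I \<rho> (- int k - 1) * (1 / w) ^ Suc k"
        unfolding I_def using R R0
        by (intro contour_integral_rmul contour_integrable_continuous_circlepath) (auto intro!: continuous_intros cont)
      finally show ?thesis using I0[of \<rho>] R by simp
    qed
    ultimately show ?thesis by simp
  qed
  have "((\<lambda>n. I s0 n / (2 * of_real pi * \<i>) * w powi n) has_sum f w) UNIV" if w: "w \<in> annulus r" for w
  proof -
    define R where "R = (cmod w + 1) / 2"
    define \<rho> where "\<rho> = (cmod w + r) / 2"
    have R: "r < R" "R < 1" "cmod w < R" and \<rho>: "r < \<rho>" "\<rho> < 1" "\<rho> < cmod w"
      using w r by (auto simp: annulus_def R_def \<rho>_def)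
    have w0: "w \<noteq> 0" using w r by (auto simp: annulus_def)
    \<comment> \<open>Convergence at \<open>v\<close>, outside \<open>w\<close>, and at \<open>u\<close>, inside \<open>w\<close>, gives absolute convergence at \<open>w\<close>.\<close>
    define v where "v = complex_of_real ((cmod w + R) / 2)"
    have "cmod v = (cmod w + R) / 2" unfolding v_def norm_of_real using R r by (intro abs_of_nonneg) auto
    then have v: "cmod w < cmod v" "cmod v < R" using R by auto
    define u where "u = complex_of_real ((cmod w + \<rho>) / 2)"
    have "cmod u = (cmod w + \<rho>) / 2" unfolding u_def norm_of_real using \<rho> r by (intro abs_of_nonneg) auto
    then have u: "cmod u < cmod w" "\<rho> < cmod u" using \<rho> by auto
    have "((\<lambda>k. I s0 (int k) * w ^ k) has_sum contour_integral (circlepath 0 R) (\<lambda>z. f z / (z - w))) UNIV"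
      by (rule powser_has_sum[OF outer[OF R] sums_summable[OF outer[OF R(1,2) v(2)]] v(1)])
    moreover
    have "((\<lambda>k. I s0 (- int k - 1) * (1 / w) ^ Suc k) has_sum (- contour_integral (circlepath 0 \<rho>) (\<lambda>z. f z / (z - w)))) UNIV"
    proof (rule norm_summable_imp_has_sum[OF _ inner[OF \<rho>]])
      have "summable (\<lambda>k. I s0 (- int k - 1) * (1 / u) ^ Suc k)"
        using inner[OF \<rho>(1,2) u(2)] sums_summable by blast
      then have "summable (\<lambda>k. u * (I s0 (- int k - 1) * (1 / u) ^ Suc k))" by (rule summable_mult)
      moreover have "u \<noteq> 0" using u \<rho> r by auto
      ultimately have "summable (\<lambda>k. I s0 (- int k - 1) * (1 / u) ^ k)" by simp
      then have "summable (\<lambda>k. norm (I s0 (- int k - 1) * (1 / w) ^ k))"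
      proof (rule powser_insidea)
        have "0 < cmod u" using u \<rho> r by linarith
        then have "inverse (cmod w) < inverse (cmod u)" using u by (intro less_imp_inverse_less) auto
        then show "cmod (1 / w) < cmod (1 / u)" by (simp add: norm_divide inverse_eq_divide)
      qed
      then have "summable (\<lambda>k. norm (1 / w) * norm (I s0 (- int k - 1) * (1 / w) ^ k))" by (rule summable_mult)
      then show "summable (\<lambda>k. norm (I s0 (- int k - 1) * (1 / w) ^ Suc k))"
        by (simp only: norm_mult power_Suc mult.left_commute)
    qed
    moreover have "w powi (- int k - 1) = (1 / w) ^ Suc k" for k
    proof -
      have "- int k - 1 = - int (Suc k)" by simp
      then have "w powi (- int k - 1) = w powi (- int (Suc k))" by (rule arg_cong)
      then show ?thesis by (simp only: power_int_minus power_int_of_nat power_one_over inverse_eq_divide)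
    qed
    ultimately have "((\<lambda>n. I s0 n * w powi n) has_sum (contour_integral (circlepath 0 R) (\<lambda>z. f z / (z - w)) + (- contour_integral (circlepath 0 \<rho>) (\<lambda>z. f z / (z - w))))) UNIV"
      by (intro has_sum_int_split) (simp_all only: power_int_of_nat)
    moreover have "contour_integral (circlepath 0 R) (\<lambda>z. f z / (z - w)) - contour_integral (circlepath 0 \<rho>) (\<lambda>z. f z / (z - w))
          = 2 * of_real pi * \<i> * f w"
      by (rule cauchy_formula_annulus[OF f op]) (use R \<rho> r in \<open>auto simp: annulus_def\<close>)
    ultimately have "((\<lambda>n. I s0 n * w powi n) has_sum (2 * of_real pi * \<i> * f w)) UNIV" by simp
    from has_sum_cmult_right[OF this, of "1 / (2 * of_real pi * \<i>)"]
    show ?thesis by (simp add: field_simps)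
  qed
  then show ?thesis using that[of "\<lambda>n. I s0 n / (2 * of_real pi * \<i>)"] by blast
qed


section \<open>Multipliers of the Hardy space of the annulus\<close>

lemma laurent_coeff_has_sum:
  assumes "f holomorphic_on annulus r" "0 < r" "r < 1" "z \<in> annulus r"
  shows "((\<lambda>n. laurent_coeff r f n * z powi n) has_sum f z) UNIV"
proof -
  obtain a where a: "\<And>w. w \<in> annulus r \<Longrightarrow> ((\<lambda>n. a n * w powi n) has_sum f w) UNIV"
    using laurent_expansion_exists[OF assms(1-3)] by blast
  have "\<forall>z\<in>annulus r. ((\<lambda>n. laurent_coeff r f n * z powi n) has_sum f z) UNIV"
    unfolding laurent_coeff_def
  proof (rule theI[where a = a])
    show "\<forall>z\<in>annulus r. ((\<lambda>n. a n * z powi n) has_sum f z) UNIV" using a by blast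
    fix b assume b: "\<forall>z\<in>annulus r. ((\<lambda>n. b n * z powi n) has_sum f z) UNIV"
    show "b = a"
      by (rule laurent_unique[of "(r + 1) / 2" _ f]) (use a b assms in \<open>auto simp: annulus_def\<close>)
  qed
  then show ?thesis using assms by blast
qed

lemma laurent_coeff_eqI:
  assumes "0 < r" "r < 1" "\<And>z. z \<in> annulus r \<Longrightarrow> ((\<lambda>n. a n * z powi n) has_sum f z) UNIV"
  shows "laurent_coeff r f = a"
  unfolding laurent_coeff_def
proof (rule the_equality)
  fix b assume b: "\<forall>z\<in>annulus r. ((\<lambda>n. b n * z powi n) has_sum f z) UNIV"
  show "b = a"
    by (rule laurent_unique[of "(r + 1) / 2" _ f]) (use assms b in \<open>auto simp: annulus_def\<close>)
qed (use assms in blast)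

lemma H2_weight_pos: "0 < r \<Longrightarrow> 0 < H2_weight r n"
  by (simp add: H2_weight_def)

text \<open>Together with \<open>powi_le_H2_weight\<close> this compares the norm of the space with mean values over circles close
to the boundary.\<close>

lemma H2_weight_le_boundary: "0 < r \<Longrightarrow> H2_weight r n \<le> 1 + r powi (2 * n)"
  by (simp add: H2_weight_def)

lemma powi_le_H2_weight:
  assumes "0 < r" "r \<le> t" "t \<le> 1"
  shows "t powi (2 * n) \<le> H2_weight r n"
proof (cases "n \<le> -1")
  case True
  have "t powi (2 * n) = inverse (t ^ nat (- 2 * n))" using True by (simp add: power_int_def power_inverse)
  also have "\<dots> \<le> inverse (r ^ nat (- 2 * n))"
    using assms by (intro le_imp_inverse_le power_mono) auto
  also have "\<dots> = H2_weight r n" using True by (simp add: power_int_def power_inverse H2_weight_def)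
  finally show ?thesis .
next
  case False
  then show ?thesis using assms by (simp add: H2_weight_def power_int_def power_le_one)
qed

lemma H2_norm_nonneg: "0 < r \<Longrightarrow> 0 \<le> H2_norm r f"
  unfolding H2_norm_def by (intro real_sqrt_ge_zero infsum_nonneg mult_nonneg_nonneg) (auto intro: less_imp_le H2_weight_pos)

lemma H2_norm_square:
  "0 < r \<Longrightarrow> (H2_norm r f)\<^sup>2 = (\<Sum>\<^sub>\<infinity>n. H2_weight r n * (cmod (laurent_coeff r f n))\<^sup>2)"
  unfolding H2_norm_def
  by (intro real_sqrt_pow2 infsum_nonneg mult_nonneg_nonneg) (auto intro: less_imp_le H2_weight_pos)

lemma H2_finite_sum_le:
  assumes "0 < r" "f \<in> H2 r" "finite F"
  shows "(\<Sum>n\<in>F. H2_weight r n * (cmod (laurent_coeff r f n))\<^sup>2) \<le> (H2_norm r f)\<^sup>2"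
  unfolding H2_norm_square[OF assms(1)]
  by (rule finite_sum_le_infsum) (use assms in \<open>auto simp: H2_def intro!: mult_nonneg_nonneg less_imp_le[OF H2_weight_pos]\<close>)

lemma H_infty_bound:
  assumes "\<phi> \<in> H_infty r" "z \<in> annulus r"
  shows "cmod (\<phi> z) \<le> H_infty_norm r \<phi>"
proof -
  have "bdd_above ((\<lambda>z. cmod (\<phi> z)) ` annulus r)"
    using assms(1) by (force simp: H_infty_def bounded_iff bdd_above_def)
  then show ?thesis unfolding H_infty_norm_def using assms(2) by (rule cSUP_upper2) simp
qed

lemma annulus_nonempty: "0 < r \<Longrightarrow> r < 1 \<Longrightarrow> of_real ((r + 1) / 2) \<in> annulus r"
  unfolding annulus_def mem_Collect_eq norm_of_real by auto

lemma H_infty_norm_nonneg: "\<phi> \<in> H_infty r \<Longrightarrow> 0 < r \<Longrightarrow> r < 1 \<Longrightarrow> 0 \<le> H_infty_norm r \<phi>"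
  using H_infty_bound[OF _ annulus_nonempty, of \<phi> r] norm_ge_zero by (meson order_trans)

text \<open>Parseval on the circle of radius \<open>t\<close>, for \<open>f\<close> and for \<open>\<phi> f\<close>, turns the pointwise bound on \<open>\<phi>\<close> into a
bound on coefficients.\<close>

lemma circle_multiplication_bound:
  assumes r: "0 < r" "r < 1" and t: "r < t" "t < 1"
    and \<phi>: "\<phi> \<in> H_infty r" and f: "f holomorphic_on annulus r" and F: "finite F"
  shows "(\<Sum>n\<in>F. t powi (2 * n) * (cmod (laurent_coeff r (\<lambda>z. \<phi> z * f z) n))\<^sup>2)
     \<le> (H_infty_norm r \<phi>)\<^sup>2 * (\<Sum>\<^sub>\<infinity>n. t powi (2 * n) * (cmod (laurent_coeff r f n))\<^sup>2)"
proof -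
  have t0: "0 < t" and ta: "\<And>z. cmod z = t \<Longrightarrow> z \<in> annulus r" using r t by (auto simp: annulus_def)
  have h: "(\<lambda>z. \<phi> z * f z) holomorphic_on annulus r"
    using \<phi> f by (auto simp: H_infty_def intro: holomorphic_intros)
  obtain J where J: "((\<lambda>x. (cmod (f (of_real t * cis (2 * pi * x))))\<^sup>2) has_integral J) {0..1}"
    "((\<lambda>n. t powi (2 * n) * (cmod (laurent_coeff r f n))\<^sup>2) has_sum J) UNIV"
    by (rule laurent_parseval[OF t0 laurent_coeff_has_sum[OF f r ta]]) auto
  obtain K where K: "((\<lambda>x. (cmod (\<phi> (of_real t * cis (2 * pi * x)) * f (of_real t * cis (2 * pi * x))))\<^sup>2) has_integral K) {0..1}"
    "((\<lambda>n. t powi (2 * n) * (cmod (laurent_coeff r (\<lambda>z. \<phi> z * f z) n))\<^sup>2) has_sum K) UNIV"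
    by (rule laurent_parseval[OF t0 laurent_coeff_has_sum[OF h r ta]]) auto
  have "K \<le> (H_infty_norm r \<phi>)\<^sup>2 * J"
  proof (rule has_integral_le[OF K(1) has_integral_mult_right[OF J(1)]])
    fix x :: real
    have "cmod (\<phi> (of_real t * cis (2 * pi * x))) \<le> H_infty_norm r \<phi>"
      by (rule H_infty_bound[OF \<phi>]) (use r t in \<open>auto intro: in_annulus_polar\<close>)
    then show "(cmod (\<phi> (of_real t * cis (2 * pi * x)) * f (of_real t * cis (2 * pi * x))))\<^sup>2
        \<le> (H_infty_norm r \<phi>)\<^sup>2 * (cmod (f (of_real t * cis (2 * pi * x))))\<^sup>2"
      by (auto simp: norm_mult power_mult_distrib intro!: mult_right_mono power_mono)
  qed
  moreover have "(\<Sum>n\<in>F. t powi (2 * n) * (cmod (laurent_coeff r (\<lambda>z. \<phi> z * f z) n))\<^sup>2) \<le> K"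
    using t0 by (intro finite_sum_le_has_sum[OF K(2) F]) auto
  moreover have "J = (\<Sum>\<^sub>\<infinity>n. t powi (2 * n) * (cmod (laurent_coeff r f n))\<^sup>2)"
    using J(2) by (simp add: infsumI)
  ultimately show ?thesis by simp
qed

text \<open>The circle estimates for the radii \<open>1\<close> and \<open>r\<close> add up: on the left the sum dominates the norm of
\<open>\<phi> f\<close>, and on the right each of the two contributes the norm of \<open>f\<close> once. This is the origin of the
factor \<open>2\<close> for the squared norms.\<close>

lemma H_infty_multiplication:
  assumes r: "0 < r" "r < 1" and \<phi>: "\<phi> \<in> H_infty r" and f: "f \<in> H2 r"
  shows "(\<lambda>z. \<phi> z * f z) \<in> H2 r"
    and "H2_norm r (\<lambda>z. \<phi> z * f z) \<le> sqrt 2 * H_infty_norm r \<phi> * H2_norm r f"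
proof -
  define M where "M = H_infty_norm r \<phi>"
  define a where "a = laurent_coeff r f"
  define b where "b = laurent_coeff r (\<lambda>z. \<phi> z * f z)"
  have fh: "f holomorphic_on annulus r" and sf: "(\<lambda>n. H2_weight r n * (cmod (a n))\<^sup>2) summable_on UNIV"
    using f by (auto simp: H2_def a_def)
  have wp: "0 \<le> H2_weight r n" for n using H2_weight_pos[OF r(1)] less_imp_le by blast
  have one: "(\<Sum>n\<in>F. t powi (2 * n) * (cmod (b n))\<^sup>2) \<le> M\<^sup>2 * (H2_norm r f)\<^sup>2" if "r < t" "t < 1" "finite F" for t F
  proof -
    have "(\<Sum>\<^sub>\<infinity>n. t powi (2 * n) * (cmod (a n))\<^sup>2) \<le> (\<Sum>\<^sub>\<infinity>n. H2_weight r n * (cmod (a n))\<^sup>2)"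
    proof (rule infsum_mono[OF _ sf])
      show "(\<lambda>n. t powi (2 * n) * (cmod (a n))\<^sup>2) summable_on UNIV"
        by (rule summable_on_comparison_test[OF sf])
           (use that r in \<open>auto intro!: mult_right_mono powi_le_H2_weight\<close>)
    qed (use that r in \<open>auto intro!: mult_right_mono powi_le_H2_weight\<close>)
    then have "M\<^sup>2 * (\<Sum>\<^sub>\<infinity>n. t powi (2 * n) * (cmod (a n))\<^sup>2) \<le> M\<^sup>2 * (H2_norm r f)\<^sup>2"
      unfolding H2_norm_square[OF r(1)] a_def by (intro mult_left_mono) auto
    then show ?thesis
      using circle_multiplication_bound[OF r that(1,2) \<phi> fh that(3)] unfolding a_def b_def M_def by linarith
  qed
  have lim: "(\<Sum>n\<in>F. c powi (2 * n) * (cmod (b n))\<^sup>2) \<le> M\<^sup>2 * (H2_norm r f)\<^sup>2" if "c = r \<or> c = 1" "finite F" for c F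
  proof -
    \<comment> \<open>Radii in the open annulus that tend to the boundary radius \<open>c\<close>.\<close>
    define t where "t k = c + (if c = r then 1 else -1) * ((1 - r) / real (Suc (Suc k)))" for k
    have tk: "r < t k" "t k < 1" for k
    proof -
      define u where "u = (1 - r) / real (Suc (Suc k))"
      have "0 < u" using r by (simp add: u_def)
      moreover have "u \<le> (1 - r) / 2"
        unfolding u_def using r by (intro divide_left_mono) auto
      ultimately show "r < t k" "t k < 1" using that r unfolding t_def u_def[symmetric] by (auto split: if_splits)
    qed
    have "(\<lambda>k. (1 - r) / real (Suc (Suc k))) \<longlonglongrightarrow> 0"
      using LIMSEQ_Suc[OF LIMSEQ_Suc[OF lim_const_over_n[of "1 - r"]]] by simp
    from tendsto_mult[OF tendsto_const[of "if c = r then 1 else -1"] this]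
    have tl: "t \<longlonglongrightarrow> c" unfolding t_def using tendsto_add[OF tendsto_const[of c], of _ 0] by force
    have "(\<lambda>k. \<Sum>n\<in>F. t k powi (2 * n) * (cmod (b n))\<^sup>2) \<longlonglongrightarrow> (\<Sum>n\<in>F. c powi (2 * n) * (cmod (b n))\<^sup>2)"
      using that r by (intro tendsto_intros tl) auto
    then show ?thesis by (rule LIMSEQ_le_const2) (use one[OF tk that(2)] in blast)
  qed
  have fin: "(\<Sum>n\<in>F. H2_weight r n * (cmod (b n))\<^sup>2) \<le> 2 * M\<^sup>2 * (H2_norm r f)\<^sup>2" if F: "finite F" for F
  proof -
    have "(\<Sum>n\<in>F. H2_weight r n * (cmod (b n))\<^sup>2) \<le> (\<Sum>n\<in>F. 1 powi (2 * n) * (cmod (b n))\<^sup>2 + r powi (2 * n) * (cmod (b n))\<^sup>2)"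
      using mult_right_mono[OF H2_weight_le_boundary[OF r(1)] zero_le_power2]
      by (intro sum_mono) (simp add: distrib_right)
    also have "\<dots> \<le> 2 * M\<^sup>2 * (H2_norm r f)\<^sup>2"
      unfolding sum.distrib using lim[of r F] lim[of 1 F] F by auto
    finally show ?thesis .
  qed
  have sb: "(\<lambda>n. H2_weight r n * (cmod (b n))\<^sup>2) summable_on UNIV"
  proof (rule nonneg_bdd_above_summable_on)
    show "bdd_above (sum (\<lambda>n. H2_weight r n * (cmod (b n))\<^sup>2) ` {F. F \<subseteq> UNIV \<and> finite F})"
      by (rule bdd_aboveI2) (use fin in blast)
  qed (simp add: wp)
  have "(\<lambda>z. \<phi> z * f z) holomorphic_on annulus r"
    using \<phi> fh by (auto simp: H_infty_def intro: holomorphic_intros)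
  with sb show "(\<lambda>z. \<phi> z * f z) \<in> H2 r" by (simp add: H2_def b_def)
  have "(H2_norm r (\<lambda>z. \<phi> z * f z))\<^sup>2 \<le> 2 * M\<^sup>2 * (H2_norm r f)\<^sup>2"
    unfolding H2_norm_square[OF r(1)] b_def[symmetric]
    using infsum_le_finite_sums[OF sb] fin unfolding H2_norm_square[OF r(1)] by blast
  also have "\<dots> = (sqrt 2 * M * H2_norm r f)\<^sup>2" by (simp add: power_mult_distrib)
  finally show "H2_norm r (\<lambda>z. \<phi> z * f z) \<le> sqrt 2 * H_infty_norm r \<phi> * H2_norm r f"
    unfolding M_def[symmetric]
    by (rule power2_le_imp_le) (use H_infty_norm_nonneg[OF \<phi> r] H2_norm_nonneg[OF r(1)] M_def in auto)
qed

lemma H_infty_subset_Mult: "0 < r \<Longrightarrow> r < 1 \<Longrightarrow> \<phi> \<in> H_infty r \<Longrightarrow> \<phi> \<in> Mult r"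
  unfolding Mult_def using H_infty_multiplication by blast

lemma laurent_coeff_cmult:
  assumes "0 < r" "r < 1" "f holomorphic_on annulus r"
  shows "laurent_coeff r (\<lambda>z. c * f z) = (\<lambda>n. c * laurent_coeff r f n)"
  using has_sum_cmult_right[OF laurent_coeff_has_sum[OF assms(3,1,2)], of _ c]
  by (intro laurent_coeff_eqI[OF assms(1,2)]) (simp add: mult.assoc)

lemma H2_cmult:
  assumes "0 < r" "r < 1" "f \<in> H2 r"
  shows "(\<lambda>z. c * f z) \<in> H2 r" "H2_norm r (\<lambda>z. c * f z) = cmod c * H2_norm r f"
proof -
  have f: "f holomorphic_on annulus r" "(\<lambda>n. H2_weight r n * (cmod (laurent_coeff r f n))\<^sup>2) summable_on UNIV"
    using assms by (auto simp: H2_def)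
  have eq: "H2_weight r n * (cmod (c * laurent_coeff r f n))\<^sup>2 = (cmod c)\<^sup>2 * (H2_weight r n * (cmod (laurent_coeff r f n))\<^sup>2)" for n
    by (simp add: norm_mult power_mult_distrib)
  show "(\<lambda>z. c * f z) \<in> H2 r"
    unfolding H2_def using f by (auto simp: laurent_coeff_cmult[OF assms(1,2)] eq intro!: holomorphic_intros summable_on_cmult_right)
  show "H2_norm r (\<lambda>z. c * f z) = cmod c * H2_norm r f"
    unfolding H2_norm_def laurent_coeff_cmult[OF assms(1,2) f(1)] eq
    by (simp add: infsum_cmult_right' real_sqrt_mult)
qed

lemma laurent_coeff_monomials:
  assumes "0 < r" "r < 1" "finite F"
  shows "laurent_coeff r (\<lambda>z. \<Sum>n\<in>F. h n * z powi n) = (\<lambda>n. if n \<in> F then h n else 0)"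
proof (rule laurent_coeff_eqI[OF assms(1,2)])
  fix z
  show "((\<lambda>n. (if n \<in> F then h n else 0) * z powi n) has_sum (\<Sum>n\<in>F. h n * z powi n)) UNIV"
    by (rule has_sum_finite_neutralI[OF assms(3)]) auto
qed

lemma monomials_H2:
  assumes "0 < r" "r < 1" "finite F"
  shows "(\<lambda>z. \<Sum>n\<in>F. h n * z powi n) \<in> H2 r"
    "(H2_norm r (\<lambda>z. \<Sum>n\<in>F. h n * z powi n))\<^sup>2 = (\<Sum>n\<in>F. H2_weight r n * (cmod (h n))\<^sup>2)"
proof -
  have s: "((\<lambda>n. H2_weight r n * (cmod (if n \<in> F then h n else 0))\<^sup>2) has_sum (\<Sum>n\<in>F. H2_weight r n * (cmod (h n))\<^sup>2)) UNIV"
    by (rule has_sum_finite_neutralI[OF assms(3)]) auto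
  show "(H2_norm r (\<lambda>z. \<Sum>n\<in>F. h n * z powi n))\<^sup>2 = (\<Sum>n\<in>F. H2_weight r n * (cmod (h n))\<^sup>2)"
    unfolding H2_norm_square[OF assms(1)] laurent_coeff_monomials[OF assms] using s by (rule infsumI)
  show "(\<lambda>z. \<Sum>n\<in>F. h n * z powi n) \<in> H2 r"
    unfolding H2_def mem_Collect_eq laurent_coeff_monomials[OF assms]
    using s has_sum_imp_summable assms(1) by (auto intro!: holomorphic_intros simp: annulus_def)
qed

lemma has_sum_sum:
  fixes f :: "'i \<Rightarrow> 'a \<Rightarrow> 'b::topological_comm_monoid_add"
  assumes "\<And>i. i \<in> F \<Longrightarrow> (f i has_sum s i) A"
  shows "((\<lambda>x. \<Sum>i\<in>F. f i x) has_sum (\<Sum>i\<in>F. s i)) A"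
proof -
  have "((\<lambda>X. \<Sum>i\<in>F. \<Sum>x\<in>X. f i x) \<longlongrightarrow> (\<Sum>i\<in>F. s i)) (finite_subsets_at_top A)"
    using assms by (intro tendsto_sum) (simp add: has_sum_def)
  moreover have "(\<lambda>X. \<Sum>i\<in>F. \<Sum>x\<in>X. f i x) = (\<lambda>X. \<Sum>x\<in>X. \<Sum>i\<in>F. f i x)"
    by (intro ext sum.swap)
  ultimately show ?thesis unfolding has_sum_def by simp
qed

lemma laurent_coeff_mult_monomials:
  assumes "0 < r" "r < 1" "finite F" "\<phi> holomorphic_on annulus r"
  shows "laurent_coeff r (\<lambda>z. \<phi> z * (\<Sum>n\<in>F. h n * z powi n)) = (\<lambda>m. \<Sum>n\<in>F. laurent_coeff r \<phi> (m - n) * h n)"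
proof (rule laurent_coeff_eqI[OF assms(1,2)])
  fix z assume z: "z \<in> annulus r"
  have z0: "z \<noteq> 0" using z assms by (auto simp: annulus_def)
  have "((\<lambda>m. laurent_coeff r \<phi> (m - n) * h n * z powi m) has_sum (\<phi> z * (h n * z powi n))) UNIV" for n
  proof -
    have "((\<lambda>m. laurent_coeff r \<phi> (m - n) * z powi (m - n)) has_sum \<phi> z) UNIV"
      by (subst has_sum_reindex_bij_witness[where T = UNIV and h = "\<lambda>m. laurent_coeff r \<phi> m * z powi m" and i = "\<lambda>m. m + n" and j = "\<lambda>m. m - n"])
         (use laurent_coeff_has_sum[OF assms(4,1,2) z] in auto)
    from has_sum_cmult_left[OF this, of "h n * z powi n"]
    show ?thesis using z0 by (simp add: power_int_diff field_simps)
  qed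
  then have "((\<lambda>m. \<Sum>n\<in>F. laurent_coeff r \<phi> (m - n) * h n * z powi m) has_sum (\<Sum>n\<in>F. \<phi> z * (h n * z powi n))) UNIV"
    by (intro has_sum_sum)
  then show "((\<lambda>m. (\<Sum>n\<in>F. laurent_coeff r \<phi> (m - n) * h n) * z powi m) has_sum (\<phi> z * (\<Sum>n\<in>F. h n * z powi n))) UNIV"
    by (simp add: sum_distrib_left sum_distrib_right)
qed

lemma zero_H2:
  assumes "0 < r" "r < 1"
  shows "(\<lambda>z. 0) \<in> H2 r" "H2_norm r (\<lambda>z. 0) = 0"
  using monomials_H2[OF assms, of "{}" "\<lambda>_. 0"] by simp_all

context
  fixes r \<phi> assumes r: "0 < r" "r < 1" and \<phi>: "\<phi> \<in> H_infty r"
begin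

lemma Mult_norm_upper_unit:
  assumes "f \<in> H2 r" "H2_norm r f \<le> 1"
  shows "H2_norm r (\<lambda>z. \<phi> z * f z) \<le> Mult_norm r \<phi>"
proof -
  have "bdd_above ((\<lambda>f. H2_norm r (\<lambda>z. \<phi> z * f z)) ` {f \<in> H2 r. H2_norm r f \<le> 1})"
  proof (rule bdd_aboveI2)
    fix f assume f: "f \<in> {f \<in> H2 r. H2_norm r f \<le> 1}"
    then have "H2_norm r (\<lambda>z. \<phi> z * f z) \<le> sqrt 2 * H_infty_norm r \<phi> * H2_norm r f"
      using H_infty_multiplication[OF r \<phi>] by blast
    also have "\<dots> \<le> sqrt 2 * H_infty_norm r \<phi> * 1"
      using f H_infty_norm_nonneg[OF \<phi> r] by (intro mult_left_mono) auto
    finally show "H2_norm r (\<lambda>z. \<phi> z * f z) \<le> sqrt 2 * H_infty_norm r \<phi>" by simp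
  qed
  then show ?thesis unfolding Mult_norm_def by (rule cSUP_upper[rotated]) (simp add: assms)
qed

lemma Mult_norm_nonneg: "0 \<le> Mult_norm r \<phi>"
proof -
  have "H2_norm r (\<lambda>z. \<phi> z * 0) \<le> Mult_norm r \<phi>"
    by (rule Mult_norm_upper_unit) (simp_all add: zero_H2 r)
  with H2_norm_nonneg[OF r(1)] show ?thesis by (rule order_trans)
qed

lemma Mult_norm_upper:
  assumes f: "f \<in> H2 r"
  shows "H2_norm r (\<lambda>z. \<phi> z * f z) \<le> Mult_norm r \<phi> * H2_norm r f"
proof (cases "H2_norm r f = 0")
  case True
  then show ?thesis using H_infty_multiplication(2)[OF r \<phi> f] by simp
next
  case False
  define c where "c = H2_norm r f"
  have c: "0 < c" using False H2_norm_nonneg[OF r(1), of f] by (simp add: c_def)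
  have "H2_norm r (\<lambda>z. \<phi> z * (of_real (1 / c) * f z)) \<le> Mult_norm r \<phi>"
  proof (rule Mult_norm_upper_unit)
    show "(\<lambda>z. of_real (1 / c) * f z) \<in> H2 r" by (rule H2_cmult(1)[OF r f])
    show "H2_norm r (\<lambda>z. of_real (1 / c) * f z) \<le> 1"
      unfolding H2_cmult(2)[OF r f] norm_of_real using c by (simp add: c_def)
  qed
  also have "(\<lambda>z. \<phi> z * (of_real (1 / c) * f z)) = (\<lambda>z. of_real (1 / c) * (\<phi> z * f z))" by (simp add: fun_eq_iff)
  finally show ?thesis using c unfolding H2_cmult(2)[OF r H_infty_multiplication(1)[OF r \<phi> f]]
    by (simp add: norm_divide c_def field_simps)
qed

lemma Mult_norm_le_sqrt2: "Mult_norm r \<phi> \<le> sqrt 2 * H_infty_norm r \<phi>"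
  unfolding Mult_norm_def
proof (rule cSUP_least)
  have "(\<lambda>z. 0) \<in> {f \<in> H2 r. H2_norm r f \<le> 1}"
    by (simp add: zero_H2 r)
  then show "{f \<in> H2 r. H2_norm r f \<le> 1} \<noteq> {}" by blast
  fix f assume f: "f \<in> {f \<in> H2 r. H2_norm r f \<le> 1}"
  then have "H2_norm r (\<lambda>z. \<phi> z * f z) \<le> sqrt 2 * H_infty_norm r \<phi> * H2_norm r f"
    using H_infty_multiplication[OF r \<phi>] by blast
  also have "\<dots> \<le> sqrt 2 * H_infty_norm r \<phi> * 1"
    using f H_infty_norm_nonneg[OF \<phi> r] by (intro mult_left_mono) auto
  finally show "H2_norm r (\<lambda>z. \<phi> z * f z) \<le> sqrt 2 * H_infty_norm r \<phi>" by simp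
qed

text \<open>This is the bound on the adjoint of multiplication by \<open>\<phi>\<close>, for the weights \<open>1 / w\<^sub>n\<close> of the dual
sequence space. Multiplication by \<open>\<phi>\<close> is tested on the Laurent polynomial that represents the truncated
adjoint of \<open>c\<close>. Pairing the product with \<open>c\<close> returns the left side, so the Cauchy-Schwarz inequality closes
the estimate.\<close>

lemma multiplier_adjoint_bound:
  assumes F: "finite F" and J: "finite J"
  shows "(\<Sum>n\<in>F. (cmod (\<Sum>j\<in>J. cnj (laurent_coeff r \<phi> (j - n)) * c j))\<^sup>2 / H2_weight r n)
          \<le> (Mult_norm r \<phi>)\<^sup>2 * (\<Sum>j\<in>J. (cmod (c j))\<^sup>2 / H2_weight r j)"
proof -
  define a where "a = laurent_coeff r \<phi>"
  define w where "w = H2_weight r"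
  define g where "g n = (\<Sum>j\<in>J. cnj (a (j - n)) * c j)" for n
  define h where "h n = g n / of_real (w n)" for n
  define b where "b m = (\<Sum>n\<in>F. a (m - n) * h n)" for m
  define X where "X = (\<Sum>n\<in>F. (cmod (g n))\<^sup>2 / w n)"
  define C where "C = (\<Sum>j\<in>J. (cmod (c j))\<^sup>2 / w j)"
  define M where "M = Mult_norm r \<phi>"
  have wp: "0 < w n" for n using H2_weight_pos[OF r(1)] by (simp add: w_def)
  have hol: "\<phi> holomorphic_on annulus r" using \<phi> by (simp add: H_infty_def)
  let ?h = "\<lambda>z. \<Sum>n\<in>F. h n * z powi n"
  have hn: "(H2_norm r ?h)\<^sup>2 = X"
    unfolding monomials_H2(2)[OF r F] X_def w_def[symmetric]
    using wp by (intro sum.cong) (auto simp: h_def norm_divide power_divide power2_eq_square abs_of_pos)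
  have "(\<Sum>m\<in>J. w m * (cmod (b m))\<^sup>2) \<le> (H2_norm r (\<lambda>z. \<phi> z * ?h z))\<^sup>2"
    using H2_finite_sum_le[OF r(1) H_infty_multiplication(1)[OF r \<phi> monomials_H2(1)[OF r F, of h]] J]
    unfolding laurent_coeff_mult_monomials[OF r F hol] by (simp add: a_def w_def b_def)
  also have "\<dots> \<le> (M * H2_norm r ?h)\<^sup>2"
    unfolding M_def by (intro power_mono Mult_norm_upper monomials_H2 r F H2_norm_nonneg)
  finally have B: "(\<Sum>m\<in>J. w m * (cmod (b m))\<^sup>2) \<le> M\<^sup>2 * X" by (simp add: power_mult_distrib hn)
  have "of_real X = (\<Sum>n\<in>F. h n * cnj (g n))"
    unfolding X_def h_def of_real_sum of_real_divide by (simp only: complex_norm_square times_divide_eq_left)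
  also have "\<dots> = (\<Sum>n\<in>F. \<Sum>j\<in>J. cnj (c j) * (a (j - n) * h n))"
    unfolding g_def by (simp add: sum_distrib_left cnj_sum mult_ac)
  also have "\<dots> = (\<Sum>j\<in>J. cnj (c j) * b j)"
    by (subst sum.swap) (simp add: b_def sum_distrib_left)
  finally have "cmod (of_real X) = cmod (\<Sum>j\<in>J. cnj (c j) * b j)" by simp
  also have "\<dots> \<le> (\<Sum>j\<in>J. (cmod (c j) / sqrt (w j)) * (sqrt (w j) * cmod (b j)))"
    by (rule order_trans[OF norm_sum]) (use wp in \<open>auto simp: norm_mult less_imp_neq[OF wp, symmetric]\<close>)
  finally have "X \<le> (\<Sum>j\<in>J. (cmod (c j) / sqrt (w j)) * (sqrt (w j) * cmod (b j)))" by simp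
  moreover have X0: "0 \<le> X" unfolding X_def using wp by (intro sum_nonneg divide_nonneg_pos) auto
  ultimately have "X\<^sup>2 \<le> (\<Sum>j\<in>J. (cmod (c j) / sqrt (w j)) * (sqrt (w j) * cmod (b j)))\<^sup>2"
    by (intro power_mono)
  also have "\<dots> \<le> (\<Sum>j\<in>J. (cmod (c j) / sqrt (w j))\<^sup>2) * (\<Sum>j\<in>J. (sqrt (w j) * cmod (b j))\<^sup>2)"
    by (rule Cauchy_Schwarz_ineq_sum)
  also have "\<dots> = C * (\<Sum>m\<in>J. w m * (cmod (b m))\<^sup>2)"
    unfolding C_def using wp by (simp add: power_divide power_mult_distrib less_imp_le)
  also have "\<dots> \<le> C * (M\<^sup>2 * X)"
    using B unfolding C_def by (intro mult_left_mono sum_nonneg divide_nonneg_pos) (auto intro: wp)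
  finally have "X * X \<le> (M\<^sup>2 * C) * X" by (simp add: power2_eq_square mult_ac)
  moreover have "0 \<le> M\<^sup>2 * C" unfolding C_def using wp by (intro mult_nonneg_nonneg sum_nonneg divide_nonneg_pos) auto
  ultimately have "X \<le> M\<^sup>2 * C" using X0 by (cases "X = 0") auto
  then show ?thesis unfolding X_def C_def g_def a_def w_def M_def .
qed

end

text \<open>The test functions \<open>z\<^sup>k + r\<^sup>k z\<^sup>-\<^sup>k\<close> are sums of two orthogonal unit vectors. Their modulus is at most
\<open>1 + r\<^sup>k\<close> since \<open>y + r\<^sup>k / y \<le> 1 + r\<^sup>k\<close> for \<open>r\<^sup>k \<le> y \<le> 1\<close>.\<close>

lemma sqrt2_sharp:
  assumes r: "0 < r" "r < 1" and C: "\<forall>\<phi>\<in>H_infty r. Mult_norm r \<phi> \<le> C * H_infty_norm r \<phi>"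
  shows "sqrt 2 \<le> C"
proof -
  have key: "sqrt 2 \<le> C * (1 + r ^ k)" if k: "0 < k" for k :: nat
  proof -
    define h where "h n = (if n = int k then 1 else complex_of_real (r ^ k))" for n
    define \<phi> where "\<phi> = (\<lambda>z. \<Sum>n\<in>{int k, - int k}. h n * z powi n)"
    have bound: "cmod (\<phi> z) \<le> 1 + r ^ k" if "z \<in> annulus r" for z
    proof -
      define y where "y = cmod z ^ k"
      have zc: "r < cmod z" "cmod z < 1" "0 < cmod z" using that r by (auto simp: annulus_def)
      have y: "r ^ k \<le> y" "y \<le> 1" "0 < y"
        unfolding y_def using zc r by (intro power_mono power_le_one zero_less_power; simp)+
      have "cmod (\<phi> z) \<le> cmod (z powi int k) + cmod (of_real (r ^ k) * z powi (- int k))"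
        unfolding \<phi>_def h_def using k by (simp add: norm_triangle_ineq)
      also have "\<dots> = y + r ^ k / y"
        using r by (simp add: norm_mult norm_power norm_power_int power_int_minus y_def divide_inverse norm_inverse)
      also have "\<dots> \<le> 1 + r ^ k"
      proof -
        have "0 \<le> (1 - y) * (y - r ^ k)" using y by auto
        then have "y * y + r ^ k \<le> (1 + r ^ k) * y" by (simp add: algebra_simps)
        then have "(y * y + r ^ k) / y \<le> 1 + r ^ k" using y by (simp add: divide_le_eq)
        then show ?thesis using y by (simp add: add_divide_distrib)
      qed
      finally show ?thesis .
    qed
    have H2: "\<phi> \<in> H2 r" "(H2_norm r \<phi>)\<^sup>2 = (\<Sum>n\<in>{int k, - int k}. H2_weight r n * (cmod (h n))\<^sup>2)"
      unfolding \<phi>_def by (intro monomials_H2 r; simp)+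
    have Hi: "\<phi> \<in> H_infty r"
      using H2(1) bound unfolding H_infty_def H2_def by (auto intro!: boundedI)
    have "(H2_norm r \<phi>)\<^sup>2 = 1 + r powi (2 * - int k) * (r ^ k)\<^sup>2"
      unfolding H2(2) using k r by (simp add: h_def H2_weight_def norm_power)
    also have "\<dots> = 2" using r by (simp add: power_int_minus power_int_mult power_even_eq power_mult[symmetric] mult.commute)
    finally have "H2_norm r \<phi> = sqrt 2" using H2_norm_nonneg[OF r(1)] by (metis real_sqrt_unique)
    moreover have "H2_norm r (\<lambda>z. \<phi> z * (\<Sum>n\<in>{0}. 1 * z powi n)) \<le> Mult_norm r \<phi> * H2_norm r (\<lambda>z. \<Sum>n\<in>{0}. 1 * z powi n)"
      by (intro Mult_norm_upper r Hi monomials_H2) simp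
    moreover have "(H2_norm r (\<lambda>z. \<Sum>n\<in>{0}. 1 * z powi n))\<^sup>2 = 1"
      using monomials_H2(2)[OF r, of "{0}" "\<lambda>_. 1"] by (simp add: H2_weight_def)
    then have "H2_norm r (\<lambda>z. \<Sum>n\<in>{0}. 1 * z powi n) = 1"
      using H2_norm_nonneg[OF r(1)] by (metis real_sqrt_unique real_sqrt_one)
    ultimately have "sqrt 2 \<le> Mult_norm r \<phi>" by simp
    also have "\<dots> \<le> C * H_infty_norm r \<phi>" using C Hi by blast
    finally have s: "sqrt 2 \<le> C * H_infty_norm r \<phi>" .
    have N: "H_infty_norm r \<phi> \<le> 1 + r ^ k"
      unfolding H_infty_norm_def using annulus_nonempty[OF r] bound by (intro cSUP_least) auto
    have "0 < C * H_infty_norm r \<phi>" using s by (smt (verit) real_sqrt_gt_0_iff)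
    then have "0 < C" using H_infty_norm_nonneg[OF Hi r] by (simp add: zero_less_mult_iff)
    then have "C * H_infty_norm r \<phi> \<le> C * (1 + r ^ k)" using N by (intro mult_left_mono) auto
    then show ?thesis using s by simp
  qed
  have "(\<lambda>k. C * (1 + r ^ k)) \<longlonglongrightarrow> C * (1 + 0)"
    using r by (intro tendsto_intros LIMSEQ_power_zero) auto
  then have "sqrt 2 \<le> C * (1 + 0)"
    by (rule LIMSEQ_le_const) (use key in \<open>auto intro!: exI[of _ 1]\<close>)
  then show ?thesis by simp
qed


section \<open>Semi-inner products and Hilbert spaces\<close>

text \<open>Definiteness is left out because the defect form of an operator of the class can be degenerate.\<close>

locale semi_inner_space = vector_space smul
  for smul :: "complex \<Rightarrow> 'v::ab_group_add \<Rightarrow> 'v" +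
  fixes H :: "'v set" and s :: "'v \<Rightarrow> 'v \<Rightarrow> complex"
  assumes sub: "subspace H"
    and s_add: "\<lbrakk>x \<in> H; y \<in> H; z \<in> H\<rbrakk> \<Longrightarrow> s (x + y) z = s x z + s y z"
    and s_smul: "\<lbrakk>x \<in> H; y \<in> H\<rbrakk> \<Longrightarrow> s (smul c x) y = c * s x y"
    and s_cnj: "\<lbrakk>x \<in> H; y \<in> H\<rbrakk> \<Longrightarrow> s y x = cnj (s x y)"
    and s_nonneg: "x \<in> H \<Longrightarrow> 0 \<le> Re (s x x)"
begin

lemma H_add [simp]: "x \<in> H \<Longrightarrow> y \<in> H \<Longrightarrow> x + y \<in> H" using sub by (rule subspace_add)
lemma H_smul [simp]: "x \<in> H \<Longrightarrow> smul c x \<in> H" using sub by (rule subspace_scale)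
lemma H_diff [simp]: "x \<in> H \<Longrightarrow> y \<in> H \<Longrightarrow> x - y \<in> H" using sub by (rule subspace_diff)
lemma H_zero [simp]: "0 \<in> H" using sub by (rule subspace_0)
lemma H_sum [simp]: "(\<And>i. i \<in> F \<Longrightarrow> f i \<in> H) \<Longrightarrow> (\<Sum>i\<in>F. f i) \<in> H" using sub by (rule subspace_sum)

lemma s_add_right: "\<lbrakk>x \<in> H; y \<in> H; z \<in> H\<rbrakk> \<Longrightarrow> s z (x + y) = s z x + s z y"
  using s_add[of x y z] s_cnj[of "x + y" z] s_cnj[of x z] s_cnj[of y z] by simp

lemma s_smul_right: "\<lbrakk>x \<in> H; y \<in> H\<rbrakk> \<Longrightarrow> s x (smul c y) = cnj c * s x y"
  using s_smul[of y x c] s_cnj[of "smul c y" x] s_cnj[of y x] by simp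

lemma s_diff: assumes "x \<in> H" "y \<in> H" "z \<in> H" shows "s (x - y) z = s x z - s y z"
  using s_add[of "x - y" y z] assms by (simp add: eq_diff_eq)

lemma s_diff_right: assumes "x \<in> H" "y \<in> H" "z \<in> H" shows "s z (x - y) = s z x - s z y"
  using s_add_right[of "x - y" y z] assms by (simp add: eq_diff_eq)

lemma s_zero: "x \<in> H \<Longrightarrow> s 0 x = 0" "x \<in> H \<Longrightarrow> s x 0 = 0"
  using s_diff[of x x x] s_diff_right[of x x x] by auto

lemma s_sum: "(\<And>i. i \<in> F \<Longrightarrow> f i \<in> H) \<Longrightarrow> z \<in> H \<Longrightarrow> s (\<Sum>i\<in>F. f i) z = (\<Sum>i\<in>F. s (f i) z)"
  by (induction F rule: infinite_finite_induct) (auto simp: s_zero s_add)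

lemma s_sum_right: "(\<And>i. i \<in> F \<Longrightarrow> f i \<in> H) \<Longrightarrow> z \<in> H \<Longrightarrow> s z (\<Sum>i\<in>F. f i) = (\<Sum>i\<in>F. s z (f i))"
  by (induction F rule: infinite_finite_induct) (auto simp: s_zero s_add_right)

lemma s_self: "x \<in> H \<Longrightarrow> s x x = of_real (Re (s x x))"
  using s_cnj[of x x] by (simp add: complex_eq_iff)

lemma cauchy_schwarz_semi:
  assumes x: "x \<in> H" and y: "y \<in> H"
  shows "(cmod (s x y))\<^sup>2 \<le> Re (s x x) * Re (s y y)"
proof -
  define a where "a = s x y"
  have yx: "s y x = cnj a" using s_cnj[OF x y] by (simp add: a_def)
  have expand: "Re (s (x - smul c y) (x - smul c y)) = Re (s x x) - 2 * Re (cnj c * a) + (cmod c)\<^sup>2 * Re (s y y)" for c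
  proof -
    have "s (x - smul c y) (x - smul c y) = s x x - cnj c * a - c * cnj a + c * cnj c * s y y"
      using x y by (simp add: s_diff s_diff_right s_smul s_smul_right yx a_def algebra_simps)
    moreover have "c * cnj c * s y y = of_real ((cmod c)\<^sup>2 * Re (s y y))"
      using s_self[OF y] by (metis complex_norm_square of_real_mult)
    ultimately show ?thesis by simp
  qed
  have re: "Re (cnj (of_real t * a) * a) = t * (cmod a)\<^sup>2" for t
    unfolding cmod_power2 by (simp add: power2_eq_square algebra_simps)
  show ?thesis
  proof (cases "Re (s y y) = 0")
    case True
    have "a = 0"
    proof (rule ccontr)
      assume "a \<noteq> 0"
      \<comment> \<open>This multiple of \<open>y\<close> would make the square of a vector equal to \<open>-1\<close>.\<close>
      define t where "t = (Re (s x x) + 1) / (2 * (cmod a)\<^sup>2)"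
      have "0 \<le> Re (s (x - smul (of_real t * a) y) (x - smul (of_real t * a) y))" using x y by (intro s_nonneg) auto
      also have "\<dots> = Re (s x x) - 2 * t * (cmod a)\<^sup>2"
        unfolding expand True re by simp
      also have "\<dots> = -1" using \<open>a \<noteq> 0\<close> by (simp add: t_def field_simps)
      finally show False by simp
    qed
    then show ?thesis using True by (simp add: a_def)
  next
    case False
    define N where "N = Re (s y y)"
    have N: "0 < N" using False s_nonneg[OF y] by (simp add: N_def)
    have "0 \<le> Re (s (x - smul (of_real (1 / N) * a) y) (x - smul (of_real (1 / N) * a) y))" using x y by (intro s_nonneg) auto
    also have "\<dots> = Re (s x x) - (cmod a)\<^sup>2 / N"
      unfolding expand re N_def[symmetric] using N
      by (simp add: norm_mult norm_divide power_mult_distrib power_divide field_simps power2_eq_square)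
    finally show ?thesis using N by (simp add: field_simps a_def N_def)
  qed
qed

text \<open>Gram-Schmidt: the rows of \<open>c\<close> are coordinates of the \<open>u i\<close> with respect to an orthonormal family. An
inequality for sequences of scalars thereby extends to sequences of vectors, one coordinate at a time.\<close>

lemma gram_factorization:
  assumes "finite J" "\<And>i. i \<in> J \<Longrightarrow> u i \<in> H"
  shows "\<exists>(d::nat) c. \<forall>i\<in>J. \<forall>j\<in>J. s (u i) (u j) = (\<Sum>l<d. c i l * cnj (c j l))"
  using assms
proof (induction J arbitrary: u)
  case empty
  then show ?case by auto
next
  case (insert k J)
  define N where "N = Re (s (u k) (u k))"
  have uk: "u k \<in> H" using insert by auto
  have kk: "s (u k) (u k) = of_real N" using s_self[OF uk] by (simp add: N_def)
  have N0: "0 \<le> N" using s_nonneg[OF uk] by (simp add: N_def)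
  define u' where "u' i = u i - smul (s (u i) (u k) / of_real N) (u k)" for i
  have u': "u' i \<in> H" if "i \<in> J" for i using that insert uk by (auto simp: u'_def)
  obtain d :: nat and c where c: "\<And>i j. i \<in> J \<Longrightarrow> j \<in> J \<Longrightarrow> s (u' i) (u' j) = (\<Sum>l<d. c i l * cnj (c j l))"
    using insert.IH[of u', OF u'] by blast
  \<comment> \<open>If \<open>N = 0\<close>, division by zero makes \<open>u' = u\<close> and the last column zero; both are right because then
      \<open>u k\<close> is orthogonal to everything by the Cauchy-Schwarz inequality.\<close>
  define c' where "c' i l = (if l < d then (if i = k then 0 else c i l) else s (u i) (u k) / of_real (sqrt N))" for i l
  have ks: "s (u k) (u i) = cnj (s (u i) (u k))" if "i \<in> insert k J" for i
    using that insert by (intro s_cnj) auto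
  have null: "s (u i) (u k) = 0" if "N = 0" "i \<in> insert k J" for i
    using cauchy_schwarz_semi[of "u i" "u k"] that insert.prems by (auto simp flip: N_def)
  have main: "s (u i) (u j) = s (u' i) (u' j) + s (u i) (u k) / of_real (sqrt N) * cnj (s (u j) (u k) / of_real (sqrt N))" if "i \<in> J" "j \<in> J" for i j
  proof (cases "N = 0")
    case True
    then show ?thesis using null that by (simp add: u'_def)
  next
    case False
    have sq: "complex_of_real (sqrt N) * complex_of_real (sqrt N) = of_real N"
      using N0 by (metis of_real_mult real_sqrt_mult_self abs_of_nonneg)
    have "s (u' i) (u' j) = s (u i) (u j) - s (u i) (u k) * cnj (s (u j) (u k)) / of_real N"
      using that insert.prems uk False
      by (simp add: u'_def s_diff s_diff_right s_smul s_smul_right kk ks field_simps)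
    then show ?thesis using sq False by simp
  qed
  have "s (u i) (u j) = (\<Sum>l<Suc d. c' i l * cnj (c' j l))" if ij: "i \<in> insert k J" "j \<in> insert k J" for i j
  proof -
    have last: "(\<Sum>l<Suc d. c' i l * cnj (c' j l)) = (\<Sum>l<d. c' i l * cnj (c' j l)) + s (u i) (u k) / of_real (sqrt N) * cnj (s (u j) (u k) / of_real (sqrt N))"
      by (simp add: c'_def)
    show ?thesis
    proof (cases "i = k \<or> j = k")
      case True
      then have z: "(\<Sum>l<d. c' i l * cnj (c' j l)) = 0" by (intro sum.neutral) (auto simp: c'_def)
      have sq: "complex_of_real (sqrt N) * complex_of_real (sqrt N) = of_real N"
        using N0 by (metis of_real_mult real_sqrt_mult_self abs_of_nonneg)
      show ?thesis
        unfolding last z using True sq null[OF _ ij(1)] null[OF _ ij(2)] ks[OF ij(1)] ks[OF ij(2)]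
        by (cases "N = 0") (auto simp: kk)
    next
      case False
      then have ij': "i \<in> J" "j \<in> J" using ij by auto
      have "(\<Sum>l<d. c' i l * cnj (c' j l)) = (\<Sum>l<d. c i l * cnj (c j l))"
        using False by (intro sum.cong) (auto simp: c'_def)
      then show ?thesis unfolding last using main[OF ij'] c[OF ij'] by simp
    qed
  qed
  then show ?case by blast
qed

end

context complex_inner_space
begin

sublocale semi_inner_space smul H ip
  by unfold_locales (auto intro: subspace_H ip_add ip_smul ip_cnj ip_nonneg)

lemma hnorm_nonneg [simp]: "x \<in> H \<Longrightarrow> 0 \<le> hnorm x"
  unfolding hnorm_def by (intro real_sqrt_ge_zero ip_nonneg)

lemma hnorm_square: "x \<in> H \<Longrightarrow> (hnorm x)\<^sup>2 = Re (ip x x)"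
  unfolding hnorm_def by (intro real_sqrt_pow2 ip_nonneg)

lemma ip_self: "x \<in> H \<Longrightarrow> ip x x = of_real ((hnorm x)\<^sup>2)"
  using s_self by (simp add: hnorm_square)

lemma hnorm_zero [simp]: "hnorm 0 = 0"
  by (simp add: hnorm_def s_zero)

lemma hnorm_eq_0: "x \<in> H \<Longrightarrow> hnorm x = 0 \<Longrightarrow> x = 0"
  using ip_self[of x] ip_definite by simp

lemma cauchy_schwarz: "x \<in> H \<Longrightarrow> y \<in> H \<Longrightarrow> cmod (ip x y) \<le> hnorm x * hnorm y"
  by (rule power2_le_imp_le) (simp_all add: power_mult_distrib hnorm_square cauchy_schwarz_semi)

lemma hnorm_smul: "x \<in> H \<Longrightarrow> hnorm (smul c x) = cmod c * hnorm x"
proof (rule power2_eq_imp_eq)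
  assume x: "x \<in> H"
  have "ip (smul c x) (smul c x) = (c * cnj c) * ip x x" using x by (simp add: s_smul s_smul_right)
  then have "ip (smul c x) (smul c x) = of_real ((cmod c * hnorm x)\<^sup>2)"
    by (simp only: ip_self[OF x] complex_norm_square[symmetric] power_mult_distrib of_real_mult)
  then show "(hnorm (smul c x))\<^sup>2 = (cmod c * hnorm x)\<^sup>2" using x by (simp add: hnorm_square)
qed auto

lemma hnorm_triangle: "x \<in> H \<Longrightarrow> y \<in> H \<Longrightarrow> hnorm (x + y) \<le> hnorm x + hnorm y"
proof (rule power2_le_imp_le)
  assume x: "x \<in> H" and y: "y \<in> H"
  have "(hnorm (x + y))\<^sup>2 = (hnorm x)\<^sup>2 + (hnorm y)\<^sup>2 + 2 * Re (ip x y)"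
    using x y ip_cnj[of x y] by (simp add: hnorm_square s_add s_add_right)
  also have "Re (ip x y) \<le> hnorm x * hnorm y"
    using cauchy_schwarz[OF x y] complex_Re_le_cmod order_trans by blast
  finally show "(hnorm (x + y))\<^sup>2 \<le> (hnorm x + hnorm y)\<^sup>2" by (simp add: power2_sum)
qed auto

lemma hnorm_minus: "x \<in> H \<Longrightarrow> hnorm (- x) = hnorm x"
  using hnorm_smul[of x "-1"] by (simp add: scale_minus_left)

lemma hnorm_diff_commute: "x \<in> H \<Longrightarrow> y \<in> H \<Longrightarrow> hnorm (x - y) = hnorm (y - x)"
  using hnorm_minus[of "x - y"] by simp

lemma hnorm_triangle_diff: "x \<in> H \<Longrightarrow> y \<in> H \<Longrightarrow> z \<in> H \<Longrightarrow> hnorm (x - z) \<le> hnorm (x - y) + hnorm (y - z)"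
  using hnorm_triangle[of "x - y" "y - z"] by simp

lemma hnorm_sum: "(\<And>i. i \<in> F \<Longrightarrow> f i \<in> H) \<Longrightarrow> hnorm (\<Sum>i\<in>F. f i) \<le> (\<Sum>i\<in>F. hnorm (f i))"
  by (induction F rule: infinite_finite_induct) (auto intro: order_trans[OF hnorm_triangle])

lemma parallelogram:
  "x \<in> H \<Longrightarrow> y \<in> H \<Longrightarrow> (hnorm (x + y))\<^sup>2 + (hnorm (x - y))\<^sup>2 = 2 * (hnorm x)\<^sup>2 + 2 * (hnorm y)\<^sup>2"
  by (simp add: hnorm_square s_add s_add_right s_diff s_diff_right)

lemma hnorm_leI:
  assumes "x \<in> H" "0 \<le> C" "\<And>y. y \<in> H \<Longrightarrow> cmod (ip x y) \<le> C * hnorm y"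
  shows "hnorm x \<le> C"
proof -
  have "hnorm x * hnorm x \<le> C * hnorm x"
    using assms(3)[OF assms(1)] ip_self[OF assms(1)] by (simp add: power2_eq_square norm_mult)
  then show ?thesis using assms(1,2) hnorm_nonneg[OF assms(1)] by (cases "hnorm x = 0") auto
qed

lemma ip_eqI:
  assumes "x \<in> H" "y \<in> H" "\<And>z. z \<in> H \<Longrightarrow> ip x z = ip y z"
  shows "x = y"
proof -
  have "ip (x - y) (x - y) = 0" using assms by (simp add: s_diff)
  then show ?thesis using ip_definite[of "x - y"] assms by simp
qed

lemma bounded_opsI:
  assumes "\<And>x. x \<in> H \<Longrightarrow> T x \<in> H" "\<And>x. x \<notin> H \<Longrightarrow> T x = 0"
    "\<And>x y. x \<in> H \<Longrightarrow> y \<in> H \<Longrightarrow> T (x + y) = T x + T y"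
    "\<And>c x. x \<in> H \<Longrightarrow> T (smul c x) = smul c (T x)"
    "\<And>x. x \<in> H \<Longrightarrow> hnorm (T x) \<le> K * hnorm x"
  shows "T \<in> bounded_ops"
  unfolding bounded_ops_def using assms by blast

context
  fixes T assumes T: "T \<in> bounded_ops"
begin

lemma op_H: "x \<in> H \<Longrightarrow> T x \<in> H" using T unfolding bounded_ops_def by blast
lemma op_outside: "x \<notin> H \<Longrightarrow> T x = 0" using T unfolding bounded_ops_def by blast
lemma op_add: "x \<in> H \<Longrightarrow> y \<in> H \<Longrightarrow> T (x + y) = T x + T y" using T unfolding bounded_ops_def by blast
lemma op_smul: "x \<in> H \<Longrightarrow> T (smul c x) = smul c (T x)" using T unfolding bounded_ops_def by blast

lemma op_zero: "T 0 = 0" using op_add[of 0 0] by simp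

lemma op_diff: "x \<in> H \<Longrightarrow> y \<in> H \<Longrightarrow> T (x - y) = T x - T y"
  using op_add[of "x - y" y] by (simp add: eq_diff_eq)

lemma op_sum: "(\<And>i. i \<in> F \<Longrightarrow> f i \<in> H) \<Longrightarrow> T (\<Sum>i\<in>F. f i) = (\<Sum>i\<in>F. T (f i))"
  by (induction F rule: infinite_finite_induct) (auto simp: op_zero op_add)

lemma op_bounded: obtains K where "0 \<le> K" "\<And>x. x \<in> H \<Longrightarrow> hnorm (T x) \<le> K * hnorm x"
proof -
  obtain K where K: "\<forall>x\<in>H. hnorm (T x) \<le> K * hnorm x" using T unfolding bounded_ops_def by blast
  have "hnorm (T x) \<le> max K 0 * hnorm x" if "x \<in> H" for x
    using K that mult_right_mono[of K "max K 0" "hnorm x"] by force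
  then show ?thesis using that[of "max K 0"] by auto
qed

lemma op_norm_bdd: "bdd_above ((\<lambda>x. hnorm (T x)) ` {x \<in> H. hnorm x \<le> 1})"
proof -
  obtain K where K: "0 \<le> K" "\<And>x. x \<in> H \<Longrightarrow> hnorm (T x) \<le> K * hnorm x" by (rule op_bounded) blast
  show ?thesis
  proof (rule bdd_aboveI2)
    fix x assume x: "x \<in> {x \<in> H. hnorm x \<le> 1}"
    then have "K * hnorm x \<le> K * 1" using K by (intro mult_left_mono) auto
    then show "hnorm (T x) \<le> K" using K(2)[of x] x by auto
  qed
qed

lemma op_norm_upper:
  assumes x: "x \<in> H"
  shows "hnorm (T x) \<le> op_norm T * hnorm x"
proof (cases "hnorm x = 0")
  case True
  then show ?thesis using hnorm_eq_0[OF x True] op_zero by simp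
next
  case False
  define c where "c = hnorm x"
  have c: "0 < c" using False hnorm_nonneg[OF x] by (simp add: c_def)
  have "hnorm (T (smul (of_real (1 / c)) x)) \<le> op_norm T"
    unfolding op_norm_def
    by (rule cSUP_upper[OF _ op_norm_bdd]) (use x c in \<open>simp add: hnorm_smul c_def norm_divide\<close>)
  also have "hnorm (T (smul (of_real (1 / c)) x)) = 1 / c * hnorm (T x)"
    using x c op_H[OF x] by (simp add: op_smul hnorm_smul norm_divide)
  finally show ?thesis using c by (simp add: field_simps c_def)
qed

lemma op_norm_nonneg: "0 \<le> op_norm T"
proof -
  have "hnorm (T 0) \<le> op_norm T"
    unfolding op_norm_def by (rule cSUP_upper[OF _ op_norm_bdd]) simp
  then show ?thesis by (simp add: op_zero)
qed

end

lemma op_norm_least: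
  assumes "0 \<le> C" "\<And>x. x \<in> H \<Longrightarrow> hnorm (T x) \<le> C * hnorm x"
  shows "op_norm T \<le> C"
  unfolding op_norm_def
proof (rule cSUP_least)
  have "0 \<in> {x \<in> H. hnorm x \<le> 1}" by simp
  then show "{x \<in> H. hnorm x \<le> 1} \<noteq> {}" by blast
  fix x assume x: "x \<in> {x \<in> H. hnorm x \<le> 1}"
  then have "C * hnorm x \<le> C * 1" using assms by (intro mult_left_mono) auto
  then show "hnorm (T x) \<le> C" using assms(2)[of x] x by auto
qed

lemma bounded_ops_ext:
  assumes "S \<in> bounded_ops" "T \<in> bounded_ops" "\<And>x y. x \<in> H \<Longrightarrow> y \<in> H \<Longrightarrow> ip (S x) y = ip (T x) y"
  shows "S = T"
proof
  fix x show "S x = T x"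
    using ip_eqI[OF op_H[OF assms(1)] op_H[OF assms(2)], of x x] assms(3)
      op_outside[OF assms(1)] op_outside[OF assms(2)] by (cases "x \<in> H") auto
qed

lemma id_op_bounded: "id_op \<in> bounded_ops"
  by (rule bounded_opsI[where K = 1]) (auto simp: id_op_def)

lemma comp_bounded:
  assumes S: "S \<in> bounded_ops" and T: "T \<in> bounded_ops" shows "S \<circ> T \<in> bounded_ops"
proof -
  obtain K where K: "0 \<le> K" "\<And>x. x \<in> H \<Longrightarrow> hnorm (S x) \<le> K * hnorm x" by (rule op_bounded[OF S]) blast
  obtain L where L: "0 \<le> L" "\<And>x. x \<in> H \<Longrightarrow> hnorm (T x) \<le> L * hnorm x" by (rule op_bounded[OF T]) blast
  show ?thesis
  proof (rule bounded_opsI[where K = "K * L"])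
    fix x assume x: "x \<in> H"
    have "hnorm (S (T x)) \<le> K * hnorm (T x)" using K(2) op_H[OF T x] by blast
    also have "\<dots> \<le> K * (L * hnorm x)" using K(1) L(2)[OF x] by (intro mult_left_mono)
    finally show "hnorm ((S \<circ> T) x) \<le> K * L * hnorm x" by (simp add: mult.assoc)
  qed (simp_all add: op_H[OF S] op_H[OF T] op_outside[OF T] op_zero[OF S] op_add[OF S] op_add[OF T] op_smul[OF S] op_smul[OF T])
qed

lemma minus_scaled_bounded:
  assumes S: "S \<in> bounded_ops" and T: "T \<in> bounded_ops" shows "(\<lambda>x. S x - smul c (T x)) \<in> bounded_ops"
proof -
  obtain K where K: "0 \<le> K" "\<And>x. x \<in> H \<Longrightarrow> hnorm (S x) \<le> K * hnorm x" by (rule op_bounded[OF S]) blast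
  obtain L where L: "0 \<le> L" "\<And>x. x \<in> H \<Longrightarrow> hnorm (T x) \<le> L * hnorm x" by (rule op_bounded[OF T]) blast
  show ?thesis
  proof (rule bounded_opsI[where K = "K + cmod c * L"])
    fix x assume x: "x \<in> H"
    have "hnorm (S x - smul c (T x)) \<le> hnorm (S x - 0) + hnorm (0 - smul c (T x))"
      using op_H[OF S x] op_H[OF T x] by (intro hnorm_triangle_diff) auto
    also have "\<dots> = hnorm (S x) + cmod c * hnorm (T x)"
      using op_H[OF T x] by (simp add: hnorm_minus hnorm_smul)
    also have "\<dots> \<le> K * hnorm x + cmod c * (L * hnorm x)"
      using K(2)[OF x] L(2)[OF x] by (intro add_mono mult_left_mono) auto
    finally show "hnorm (S x - smul c (T x)) \<le> (K + cmod c * L) * hnorm x" by (simp add: algebra_simps)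
  next
    fix a x assume "x \<in> H"
    then show "S (smul a x) - smul c (T (smul a x)) = smul a (S x - smul c (T x))"
      by (simp add: op_smul[OF S] op_smul[OF T] scale_right_diff_distrib mult.commute)
  qed (simp_all add: op_H[OF S] op_H[OF T] op_outside[OF S] op_outside[OF T] op_add[OF S] op_add[OF T] scale_right_distrib)
qed

lemma sum_bounded:
  assumes "\<And>i. i \<in> F \<Longrightarrow> A i \<in> bounded_ops"
  shows "(\<lambda>x. \<Sum>i\<in>F. smul (a i) (A i x)) \<in> bounded_ops"
  using assms
proof (induction F rule: infinite_finite_induct)
  case (insert k F)
  have "(\<lambda>x. (\<Sum>i\<in>F. smul (a i) (A i x)) - smul (- a k) (A k x)) \<in> bounded_ops"
    using insert by (intro minus_scaled_bounded) auto
  then show ?case using insert by (simp add: add.commute)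
qed (auto intro!: bounded_opsI[where K = 0])

end

context complex_hilbert_space
begin

text \<open>A minimizing sequence of the distance from \<open>x\<close> to \<open>K\<close> is Cauchy by the parallelogram law. Its limit \<open>h\<close>
lies in the closure of \<open>K\<close>, and minimality forces \<open>x - h\<close> to be orthogonal to \<open>K\<close>.\<close>

lemma projection:
  assumes K: "subspace K" "K \<subseteq> H" and x: "x \<in> H"
  obtains h where "h \<in> H" "\<And>e. e > 0 \<Longrightarrow> \<exists>k\<in>K. hnorm (k - h) < e" "\<And>k. k \<in> K \<Longrightarrow> ip (x - h) k = 0"
proof -
  define d where "d = (INF k\<in>K. (hnorm (x - k))\<^sup>2)"
  have K0: "0 \<in> K" using K(1) by (rule subspace_0)
  have bdd: "bdd_below ((\<lambda>k. (hnorm (x - k))\<^sup>2) ` K)" by (rule bdd_belowI2[of _ 0]) simp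
  have d: "d \<le> (hnorm (x - k))\<^sup>2" if "k \<in> K" for k
    unfolding d_def by (rule cINF_lower[OF bdd that])
  have "\<exists>k\<in>K. (hnorm (x - k))\<^sup>2 < d + 1 / real (Suc n)" for n
  proof (rule ccontr)
    assume "\<not> ?thesis"
    then have "d + 1 / real (Suc n) \<le> d" unfolding d_def using K0
      by (intro cINF_greatest) (auto simp: not_less d_def)
    then show False by (simp add: field_simps)
  qed
  then obtain k where k: "\<And>n. k n \<in> K" "\<And>n. (hnorm (x - k n))\<^sup>2 < d + 1 / real (Suc n)" by metis
  have kH: "k n \<in> H" for n using k(1) K(2) by blast
  have close: "(hnorm (k m - k n))\<^sup>2 \<le> 2 / real (Suc m) + 2 / real (Suc n)" for m n
  proof -
    define c where "c = smul (1/2) (k m + k n)"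
    have cK: "c \<in> K" unfolding c_def using k(1) K(1) by (intro subspace_scale subspace_add)
    have "(x - k m) + (x - k n) = smul 2 (x - c)"
      unfolding c_def by (simp add: scale_right_diff_distrib scale_left_distrib[of 1 1 x, simplified])
    moreover have "(x - k m) - (x - k n) = k n - k m" by simp
    ultimately have "(hnorm (smul 2 (x - c)))\<^sup>2 + (hnorm (k n - k m))\<^sup>2 = 2 * (hnorm (x - k m))\<^sup>2 + 2 * (hnorm (x - k n))\<^sup>2"
      using parallelogram[of "x - k m" "x - k n"] x kH by simp
    moreover have "(hnorm (smul 2 (x - c)))\<^sup>2 = 4 * (hnorm (x - c))\<^sup>2"
      using x cK K(2) by (subst hnorm_smul) (auto simp: power_mult_distrib)
    moreover have "hnorm (k n - k m) = hnorm (k m - k n)" using kH by (intro hnorm_diff_commute)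
    ultimately show ?thesis using d[OF cK] k(2)[of m] k(2)[of n] by auto
  qed
  have "\<exists>h\<in>H. (\<lambda>n. hnorm (k n - h)) \<longlonglongrightarrow> 0"
  proof (rule complete_H)
    fix e :: real assume e: "e > 0"
    obtain M :: nat where M: "4 / e\<^sup>2 < real M" using reals_Archimedean2 by blast
    have "hnorm (k m - k n) < e" if "m \<ge> M" "n \<ge> M" for m n
    proof (rule power2_less_imp_less)
      have M0: "0 < real M" using M e by (smt (verit) divide_pos_pos zero_less_power)
      have "2 / real (Suc m) \<le> 2 / real M" "2 / real (Suc n) \<le> 2 / real M"
        using that M0 by (intro divide_left_mono; simp)+
      then have "(hnorm (k m - k n))\<^sup>2 \<le> 4 / real M" using close[of m n] by simp
      also have "\<dots> < e\<^sup>2" using M M0 e by (simp add: field_simps)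
      finally show "(hnorm (k m - k n))\<^sup>2 < e\<^sup>2" .
    qed (use e in simp)
    then show "\<exists>M. \<forall>m\<ge>M. \<forall>n\<ge>M. hnorm (k m - k n) < e" by blast
  qed (rule kH)
  then obtain h where h: "h \<in> H" "(\<lambda>n. hnorm (k n - h)) \<longlonglongrightarrow> 0" by blast
  show ?thesis
  proof (rule that[OF h(1)])
    fix e :: real assume "e > 0"
    then have "\<forall>\<^sub>F n in sequentially. hnorm (k n - h) < e" using h(2) by (intro order_tendstoD) 
    then obtain n where "hnorm (k n - h) < e" by (auto simp: eventually_sequentially)
    then show "\<exists>k\<in>K. hnorm (k - h) < e" using k(1) by blast
  next
    fix v assume v: "v \<in> K"
    have vH: "v \<in> H" using v K by blast
    show "ip (x - h) v = 0"
    proof (cases "v = 0")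
      case True
      then show ?thesis using x h by (simp add: s_zero)
    next
      case False
      define N where "N = (hnorm v)\<^sup>2"
      have N: "0 < N" using False hnorm_eq_0[OF vH] by (auto simp: N_def)
      have small: "(cmod (ip (x - k n) v))\<^sup>2 \<le> N / real (Suc n)" for n
      proof -
        define u where "u = x - k n"
        define a where "a = ip u v"
        define c where "c = a / of_real N"
        have uH: "u \<in> H" using x kH by (simp add: u_def)
        have "k n + smul c v \<in> K" using k(1) v K(1) by (intro subspace_add subspace_scale)
        from d[OF this] have "d \<le> (hnorm (u - smul c v))\<^sup>2" by (simp add: u_def diff_diff_eq)
        also have "of_real ((hnorm (u - smul c v))\<^sup>2) = ip (u - smul c v) (u - smul c v)"
          using uH vH by (simp add: ip_self)
        then have "complex_of_real ((hnorm (u - smul c v))\<^sup>2) = of_real ((hnorm u)\<^sup>2 - (cmod a)\<^sup>2 / N)"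
        proof -
          have vu: "ip v u = cnj a" using ip_cnj[OF uH vH] by (simp add: a_def)
          have "ip (u - smul c v) (u - smul c v) = ip u u - cnj c * a - c * cnj a + c * cnj c * ip v v"
            using uH vH by (simp add: s_diff s_diff_right s_smul s_smul_right vu a_def algebra_simps)
          also have "\<dots> = of_real ((hnorm u)\<^sup>2) - a * cnj a / of_real N"
            using N by (simp add: ip_self uH vH c_def N_def[symmetric] field_simps)
          also have "\<dots> = of_real ((hnorm u)\<^sup>2 - (cmod a)\<^sup>2 / N)"
            by (simp only: complex_norm_square[symmetric] of_real_diff of_real_divide)
          finally show ?thesis using \<open>of_real ((hnorm (u - smul c v))\<^sup>2) = ip (u - smul c v) (u - smul c v)\<close> by simp
        qed
        then have "(hnorm (u - smul c v))\<^sup>2 = (hnorm u)\<^sup>2 - (cmod a)\<^sup>2 / N" by (simp only: of_real_eq_iff)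
        finally have "d \<le> (hnorm u)\<^sup>2 - (cmod a)\<^sup>2 / N" .
        then have "(cmod a)\<^sup>2 / N \<le> 1 / real (Suc n)" using k(2)[of n] by (simp add: u_def)
        then have "(cmod a)\<^sup>2 \<le> 1 / real (Suc n) * N" using N by (simp only: pos_divide_le_eq)
        then show ?thesis by (simp add: a_def u_def)
      qed
      have "cmod (ip (x - h) v) \<le> sqrt (N / real (Suc n)) + hnorm (k n - h) * hnorm v" for n
      proof -
        have "ip (x - h) v = ip (x - k n) v + ip (k n - h) v" using x kH h vH by (simp add: s_diff)
        then have "cmod (ip (x - h) v) \<le> cmod (ip (x - k n) v) + cmod (ip (k n - h) v)" by (simp add: norm_triangle_ineq)
        also have "\<dots> \<le> sqrt (N / real (Suc n)) + hnorm (k n - h) * hnorm v"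
          using small[of n] kH h vH by (intro add_mono cauchy_schwarz real_le_rsqrt) auto
        finally show ?thesis .
      qed
      moreover have "(\<lambda>n. sqrt (N / real (Suc n)) + hnorm (k n - h) * hnorm v) \<longlonglongrightarrow> sqrt 0 + 0 * hnorm v"
        by (intro tendsto_intros h(2) LIMSEQ_Suc[OF lim_const_over_n])
      ultimately have "cmod (ip (x - h) v) \<le> sqrt 0 + 0 * hnorm v"
        by (intro LIMSEQ_le_const) auto
      then show ?thesis by simp
    qed
  qed
qed

text \<open>The kernel of \<open>l\<close> is closed, so some nonzero vector \<open>v\<close> is orthogonal to it. Every \<open>x\<close> differs from a
multiple of \<open>v\<close> by an element of the kernel, which shows that \<open>l\<close> is an inner product with a multiple of \<open>v\<close>.\<close>

lemma riesz_representation: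
  assumes add: "\<And>x y. x \<in> H \<Longrightarrow> y \<in> H \<Longrightarrow> l (x + y) = l x + l y"
    and scale: "\<And>c x. x \<in> H \<Longrightarrow> l (smul c x) = c * l x"
    and bound: "\<And>x. x \<in> H \<Longrightarrow> cmod (l x) \<le> C * hnorm x"
  shows "\<exists>y\<in>H. \<forall>x\<in>H. l x = ip x y"
proof (cases "\<forall>x\<in>H. l x = 0")
  case True
  then show ?thesis by (intro bexI[of _ 0]) (auto simp: s_zero)
next
  case False
  then obtain x0 where x0: "x0 \<in> H" "l x0 \<noteq> 0" by blast
  have diff: "l (x - y) = l x - l y" if "x \<in> H" "y \<in> H" for x y
    using add[of "x - y" y] that by (simp add: eq_diff_eq)
  have l0: "l 0 = 0" using diff[of 0 0] by simp
  define K where "K = {x \<in> H. l x = 0}"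
  have "subspace K" by (rule subspaceI) (auto simp: K_def l0 add scale)
  then obtain h where h: "h \<in> H" "\<And>e. e > 0 \<Longrightarrow> \<exists>k\<in>K. hnorm (k - h) < e" "\<And>k. k \<in> K \<Longrightarrow> ip (x0 - h) k = 0"
    by (rule projection[OF _ _ x0(1)]) (auto simp: K_def)
  have "cmod (l h) \<le> 0 + e" if "e > 0" for e
  proof -
    obtain k where k: "k \<in> K" "hnorm (k - h) < e / (\<bar>C\<bar> + 1)" using h(2)[of "e / (\<bar>C\<bar> + 1)"] \<open>e > 0\<close> by auto
    have "cmod (l h) = cmod (l (k - h))" using k h by (simp add: diff K_def)
    also have "\<dots> \<le> C * hnorm (k - h)" using k h by (intro bound) (auto simp: K_def)
    also have "\<dots> \<le> (\<bar>C\<bar> + 1) * hnorm (k - h)" using k h by (intro mult_right_mono) (auto simp: K_def)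
    also have "\<dots> \<le> e" using k(2) by (simp add: field_simps)
    finally show ?thesis by simp
  qed
  then have "cmod (l h) \<le> 0" by (rule field_le_epsilon)
  then have lh: "l h = 0" by simp
  define v where "v = x0 - h"
  have vH: "v \<in> H" and lv: "l v \<noteq> 0" using x0 h lh by (auto simp: v_def diff)
  have vv: "ip v v \<noteq> 0" using ip_definite[OF vH] lv l0 by auto
  have "l x = ip x (smul (cnj (l v / ip v v)) v)" if x: "x \<in> H" for x
  proof -
    have "x - smul (l x / l v) v \<in> K" using x vH lv by (auto simp: K_def diff scale)
    then have "ip v (x - smul (l x / l v) v) = 0" using h(3) by (simp add: v_def)
    then have "ip (x - smul (l x / l v) v) v = 0" using ip_cnj[OF vH, of "x - smul (l x / l v) v"] x vH by simp
    then have "ip x v = l x / l v * ip v v" using x vH by (simp add: s_diff s_smul)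
    then show ?thesis using x vH vv lv by (simp add: s_smul_right)
  qed
  then show ?thesis by (intro bexI[OF _ H_smul[OF vH]] ballI)
qed

text \<open>Both adjoints and the operators \<open>\<phi>(T)\<close> are obtained from their forms; linearity and boundedness are then
inherited.\<close>

lemma operator_of_bounded_form:
  assumes add: "\<And>x y z. x \<in> H \<Longrightarrow> y \<in> H \<Longrightarrow> z \<in> H \<Longrightarrow> B (x + y) z = B x z + B y z"
    and scale: "\<And>c x z. x \<in> H \<Longrightarrow> z \<in> H \<Longrightarrow> B (smul c x) z = c * B x z"
    and add': "\<And>x y z. x \<in> H \<Longrightarrow> y \<in> H \<Longrightarrow> z \<in> H \<Longrightarrow> B z (x + y) = B z x + B z y"
    and scale': "\<And>c x z. x \<in> H \<Longrightarrow> z \<in> H \<Longrightarrow> B z (smul c x) = cnj c * B z x"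
    and C: "0 \<le> C" and bound: "\<And>x y. x \<in> H \<Longrightarrow> y \<in> H \<Longrightarrow> cmod (B x y) \<le> C * hnorm x * hnorm y"
  shows "\<exists>P\<in>bounded_ops. \<forall>x\<in>H. \<forall>y\<in>H. ip (P x) y = B x y"
proof -
  have "\<exists>z\<in>H. \<forall>y\<in>H. ip z y = B x y" if x: "x \<in> H" for x
  proof -
    have "\<exists>z\<in>H. \<forall>y\<in>H. cnj (B x y) = ip y z"
      by (rule riesz_representation[where C = "C * hnorm x"]) (use x bound in \<open>auto simp: add' scale'\<close>)
    then obtain z where z: "z \<in> H" "\<forall>y\<in>H. cnj (B x y) = ip y z" by blast
    have "ip z y = B x y" if "y \<in> H" for y
      using z ip_cnj[OF that z(1)] that by (metis complex_cnj_cnj)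
    then show ?thesis using z(1) by blast
  qed
  then obtain P0 where P0: "\<And>x. x \<in> H \<Longrightarrow> P0 x \<in> H" "\<And>x y. x \<in> H \<Longrightarrow> y \<in> H \<Longrightarrow> ip (P0 x) y = B x y" by metis
  define P where "P x = (if x \<in> H then P0 x else 0)" for x
  have P: "\<And>x. x \<in> H \<Longrightarrow> P x \<in> H" "\<And>x y. x \<in> H \<Longrightarrow> y \<in> H \<Longrightarrow> ip (P x) y = B x y"
    using P0 by (auto simp: P_def)
  have "P \<in> bounded_ops"
  proof (rule bounded_opsI[where K = C])
    show "P (x + y) = P x + P y" if "x \<in> H" "y \<in> H" for x y
      by (rule ip_eqI) (simp_all add: that P s_add add)
    show "P (smul c x) = smul c (P x)" if "x \<in> H" for c x
      by (rule ip_eqI) (simp_all add: that P s_smul scale)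
    show "hnorm (P x) \<le> C * hnorm x" if "x \<in> H" for x
      by (rule hnorm_leI) (simp_all add: that P C bound)
  qed (simp_all add: P_def P0)
  then show ?thesis using P(2) by (intro bexI[of _ P] ballI)
qed

lemma adjoint_op:
  assumes T: "T \<in> bounded_ops"
  shows adjoint_op_bounded: "adjoint_op T \<in> bounded_ops"
    and adjoint_op_ip: "\<And>x y. x \<in> H \<Longrightarrow> y \<in> H \<Longrightarrow> ip (T x) y = ip x (adjoint_op T y)"
proof -
  obtain K where K: "0 \<le> K" "\<And>x. x \<in> H \<Longrightarrow> hnorm (T x) \<le> K * hnorm x" by (rule op_bounded[OF T]) blast
  have "\<exists>S\<in>bounded_ops. \<forall>x\<in>H. \<forall>y\<in>H. ip (S x) y = ip x (T y)"
  proof (rule operator_of_bounded_form[OF _ _ _ _ K(1)])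
    fix x y assume "x \<in> H" "y \<in> H"
    then show "cmod (ip x (T y)) \<le> K * hnorm x * hnorm y"
      using order_trans[OF cauchy_schwarz[OF _ op_H[OF T]] mult_left_mono[OF K(2) hnorm_nonneg]]
      by (simp add: mult_ac)
  qed (simp_all add: s_add s_smul s_add_right s_smul_right op_add[OF T] op_smul[OF T] op_H[OF T])
  then obtain S where S: "S \<in> bounded_ops" "\<And>x y. x \<in> H \<Longrightarrow> y \<in> H \<Longrightarrow> ip (S x) y = ip x (T y)" by blast
  have S': "ip (T x) y = ip x (S y)" if "x \<in> H" "y \<in> H" for x y
    using S(2)[OF that(2,1)] ip_cnj[OF op_H[OF S(1) that(2)] that(1)] ip_cnj[OF that(2) op_H[OF T that(1)]] by simp
  have "adjoint_op T = S"
    unfolding adjoint_op_def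
  proof (rule the_equality)
    show "S \<in> bounded_ops \<and> (\<forall>x\<in>H. \<forall>y\<in>H. ip (T x) y = ip x (S y))" using S S' by blast
    fix R assume R: "R \<in> bounded_ops \<and> (\<forall>x\<in>H. \<forall>y\<in>H. ip (T x) y = ip x (R y))"
    show "R = S"
    proof (rule bounded_ops_ext)
      fix x y assume xy: "x \<in> H" "y \<in> H"
      have "ip y (R x) = ip y (S x)" using R S' xy by metis
      then show "ip (R x) y = ip (S x) y"
        using ip_cnj[of y "R x"] ip_cnj[of y "S x"] xy R S op_H by metis
    qed (use R S in auto)
  qed
  then show "adjoint_op T \<in> bounded_ops" "\<And>x y. x \<in> H \<Longrightarrow> y \<in> H \<Longrightarrow> ip (T x) y = ip x (adjoint_op T y)"
    using S S' by auto
qed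

lemma adjoint_op_ip':
  assumes "T \<in> bounded_ops" "x \<in> H" "y \<in> H"
  shows "ip (adjoint_op T x) y = ip x (T y)"
  using adjoint_op_ip[OF assms(1,3,2)] ip_cnj assms adjoint_op_bounded[OF assms(1)] op_H by metis

lemma adjoint_op_eqI:
  assumes "T \<in> bounded_ops" "S \<in> bounded_ops" "\<And>x y. x \<in> H \<Longrightarrow> y \<in> H \<Longrightarrow> ip (S x) y = ip x (T y)"
  shows "adjoint_op T = S"
  by (rule bounded_ops_ext) (use assms adjoint_op_bounded adjoint_op_ip' in auto)

lemma op_norm_le_adjoint:
  assumes T: "T \<in> bounded_ops" and C: "0 \<le> C" "\<And>x. x \<in> H \<Longrightarrow> hnorm (adjoint_op T x) \<le> C * hnorm x"
  shows "op_norm T \<le> C"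
proof (rule op_norm_least[OF C(1)])
  fix x assume x: "x \<in> H"
  show "hnorm (T x) \<le> C * hnorm x"
  proof (rule hnorm_leI)
    fix y assume y: "y \<in> H"
    have "cmod (ip (T x) y) \<le> hnorm x * hnorm (adjoint_op T y)"
      unfolding adjoint_op_ip[OF T x y] by (rule cauchy_schwarz[OF x op_H[OF adjoint_op_bounded[OF T] y]])
    also have "\<dots> \<le> hnorm x * (C * hnorm y)" using C(2)[OF y] x by (intro mult_left_mono) auto
    finally show "cmod (ip (T x) y) \<le> C * hnorm x * hnorm y" by (simp add: mult_ac)
  qed (simp_all add: x C op_H[OF T])
qed

lemma adjoint_hnorm_le:
  assumes T: "T \<in> bounded_ops" and C: "0 \<le> C" "\<And>x. x \<in> H \<Longrightarrow> hnorm (T x) \<le> C * hnorm x" and x: "x \<in> H"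
  shows "hnorm (adjoint_op T x) \<le> C * hnorm x"
proof (rule hnorm_leI)
  fix y assume y: "y \<in> H"
  have "cmod (ip (adjoint_op T x) y) \<le> hnorm x * hnorm (T y)"
    unfolding adjoint_op_ip'[OF T x y] by (rule cauchy_schwarz[OF x op_H[OF T y]])
  also have "\<dots> \<le> hnorm x * (C * hnorm y)" using C(2)[OF y] x by (intro mult_left_mono) auto
  finally show "cmod (ip (adjoint_op T x) y) \<le> C * hnorm x * hnorm y" by (simp add: mult_ac)
qed (simp_all add: x C op_H[OF adjoint_op_bounded[OF T]])

end


section \<open>Operators of the class and the decay of their powers\<close>

text \<open>By the recursion each increment is at most \<open>q\<close> times the previous one, so the increments are dominated by
a geometric series.\<close>

lemma second_difference_bound:
  fixes b :: "nat \<Rightarrow> real"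
  assumes q: "0 \<le> q" "q < 1" and b: "\<And>n. 0 \<le> b n" "b 1 \<le> (1 + q) * b 0"
    and rec: "\<And>n. b (Suc (Suc n)) + q * b n \<le> (1 + q) * b (Suc n)"
  shows "b n \<le> b 0 / (1 - q)"
proof -
  have inc: "b (Suc n) - b n \<le> q ^ Suc n * b 0" for n
  proof (induction n)
    case 0
    then show ?case using b(2) by (simp add: algebra_simps)
  next
    case (Suc n)
    have "b (Suc (Suc n)) - b (Suc n) \<le> q * (b (Suc n) - b n)" using rec[of n] by (simp add: algebra_simps)
    also have "\<dots> \<le> q * (q ^ Suc n * b 0)" using Suc q by (intro mult_left_mono)
    finally show ?case by simp
  qed
  have "b n \<le> b 0 * (\<Sum>k<Suc n. q ^ k)"
  proof (induction n)
    case (Suc n)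
    then show ?case using inc[of n] by (simp add: algebra_simps)
  qed simp
  also have "\<dots> \<le> b 0 * (1 / (1 - q))"
    using q b(1)[of 0] by (intro mult_left_mono) (auto simp: sum_gp_strict divide_right_mono simp del: sum.lessThan_Suc)
  finally show ?thesis by simp
qed

lemma roots_of_unity_orthogonality:
  assumes k: "k < N" "l < N"
  shows "(\<Sum>j<N. cis (2 * pi * real j / real N) ^ k * cnj (cis (2 * pi * real j / real N) ^ l)) = (if k = l then of_nat N else 0)"
proof -
  define z where "z = cis (2 * pi * (real k - real l) / real N)"
  have N: "0 < N" using k by simp
  have term_eq: "cis (2 * pi * real j / real N) ^ k * cnj (cis (2 * pi * real j / real N) ^ l) = z ^ j" for j
    unfolding z_def Complex.DeMoivre cis_cnj cis_mult
    by (rule arg_cong[of _ _ cis]) (use N in \<open>simp add: field_simps\<close>)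
  show ?thesis
  proof (cases "k = l")
    case True
    then show ?thesis unfolding term_eq by (simp add: z_def)
  next
    case False
    have "z \<noteq> 1"
    proof
      assume "z = 1"
      then have "cis (2 * pi * real k / real N) = cis (2 * pi * real l / real N)"
        unfolding z_def by (simp add: diff_divide_distrib right_diff_distrib flip: cis_divide)
      then have "exp (2 * of_real pi * \<i> * of_nat k / of_nat N) = exp (2 * of_real pi * \<i> * of_nat l / of_nat N)"
        by (simp add: cis_conv_exp mult_ac)
      then have "k mod N = l mod N" using complex_root_unity_eq[of N k l] N by simp
      then show False using False k by simp
    qed
    moreover have "z ^ N = 1"
    proof -
      have "z ^ N = cis (2 * pi * of_int (int k - int l))"
        unfolding z_def Complex.DeMoivre using N by (intro arg_cong[of _ _ cis]) (simp add: field_simps)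
      then show ?thesis using cis_multiple_2pi[of "of_int (int k - int l)"] by simp
    qed
    ultimately show ?thesis unfolding term_eq using False by (simp add: sum_gp_strict)
  qed
qed

context complex_inner_space
begin

text \<open>A discrete Parseval identity for vectors: the characters of the cyclic group of order \<open>N\<close> are orthogonal.\<close>

lemma parseval_roots_of_unity:
  assumes y: "\<And>k. y k \<in> H"
  shows "(\<Sum>j<N. (hnorm (\<Sum>k<N. smul (cis (2 * pi * real j / real N) ^ k) (y k)))\<^sup>2) = real N * (\<Sum>k<N. (hnorm (y k))\<^sup>2)"
proof -
  define c where "c j = cis (2 * pi * real j / real N)" for j
  have "complex_of_real (\<Sum>j<N. (hnorm (\<Sum>k<N. smul (c j ^ k) (y k)))\<^sup>2)
      = (\<Sum>j<N. ip (\<Sum>k<N. smul (c j ^ k) (y k)) (\<Sum>l<N. smul (c j ^ l) (y l)))"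
    using y by (simp add: ip_self)
  also have "\<dots> = (\<Sum>j<N. \<Sum>k<N. \<Sum>l<N. c j ^ k * cnj (c j ^ l) * ip (y k) (y l))"
    using y by (simp add: s_sum s_sum_right s_smul s_smul_right sum_distrib_left mult_ac) (intro sum.cong refl sum.swap)
  also have "\<dots> = (\<Sum>k<N. \<Sum>l<N. \<Sum>j<N. c j ^ k * cnj (c j ^ l) * ip (y k) (y l))"
    by (subst sum.swap) (intro sum.cong refl sum.swap)
  also have "\<dots> = (\<Sum>k<N. \<Sum>l<N. (if k = l then of_nat N else 0) * ip (y k) (y l))"
    unfolding sum_distrib_right[symmetric] c_def
    by (intro sum.cong refl arg_cong2[of _ _ _ _ "(*)"] roots_of_unity_orthogonality) auto
  also have "\<dots> = (\<Sum>k<N. of_nat N * ip (y k) (y k))"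
    by (intro sum.cong refl) (simp add: if_distrib[of "\<lambda>x. x * _"] cong: if_cong)
  also have "\<dots> = complex_of_real (real N * (\<Sum>k<N. (hnorm (y k))\<^sup>2))"
    using y by (simp add: ip_self sum_distrib_left)
  finally show ?thesis unfolding c_def of_real_eq_iff .
qed

lemma funpow_H: "S \<in> bounded_ops \<Longrightarrow> x \<in> H \<Longrightarrow> (S ^^ n) x \<in> H"
  by (induction n) (auto simp: op_H)

text \<open>The partial sums \<open>y\<close> of \<open>\<Sum> c\<^sup>k S\<^sup>k x\<close> satisfy \<open>y - c S y = x - c\<^sup>N S\<^sup>N x\<close>, so \<open>\<parallel>y\<parallel> \<le> L \<parallel>x\<parallel>\<close> for
\<open>\<bar>c\<bar> = 1\<close>, with \<open>L\<close> independent of \<open>N\<close>. Averaging over the \<open>N\<close>-th roots of unity bounds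
\<open>\<Sum>\<^sub>k\<^sub><\<^sub>N \<parallel>S\<^sup>k x\<parallel>\<^sup>2\<close>. Each summand controls \<open>\<parallel>S\<^sup>N x\<parallel>\<^sup>2\<close> by power boundedness, so \<open>N \<parallel>S\<^sup>N x\<parallel>\<^sup>2\<close> stays bounded
and some power of \<open>S\<close> halves the norm.\<close>

lemma power_bounded_decay:
  assumes S: "S \<in> bounded_ops" and C: "\<And>n x. x \<in> H \<Longrightarrow> hnorm ((S ^^ n) x) \<le> C * hnorm x"
    and \<delta>: "0 < \<delta>" "\<And>c x. cmod c = 1 \<Longrightarrow> x \<in> H \<Longrightarrow> \<delta> * hnorm x \<le> hnorm (S x - smul c x)"
  obtains K \<rho> where "0 \<le> K" "0 < \<rho>" "\<rho> < 1" "\<And>n x. x \<in> H \<Longrightarrow> hnorm ((S ^^ n) x) \<le> K * \<rho> ^ n * hnorm x"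
proof -
  define C' where "C' = max C 1"
  have C'1: "1 \<le> C'" by (simp add: C'_def)
  have C': "hnorm ((S ^^ n) x) \<le> C' * hnorm x" if "x \<in> H" for n x
    using C[OF that, of n] mult_right_mono[of C C' "hnorm x"] that by (simp add: C'_def)
  define L where "L = (1 + C') / \<delta>"
  have L0: "0 < L" using C'1 \<delta>(1) by (simp add: L_def)
  have partial: "hnorm (\<Sum>k<N. smul (c ^ k) ((S ^^ k) x)) \<le> L * hnorm x"
    if x: "x \<in> H" and c: "cmod c = 1" for c x and N :: nat
  proof -
    define y where "y = (\<Sum>k<N. smul (c ^ k) ((S ^^ k) x))"
    have yH: "y \<in> H" unfolding y_def using x by (simp add: funpow_H[OF S])
    have tel: "(\<Sum>k<N. smul (c ^ k) ((S ^^ k) x)) - smul c (S (\<Sum>k<N. smul (c ^ k) ((S ^^ k) x))) = x - smul (c ^ N) ((S ^^ N) x)" for N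
    proof (induction N)
      case 0
      then show ?case by (simp add: op_zero[OF S])
    next
      case (Suc N)
      have "S (\<Sum>k<Suc N. smul (c ^ k) ((S ^^ k) x)) = S (\<Sum>k<N. smul (c ^ k) ((S ^^ k) x)) + smul (c ^ N) ((S ^^ Suc N) x)"
        using x by (simp add: op_add[OF S] op_smul[OF S] funpow_H[OF S])
      then show ?case using Suc by (simp add: scale_right_distrib algebra_simps)
    qed
    have cn: "c \<noteq> 0" using c by auto
    have "smul (- c) (S y - smul (1 / c) y) = y - smul c (S y)"
      using cn by (simp add: scale_right_diff_distrib)
    then have "hnorm (S y - smul (1 / c) y) = hnorm (x - smul (c ^ N) ((S ^^ N) x))"
      using hnorm_smul[of "S y - smul (1 / c) y" "- c"] yH op_H[OF S yH] c tel[of N] by (simp add: y_def)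
    also have "\<dots> \<le> hnorm (x - 0) + hnorm (0 - smul (c ^ N) ((S ^^ N) x))"
      using x by (intro hnorm_triangle_diff) (simp_all add: funpow_H[OF S])
    also have "\<dots> = hnorm x + hnorm ((S ^^ N) x)"
      using x c by (simp add: hnorm_minus hnorm_smul funpow_H[OF S] norm_power)
    also have "\<dots> \<le> (1 + C') * hnorm x" using C'[OF x, of N] by (simp add: algebra_simps)
    finally have "\<delta> * hnorm y \<le> (1 + C') * hnorm x"
      using \<delta>(2)[OF _ yH, of "1 / c"] c by (simp add: norm_divide)
    then show ?thesis using \<delta>(1) by (simp add: L_def y_def field_simps)
  qed
  have square_sum: "(\<Sum>k<N. (hnorm ((S ^^ k) x))\<^sup>2) \<le> L\<^sup>2 * (hnorm x)\<^sup>2" if x: "x \<in> H" and N: "0 < N" for x N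
  proof -
    have "real N * (\<Sum>k<N. (hnorm ((S ^^ k) x))\<^sup>2)
        = (\<Sum>j<N. (hnorm (\<Sum>k<N. smul (cis (2 * pi * real j / real N) ^ k) ((S ^^ k) x)))\<^sup>2)"
      by (rule parseval_roots_of_unity[symmetric]) (rule funpow_H[OF S x])
    also have "\<dots> \<le> (\<Sum>j<N. (L * hnorm x)\<^sup>2)"
      using x by (intro sum_mono power_mono partial hnorm_nonneg) (simp_all add: funpow_H[OF S])
    finally show ?thesis using N by (simp add: power_mult_distrib)
  qed
  have large: "real N * (hnorm ((S ^^ N) x))\<^sup>2 \<le> (C' * L * hnorm x)\<^sup>2" if x: "x \<in> H" and N: "0 < N" for x N
  proof -
    have "real N * (hnorm ((S ^^ N) x))\<^sup>2 = (\<Sum>k<N. (hnorm ((S ^^ (N - k)) ((S ^^ k) x)))\<^sup>2)"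
    proof -
      have "(S ^^ (N - k)) ((S ^^ k) x) = (S ^^ N) x" if "k < N" for k
        using that funpow_add[of "N - k" k S] by (simp add: fun_eq_iff)
      then show ?thesis by simp
    qed
    also have "\<dots> \<le> (\<Sum>k<N. (C' * hnorm ((S ^^ k) x))\<^sup>2)"
      using x by (intro sum_mono power_mono C' hnorm_nonneg) (simp_all add: funpow_H[OF S])
    also have "\<dots> = C'\<^sup>2 * (\<Sum>k<N. (hnorm ((S ^^ k) x))\<^sup>2)"
      by (simp add: power_mult_distrib sum_distrib_left)
    also have "\<dots> \<le> C'\<^sup>2 * (L\<^sup>2 * (hnorm x)\<^sup>2)" using square_sum[OF x N] by (intro mult_left_mono) auto
    finally show ?thesis by (simp add: power_mult_distrib mult_ac)
  qed
  obtain N :: nat where N: "4 * (C' * L)\<^sup>2 < real N" using reals_Archimedean2 by blast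
  have N0: "0 < N" using N by (metis gr_zeroI not_less of_nat_0 zero_le_mult_iff zero_le_numeral zero_le_power2)
  have half: "hnorm ((S ^^ N) x) \<le> 1 / 2 * hnorm x" if x: "x \<in> H" for x
  proof (rule power2_le_imp_le)
    have "4 * (C' * L)\<^sup>2 * (hnorm ((S ^^ N) x))\<^sup>2 \<le> real N * (hnorm ((S ^^ N) x))\<^sup>2"
      using N by (intro mult_right_mono) auto
    also have "\<dots> \<le> (C' * L * hnorm x)\<^sup>2" using large[OF x N0] .
    finally have "(C' * L)\<^sup>2 * (4 * (hnorm ((S ^^ N) x))\<^sup>2) \<le> (C' * L)\<^sup>2 * (hnorm x)\<^sup>2"
      by (simp add: power_mult_distrib mult_ac)
    moreover have "0 < (C' * L)\<^sup>2" using C'1 L0 by simp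
    ultimately have "4 * (hnorm ((S ^^ N) x))\<^sup>2 \<le> (hnorm x)\<^sup>2" by (simp only: mult_le_cancel_left_pos)
    then show "(hnorm ((S ^^ N) x))\<^sup>2 \<le> (1 / 2 * hnorm x)\<^sup>2" by (simp add: power_divide)
  qed (use x in simp)
  \<comment> \<open>The factor \<open>2\<close> in the final bound compensates the at most \<open>N - 1\<close> powers beyond a multiple of \<open>N\<close>.\<close>
  define \<rho> where "\<rho> = root N (1 / 2)"
  have \<rho>: "0 < \<rho>" "\<rho> < 1" "\<rho> ^ N = 1 / 2" using N0 by (auto simp: \<rho>_def)
  have geo: "hnorm ((S ^^ (N * m)) x) \<le> (1 / 2) ^ m * hnorm x" if "x \<in> H" for m x
  proof (induction m)
    case (Suc m)
    have "(S ^^ (N * Suc m)) x = (S ^^ N) ((S ^^ (N * m)) x)" by (simp add: funpow_add)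
    then show ?case using half[OF funpow_H[OF S that], of "N * m"] Suc by simp
  qed simp
  have "hnorm ((S ^^ n) x) \<le> (2 * C') * \<rho> ^ n * hnorm x" if x: "x \<in> H" for n x
  proof -
    have n: "n = n mod N + N * (n div N)" by simp
    have "(S ^^ n) x = (S ^^ (n mod N)) ((S ^^ (N * (n div N))) x)"
      by (subst n, subst funpow_add) simp
    then have "hnorm ((S ^^ n) x) \<le> C' * hnorm ((S ^^ (N * (n div N))) x)"
      using C'[OF funpow_H[OF S x]] by simp
    also have "\<dots> \<le> C' * ((1 / 2) ^ (n div N) * hnorm x)"
      using C'1 geo[OF x] by (intro mult_left_mono) auto
    also have "(1 / 2) ^ (n div N) \<le> 2 * \<rho> ^ n"
    proof -
      have "\<rho> ^ N * \<rho> ^ (N * (n div N)) = \<rho> ^ (N + N * (n div N))" by (simp add: power_add)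
      also have "\<dots> \<le> \<rho> ^ n"
      proof (rule power_decreasing)
        have "n mod N < N" using N0 by simp
        then show "n \<le> N + N * (n div N)" using n by linarith
      qed (use \<rho> in auto)
      finally show ?thesis using \<rho>(3) by (simp add: power_mult)
    qed
    finally show ?thesis using C'1 x by (simp add: mult_left_mono mult_right_mono mult_ac)
  qed
  then show ?thesis using that[of "2 * C'" \<rho>] C'1 \<rho> by auto
qed

lemma second_difference_power_bounded:
  assumes q: "0 \<le> q" "q < 1" and A: "A \<in> bounded_ops"
    and rec: "\<And>z. z \<in> H \<Longrightarrow> (hnorm (A (A z)))\<^sup>2 + q * (hnorm z)\<^sup>2 \<le> (1 + q) * (hnorm (A z))\<^sup>2"
    and one: "\<And>z. z \<in> H \<Longrightarrow> (hnorm (A z))\<^sup>2 \<le> (1 + q) * (hnorm z)\<^sup>2"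
    and x: "x \<in> H"
  shows "hnorm ((A ^^ n) x) \<le> 1 / (1 - q) * hnorm x"
proof (rule power2_le_imp_le)
  define b where "b n = (hnorm ((A ^^ n) x))\<^sup>2" for n
  have "b n \<le> b 0 / (1 - q)"
    by (rule second_difference_bound[OF q])
       (use rec[OF funpow_H[OF A x]] one[OF x] in \<open>simp_all add: b_def\<close>)
  also have "\<dots> \<le> (1 / (1 - q))\<^sup>2 * b 0"
  proof -
    have "1 \<le> 1 / (1 - q)" using q by simp
    then have "1 / (1 - q) * 1 \<le> 1 / (1 - q) * (1 / (1 - q))" using q by (intro mult_left_mono) auto
    then have "1 / (1 - q) * b 0 \<le> (1 / (1 - q))\<^sup>2 * b 0" unfolding power2_eq_square[of "1 / (1 - q)"]
      by (intro mult_right_mono) (auto simp: b_def)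
    then show ?thesis by simp
  qed
  finally show "(hnorm ((A ^^ n) x))\<^sup>2 \<le> (1 / (1 - q) * hnorm x)\<^sup>2" by (simp add: b_def power_mult_distrib power_divide)
qed (use x q in simp)

text \<open>The lower bounds vary continuously with \<open>c\<close>, so finitely many of them suffice on a compact set.\<close>

lemma uniform_lower_bound:
  assumes S: "S \<in> bounded_ops" and Z: "compact Z"
    and lb: "\<And>c. c \<in> Z \<Longrightarrow> \<exists>d>0. \<forall>x\<in>H. d * hnorm x \<le> hnorm (S x - smul c x)"
  obtains \<delta> where "0 < \<delta>" "\<And>c x. c \<in> Z \<Longrightarrow> x \<in> H \<Longrightarrow> \<delta> * hnorm x \<le> hnorm (S x - smul c x)"
proof -
  obtain d where d: "\<And>c. c \<in> Z \<Longrightarrow> 0 < d c" "\<And>c x. c \<in> Z \<Longrightarrow> x \<in> H \<Longrightarrow> d c * hnorm x \<le> hnorm (S x - smul c x)"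
    using lb by metis
  obtain D where D: "D \<subseteq> Z" "finite D" "Z \<subseteq> (\<Union>c\<in>D. ball c (d c / 2))"
    by (rule compactE_image[OF Z, of Z "\<lambda>c. ball c (d c / 2)"]) (use d in auto)
  define \<delta> where "\<delta> = Min (insert 1 ((\<lambda>c. d c / 2) ` D))"
  have "0 < \<delta>" unfolding \<delta>_def using D d by (subst Min_gr_iff) auto
  moreover have "\<delta> * hnorm x \<le> hnorm (S x - smul c x)" if c: "c \<in> Z" and x: "x \<in> H" for c x
  proof -
    obtain c' where c': "c' \<in> D" "c \<in> ball c' (d c' / 2)" using D(3) c by blast
    have SxH: "S x \<in> H" by (rule op_H[OF S x])
    have "d c' * hnorm x \<le> hnorm (S x - smul c' x)" using d(2) c' D(1) x by blast
    also have "\<dots> \<le> hnorm (S x - smul c x) + hnorm (smul c x - smul c' x)"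
      using x SxH by (intro hnorm_triangle_diff) auto
    also have "smul c x - smul c' x = smul (c - c') x" by (simp add: scale_left_diff_distrib)
    also have "hnorm (smul (c - c') x) \<le> d c' / 2 * hnorm x"
      unfolding hnorm_smul[OF x] using c' x by (intro mult_right_mono) (auto simp: dist_norm norm_minus_commute)
    finally have "d c' / 2 * hnorm x \<le> hnorm (S x - smul c x)" by (simp add: field_simps)
    moreover have "\<delta> \<le> d c' / 2" unfolding \<delta>_def using c' D(2) by (intro Min_le) auto
    ultimately show ?thesis using mult_right_mono[of \<delta> "d c' / 2" "hnorm x"] x by simp
  qed
  ultimately show ?thesis using that by blast
qed

lemma inverse_op:
  assumes T: "T \<in> bounded_ops" "invertible_op T"
  shows inverse_op_bounded: "inverse_op T \<in> bounded_ops"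
    and inverse_op_left: "\<And>x. x \<in> H \<Longrightarrow> inverse_op T (T x) = x"
    and inverse_op_right: "\<And>x. x \<in> H \<Longrightarrow> T (inverse_op T x) = x"
proof -
  obtain S where S: "S \<in> bounded_ops" "S \<circ> T = id_op" "T \<circ> S = id_op" using T by (auto simp: invertible_op_def)
  have "inverse_op T = S"
    unfolding inverse_op_def
  proof (rule the_equality)
    fix R assume R: "R \<in> bounded_ops \<and> R \<circ> T = id_op \<and> T \<circ> R = id_op"
    have RT: "R (T z) = z" if "z \<in> H" for z using R that by (metis comp_apply id_op_def)
    show "R = S"
    proof
      fix x
      show "R x = S x"
      proof (cases "x \<in> H")
        case True
        have "R x = R (T (S x))" using fun_cong[OF S(3), of x] True by (simp add: id_op_def)
        also have "\<dots> = S x" using RT[OF op_H[OF S(1) True]] .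
        finally show ?thesis .
      next
        case False
        then show ?thesis using R S op_outside by metis
      qed
    qed
  qed (use S in auto)
  then show "inverse_op T \<in> bounded_ops" "\<And>x. x \<in> H \<Longrightarrow> inverse_op T (T x) = x" "\<And>x. x \<in> H \<Longrightarrow> T (inverse_op T x) = x"
    using S(1) fun_cong[OF S(2), unfolded comp_apply id_op_def] fun_cong[OF S(3), unfolded comp_apply id_op_def] by simp_all
qed

end

text \<open>Integer powers of \<open>A\<close>, where \<open>B\<close> plays the role of the inverse of \<open>A\<close>.\<close>

definition zpow :: "('v \<Rightarrow> 'v) \<Rightarrow> ('v \<Rightarrow> 'v) \<Rightarrow> int \<Rightarrow> 'v \<Rightarrow> 'v" where
  "zpow A B n = (if 0 \<le> n then A ^^ nat n else B ^^ nat (- n))"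

lemma zpow_0 [simp]: "zpow A B 0 x = x" by (simp add: zpow_def)

locale inverse_pair =
  fixes H :: "'v set" and A B :: "'v \<Rightarrow> 'v"
  assumes AH: "x \<in> H \<Longrightarrow> A x \<in> H" and BH: "x \<in> H \<Longrightarrow> B x \<in> H"
    and AB: "x \<in> H \<Longrightarrow> A (B x) = x" and BA: "x \<in> H \<Longrightarrow> B (A x) = x"
begin

lemma funpow_closed: "x \<in> H \<Longrightarrow> (A ^^ n) x \<in> H" "x \<in> H \<Longrightarrow> (B ^^ n) x \<in> H"
  by (induction n) (auto intro: AH BH)

lemma zpow_H: "x \<in> H \<Longrightarrow> zpow A B n x \<in> H"
  by (simp add: zpow_def funpow_closed)

lemma zpow_Suc: assumes x: "x \<in> H" shows "A (zpow A B n x) = zpow A B (n + 1) x"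
proof (cases "0 \<le> n")
  case True
  then show ?thesis by (simp add: zpow_def nat_add_distrib)
next
  case False
  then have "nat (- n) = Suc (nat (- (n + 1)))" by simp
  then have "zpow A B n x = B ((B ^^ nat (- (n + 1))) x)" using False by (simp add: zpow_def)
  then have "A (zpow A B n x) = (B ^^ nat (- (n + 1))) x" using AB[OF funpow_closed(2)[OF x]] by simp
  also have "\<dots> = zpow A B (n + 1) x" using False by (cases "n = -1") (auto simp: zpow_def)
  finally show ?thesis .
qed

lemma zpow_pred: assumes x: "x \<in> H" shows "B (zpow A B n x) = zpow A B (n - 1) x"
  using zpow_Suc[OF x, of "n - 1"] BA[OF zpow_H[OF x, of "n - 1"]] by simp

lemma zpow_add: assumes x: "x \<in> H" shows "zpow A B m (zpow A B n x) = zpow A B (m + n) x"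
proof (induction m rule: int_induct[where k = 0])
  case base
  then show ?case by simp
next
  case (step1 m)
  then show ?case using zpow_Suc[OF zpow_H[OF x], of m n] zpow_Suc[OF x, of "m + n"] by (simp add: algebra_simps)
next
  case (step2 m)
  then show ?case using zpow_pred[OF zpow_H[OF x], of m n] zpow_pred[OF x, of "m + n"] by (simp add: algebra_simps)
qed

end

context complex_hilbert_space
begin

text \<open>If \<open>R\<close> inverts \<open>T - c\<close>, then \<open>\<langle>x, x\<rangle> = \<langle>(T\<^sup>* - cnj c) x, R x\<rangle>\<close>.\<close>

lemma adjoint_bounded_below:
  assumes T: "T \<in> bounded_ops" and c: "c \<notin> spectrum_op T"
  shows "\<exists>d>0. \<forall>x\<in>H. d * hnorm x \<le> hnorm (adjoint_op T x - smul (cnj c) x)"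
proof -
  have "invertible_op (\<lambda>x. T x - smul c (id_op x))" using c by (simp add: spectrum_op_def)
  then obtain R where R: "R \<in> bounded_ops" "(\<lambda>x. T x - smul c (id_op x)) \<circ> R = id_op"
    by (auto simp: invertible_op_def)
  obtain K where K: "0 \<le> K" "\<And>x. x \<in> H \<Longrightarrow> hnorm (R x) \<le> K * hnorm x" by (rule op_bounded[OF R(1)]) blast
  have "1 / (K + 1) * hnorm x \<le> hnorm (adjoint_op T x - smul (cnj c) x)" if x: "x \<in> H" for x
  proof -
    define z where "z = adjoint_op T x - smul (cnj c) x"
    have zH: "z \<in> H" unfolding z_def using x op_H[OF adjoint_op_bounded[OF T] x] by simp
    have RH: "R x \<in> H" by (rule op_H[OF R(1) x])
    have "T (R x) - smul c (R x) = x" using fun_cong[OF R(2), of x] x RH by (simp add: id_op_def)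
    then have "ip x x = ip x (T (R x) - smul c (R x))" by simp
    also have "\<dots> = ip z (R x)"
      unfolding z_def using x RH op_H[OF T RH] op_H[OF adjoint_op_bounded[OF T] x]
      by (simp add: s_diff s_diff_right s_smul s_smul_right adjoint_op_ip'[OF T])
    finally have "(hnorm x)\<^sup>2 = cmod (ip z (R x))" using ip_self[OF x] by (metis norm_of_real abs_of_nonneg zero_le_power2)
    also have "\<dots> \<le> hnorm z * hnorm (R x)" by (rule cauchy_schwarz[OF zH RH])
    also have "\<dots> \<le> hnorm z * ((K + 1) * hnorm x)"
      using K(2)[OF x] zH x by (intro mult_left_mono) (auto simp: algebra_simps intro: order_trans)
    finally have "hnorm x * hnorm x \<le> ((K + 1) * hnorm z) * hnorm x" by (simp add: power2_eq_square mult_ac)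
    then have "hnorm x \<le> (K + 1) * hnorm z"
      using K(1) zH x hnorm_nonneg[OF x] by (cases "hnorm x = 0") auto
    then show ?thesis unfolding z_def[symmetric] using K(1) by (simp add: field_simps)
  qed
  then show ?thesis using K(1) by (intro exI[of _ "1 / (K + 1)"]) auto
qed

end

locale class_F_operator = complex_hilbert_space smul H ip
  for smul :: "complex \<Rightarrow> 'v::ab_group_add \<Rightarrow> 'v" and H ip +
  fixes r :: real and T :: "'v \<Rightarrow> 'v"
  assumes r: "0 < r" "r < 1" and T: "T \<in> class_F_on r"
begin

abbreviation "Ti \<equiv> inverse_op T"
abbreviation "S \<equiv> adjoint_op T"
abbreviation "Si \<equiv> adjoint_op Ti"

lemma T_bounded: "T \<in> bounded_ops" and T_inv: "invertible_op T" and T_spec: "spectrum_op T \<subseteq> annulus r"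
  using T by (auto simp: class_F_on_def)

lemmas Ti_bounded = inverse_op_bounded[OF T_bounded T_inv]
lemmas S_bounded = adjoint_op_bounded[OF T_bounded]
lemmas Si_bounded = adjoint_op_bounded[OF Ti_bounded]
lemmas ops_H = op_H[OF T_bounded] op_H[OF Ti_bounded] op_H[OF S_bounded] op_H[OF Si_bounded]

sublocale T: inverse_pair H T Ti
  by unfold_locales (auto simp: ops_H inverse_op_left[OF T_bounded T_inv] inverse_op_right[OF T_bounded T_inv])

sublocale S: inverse_pair H S Si
proof
  fix x assume x: "x \<in> H"
  show "S (Si x) = x"
    by (rule ip_eqI) (simp_all add: x ops_H adjoint_op_ip'[OF T_bounded] adjoint_op_ip'[OF Ti_bounded] T.BA)
  show "Si (S x) = x"
    by (rule ip_eqI) (simp_all add: x ops_H adjoint_op_ip'[OF T_bounded] adjoint_op_ip'[OF Ti_bounded] T.AB)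
qed (auto simp: ops_H)

text \<open>The operator inequality of the class, read as an inequality between quadratic forms.\<close>

lemma defect_nonneg:
  assumes x: "x \<in> H"
  shows "r\<^sup>2 * (hnorm (Si x))\<^sup>2 + (hnorm (S x))\<^sup>2 \<le> (r\<^sup>2 + 1) * (hnorm x)\<^sup>2"
proof -
  have "0 \<le> Re (ip (smul (of_real (r\<^sup>2 + 1)) (id_op x) - (smul (of_real (r\<^sup>2)) (Ti (Si x)) + T (S x))) x)"
    using T x unfolding class_F_on_def op_le_def by blast
  also have "ip (smul (of_real (r\<^sup>2 + 1)) (id_op x) - (smul (of_real (r\<^sup>2)) (Ti (Si x)) + T (S x))) x
     = of_real (r\<^sup>2 + 1) * ip x x - (of_real (r\<^sup>2) * ip (Si x) (Si x) + ip (S x) (S x))"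
    using x by (simp add: id_op_def s_diff s_add s_smul ops_H adjoint_op_ip[OF T_bounded] adjoint_op_ip[OF Ti_bounded])
  also have "\<dots> = of_real ((r\<^sup>2 + 1) * (hnorm x)\<^sup>2 - (r\<^sup>2 * (hnorm (Si x))\<^sup>2 + (hnorm (S x))\<^sup>2))"
    using x by (simp add: ip_self ops_H)
  finally show ?thesis by simp
qed

lemma S_power_bounded:
  assumes x: "x \<in> H"
  shows "hnorm ((S ^^ n) x) \<le> 1 / (1 - r\<^sup>2) * hnorm x"
proof (rule second_difference_power_bounded[OF _ _ S_bounded _ _ x])
  show "(hnorm (S (S z)))\<^sup>2 + r\<^sup>2 * (hnorm z)\<^sup>2 \<le> (1 + r\<^sup>2) * (hnorm (S z))\<^sup>2" if "z \<in> H" for z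
    using defect_nonneg[OF ops_H(3)[OF that]] S.BA[OF that] by (simp add: add.commute)
  show "(hnorm (S z))\<^sup>2 \<le> (1 + r\<^sup>2) * (hnorm z)\<^sup>2" if "z \<in> H" for z
  proof -
    have "0 \<le> r\<^sup>2 * (hnorm (Si z))\<^sup>2" by simp
    then show ?thesis using defect_nonneg[OF that] unfolding add.commute[of 1 "r\<^sup>2"] by linarith
  qed
qed (use r in \<open>auto simp: power_less_one_iff\<close>)

text \<open>\<open>Q\<close> is the adjoint of \<open>r T\<^sup>-\<^sup>1\<close>. The class is invariant under \<open>T \<mapsto> r T\<^sup>-\<^sup>1\<close>, so the estimates for the
powers of \<open>S\<close> have counterparts for the powers of \<open>Q\<close>, and these control the negative powers of \<open>S\<close>.\<close>

definition Q :: "'v \<Rightarrow> 'v" where "Q x = smul (of_real r) (Si x)"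

lemma Q_H: "x \<in> H \<Longrightarrow> Q x \<in> H" by (simp add: Q_def ops_H)

lemma Q_bounded: "Q \<in> bounded_ops"
proof -
  obtain K where K: "0 \<le> K" "\<And>x. x \<in> H \<Longrightarrow> hnorm (Si x) \<le> K * hnorm x" by (rule op_bounded[OF Si_bounded]) blast
  show ?thesis
    by (rule bounded_opsI[where K = "r * K"])
       (use r K in \<open>simp_all add: Q_def ops_H op_outside[OF Si_bounded] op_add[OF Si_bounded] op_smul[OF Si_bounded]
          scale_right_distrib mult.commute hnorm_smul mult_left_mono mult.assoc\<close>)
qed

lemma Q_power: "x \<in> H \<Longrightarrow> (Q ^^ n) x = smul (of_real (r ^ n)) ((Si ^^ n) x)"
  by (induction n) (simp_all add: Q_def op_smul[OF Si_bounded] S.funpow_closed)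

lemma Q_power_bounded:
  assumes x: "x \<in> H"
  shows "hnorm ((Q ^^ n) x) \<le> 1 / (1 - r\<^sup>2) * hnorm x"
proof (rule second_difference_power_bounded[OF _ _ Q_bounded _ _ x])
  have defect: "(hnorm (Q z))\<^sup>2 + (hnorm (S z))\<^sup>2 \<le> (1 + r\<^sup>2) * (hnorm z)\<^sup>2" if "z \<in> H" for z
    using defect_nonneg[OF that] r that by (simp add: Q_def hnorm_smul ops_H power_mult_distrib add.commute)
  show "(hnorm (Q (Q z)))\<^sup>2 + r\<^sup>2 * (hnorm z)\<^sup>2 \<le> (1 + r\<^sup>2) * (hnorm (Q z))\<^sup>2" if z: "z \<in> H" for z
  proof -
    have "S (Q z) = smul (of_real r) z" using z by (simp add: Q_def op_smul[OF S_bounded] ops_H S.AB)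
    then have "(hnorm (S (Q z)))\<^sup>2 = r\<^sup>2 * (hnorm z)\<^sup>2" using z by (simp add: hnorm_smul power_mult_distrib)
    then show ?thesis using defect[OF Q_H[OF z]] by simp
  qed
  show "(hnorm (Q z))\<^sup>2 \<le> (1 + r\<^sup>2) * (hnorm z)\<^sup>2" if "z \<in> H" for z
    using defect[OF that] zero_le_power2[of "hnorm (S z)"] by linarith
qed (use r in \<open>auto simp: power_less_one_iff\<close>)

lemma S_bounded_below_circle:
  assumes "t = r \<or> t = 1"
  obtains \<delta> where "0 < \<delta>" "\<And>c x. cmod c = t \<Longrightarrow> x \<in> H \<Longrightarrow> \<delta> * hnorm x \<le> hnorm (S x - smul c x)"
proof (rule uniform_lower_bound[OF S_bounded compact_sphere[of 0 t]])
  fix c :: complex assume "c \<in> sphere 0 t"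
  then have "cnj c \<notin> annulus r" using assms by (auto simp: annulus_def)
  then have "cnj c \<notin> spectrum_op T" using T_spec by blast
  from adjoint_bounded_below[OF T_bounded this]
  show "\<exists>d>0. \<forall>x\<in>H. d * hnorm x \<le> hnorm (S x - smul c x)" by simp
qed (use that in auto)

lemma Q_bounded_below:
  obtains \<delta> where "0 < \<delta>" "\<And>c x. cmod c = 1 \<Longrightarrow> x \<in> H \<Longrightarrow> \<delta> * hnorm x \<le> hnorm (Q x - smul c x)"
proof -
  obtain \<delta> where \<delta>: "0 < \<delta>" "\<And>c x. cmod c = r \<Longrightarrow> x \<in> H \<Longrightarrow> \<delta> * hnorm x \<le> hnorm (S x - smul c x)"
    by (rule S_bounded_below_circle[of r]) auto
  obtain K where K: "0 \<le> K" "\<And>x. x \<in> H \<Longrightarrow> hnorm (S x) \<le> K * hnorm x" by (rule op_bounded[OF S_bounded]) blast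
  have "\<delta> / (K + 1) * hnorm x \<le> hnorm (Q x - smul c x)" if c: "cmod c = 1" and x: "x \<in> H" for c x
  proof -
    define z where "z = Si x"
    have zH: "z \<in> H" and xz: "x = S z" using x by (auto simp: z_def ops_H S.AB)
    have cn: "c \<noteq> 0" using c by auto
    have "Q x - smul c x = smul (- c) (S z - smul (of_real r / c) z)"
      using cn by (simp add: Q_def z_def[symmetric] xz[symmetric] scale_right_diff_distrib)
    then have "hnorm (Q x - smul c x) = hnorm (S z - smul (of_real r / c) z)"
      using zH c hnorm_smul[of "S z - smul (of_real r / c) z" "- c"] by (simp add: ops_H)
    moreover have "\<delta> * hnorm z \<le> hnorm (S z - smul (of_real r / c) z)"
      using \<delta>(2)[of "of_real r / c" z] c zH r by (simp add: norm_divide)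
    moreover have "\<delta> * hnorm x \<le> \<delta> * ((K + 1) * hnorm z)"
      using K(2)[OF zH] \<delta>(1) zH by (intro mult_left_mono) (auto simp: xz algebra_simps intro: order_trans)
    moreover have "\<delta> * ((K + 1) * hnorm z) = (K + 1) * (\<delta> * hnorm z)" by simp
    ultimately have "\<delta> * hnorm x \<le> (K + 1) * hnorm (Q x - smul c x)"
      using mult_left_mono[of "\<delta> * hnorm z" "hnorm (Q x - smul c x)" "K + 1"] K(1) by linarith
    then show ?thesis using K(1) by (simp add: field_simps)
  qed
  then show ?thesis using that[of "\<delta> / (K + 1)"] \<delta>(1) K(1) by auto
qed

lemma powers_decay:
  obtains K \<rho> where "0 \<le> K" "r < \<rho>" "\<rho> < 1"
    "\<And>n x. x \<in> H \<Longrightarrow> hnorm ((S ^^ n) x) \<le> K * \<rho> ^ n * hnorm x"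
    "\<And>n x. x \<in> H \<Longrightarrow> r ^ n * hnorm ((Si ^^ n) x) \<le> K * \<rho> ^ n * hnorm x"
proof -
  obtain \<delta>1 where \<delta>1: "0 < \<delta>1" "\<And>c x. cmod c = 1 \<Longrightarrow> x \<in> H \<Longrightarrow> \<delta>1 * hnorm x \<le> hnorm (S x - smul c x)"
    by (rule S_bounded_below_circle[of 1]) auto
  obtain K1 \<rho>1 where 1: "0 \<le> K1" "0 < \<rho>1" "\<rho>1 < 1" "\<And>n x. x \<in> H \<Longrightarrow> hnorm ((S ^^ n) x) \<le> K1 * \<rho>1 ^ n * hnorm x"
    using power_bounded_decay[OF S_bounded S_power_bounded \<delta>1] by blast
  obtain \<delta>2 where \<delta>2: "0 < \<delta>2" "\<And>c x. cmod c = 1 \<Longrightarrow> x \<in> H \<Longrightarrow> \<delta>2 * hnorm x \<le> hnorm (Q x - smul c x)"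
    by (rule Q_bounded_below) auto
  obtain K2 \<rho>2 where 2: "0 \<le> K2" "0 < \<rho>2" "\<rho>2 < 1" "\<And>n x. x \<in> H \<Longrightarrow> hnorm ((Q ^^ n) x) \<le> K2 * \<rho>2 ^ n * hnorm x"
    using power_bounded_decay[OF Q_bounded Q_power_bounded \<delta>2] by blast
  define K where "K = max K1 K2"
  \<comment> \<open>A common rate, enlarged beyond \<open>r\<close> so that \<open>\<rho>\<close> and \<open>r / \<rho>\<close> are radii of the annulus.\<close>
  define \<rho> where "\<rho> = max ((r + 1) / 2) (max \<rho>1 \<rho>2)"
  have le: "K1 * \<rho>1 ^ n * hnorm x \<le> K * \<rho> ^ n * hnorm x" "K2 * \<rho>2 ^ n * hnorm x \<le> K * \<rho> ^ n * hnorm x" if "x \<in> H" for n x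
    using 1 2 that by (intro mult_right_mono mult_mono power_mono; simp add: K_def \<rho>_def)+
  show ?thesis
  proof (rule that[of K \<rho>])
    show "0 \<le> K" "r < \<rho>" "\<rho> < 1" using 1 2 r by (simp_all add: K_def \<rho>_def less_max_iff_disj)
    fix n x assume x: "x \<in> H"
    show "hnorm ((S ^^ n) x) \<le> K * \<rho> ^ n * hnorm x" using 1(4)[OF x] le(1)[OF x] order_trans by blast
    have "r ^ n * hnorm ((Si ^^ n) x) = hnorm ((Q ^^ n) x)" using x r by (simp add: Q_power hnorm_smul S.funpow_closed norm_power)
    then show "r ^ n * hnorm ((Si ^^ n) x) \<le> K * \<rho> ^ n * hnorm x" using 2(4)[OF x, of n] le(2)[OF x, of n] by linarith
  qed
qed

lemma funpow_adjoint:
  assumes A: "A \<in> bounded_ops" and y: "y \<in> H"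
  shows "x \<in> H \<Longrightarrow> ip ((A ^^ n) x) y = ip x ((adjoint_op A ^^ n) y)"
proof (induction n arbitrary: x)
  case (Suc n)
  have "ip ((A ^^ Suc n) x) y = ip ((A ^^ n) (A x)) y" by (simp add: funpow_swap1)
  also have "\<dots> = ip x ((adjoint_op A ^^ Suc n) y)"
    using Suc y by (simp add: op_H[OF A] adjoint_op_ip[OF A] funpow_H[OF adjoint_op_bounded[OF A]])
  finally show ?case .
qed simp

lemma zpow_adjoint: "x \<in> H \<Longrightarrow> y \<in> H \<Longrightarrow> ip (zpow T Ti n x) y = ip x (zpow S Si n y)"
  by (simp add: zpow_def funpow_adjoint[OF T_bounded] funpow_adjoint[OF Ti_bounded])

lemma op_powi_zpow: "x \<in> H \<Longrightarrow> op_powi T n x = zpow T Ti n x"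
  by (simp add: op_powi_def zpow_def id_op_def)

text \<open>The bound consists of values of \<open>z\<^sup>n\<close> at points of the annulus, against which Laurent coefficients are
absolutely summable.\<close>

lemma zpow_S_bound:
  obtains K t u where "0 \<le> K" "r < t" "t < 1" "r < u" "u < 1"
    "\<And>n x. x \<in> H \<Longrightarrow> hnorm (zpow S Si n x) \<le> K * (t powi n + u powi n) * hnorm x"
proof -
  obtain K \<rho> where K: "0 \<le> K" and \<rho>: "r < \<rho>" "\<rho> < 1"
    and d: "\<And>n x. x \<in> H \<Longrightarrow> hnorm ((S ^^ n) x) \<le> K * \<rho> ^ n * hnorm x"
    "\<And>n x. x \<in> H \<Longrightarrow> r ^ n * hnorm ((Si ^^ n) x) \<le> K * \<rho> ^ n * hnorm x"
    by (rule powers_decay) blast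
  have p: "0 < \<rho> powi n" "0 < (r / \<rho>) powi n" for n using r \<rho> by auto
  have "hnorm (zpow S Si n x) \<le> K * (\<rho> powi n + (r / \<rho>) powi n) * hnorm x" if x: "x \<in> H" for n x
  proof (cases "0 \<le> n")
    case True
    have "hnorm (zpow S Si n x) \<le> K * \<rho> powi n * hnorm x"
      using d(1)[OF x, of "nat n"] True by (simp add: zpow_def power_int_def)
    also have "\<dots> \<le> K * (\<rho> powi n + (r / \<rho>) powi n) * hnorm x"
      using p(2)[of n] K x by (intro mult_right_mono mult_left_mono) auto
    finally show ?thesis .
  next
    case False
    define m where "m = nat (- n)"
    have n: "n = - int m" using False by (simp add: m_def)
    have "r ^ m * hnorm (zpow S Si n x) \<le> K * \<rho> ^ m * hnorm x"
      using d(2)[OF x, of m] False by (simp add: zpow_def m_def)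
    then have "hnorm (zpow S Si n x) \<le> K * (\<rho> ^ m / r ^ m) * hnorm x" using r by (simp add: field_simps)
    also have "\<rho> ^ m / r ^ m = (r / \<rho>) powi n" unfolding n by (simp add: power_int_minus power_divide)
    also have "K * (r / \<rho>) powi n * hnorm x \<le> K * (\<rho> powi n + (r / \<rho>) powi n) * hnorm x"
      using p(1)[of n] K x by (intro mult_right_mono mult_left_mono) auto
    finally show ?thesis .
  qed
  moreover have "r < r / \<rho>" "r / \<rho> < 1" using r \<rho> by (auto simp: field_simps)
  ultimately show ?thesis using that[of K \<rho> "r / \<rho>"] K \<rho> by blast
qed

end


section \<open>The functional calculus and the upper bound\<close>

lemma has_sum_tail_bound:
  fixes f :: "'i \<Rightarrow> complex"
  assumes f: "(f has_sum s) UNIV" and \<beta>: "\<beta> summable_on UNIV" and F: "finite F"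
    and le: "\<And>n. cmod (f n) \<le> \<beta> n * c"
  shows "cmod (s - sum f F) \<le> (infsum \<beta> UNIV - sum \<beta> F) * c"
proof -
  have "(f has_sum (s - sum f F)) (UNIV - F)"
    by (rule has_sum_Diff[OF f]) (use F in \<open>auto intro: has_sum_finiteI\<close>)
  moreover have "(\<beta> has_sum (infsum \<beta> UNIV - sum \<beta> F)) (UNIV - F)"
    by (rule has_sum_Diff[OF has_sum_infsum[OF \<beta>]]) (use F in \<open>auto intro: has_sum_finiteI\<close>)
  then have "((\<lambda>n. \<beta> n * c) has_sum ((infsum \<beta> UNIV - sum \<beta> F) * c)) (UNIV - F)"
    by (rule has_sum_cmult_left)
  ultimately show ?thesis by (rule norm_infsum_le) (rule le)
qed

lemma infsum_minus_partial_tendsto: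
  fixes \<beta> :: "'i \<Rightarrow> real"
  assumes "\<beta> summable_on UNIV"
  shows "((\<lambda>F. infsum \<beta> UNIV - sum \<beta> F) \<longlongrightarrow> 0) (finite_subsets_at_top UNIV)"
  using tendsto_diff[OF tendsto_const[of "infsum \<beta> UNIV"] infsum_tendsto[OF assms]] by simp

context complex_inner_space
begin

lemma power_id_op_bounded: "A \<in> bounded_ops \<Longrightarrow> A ^^ k \<circ> id_op \<in> bounded_ops"
proof (induction k)
  case 0
  then show ?case using id_op_bounded by simp
next
  case (Suc k)
  have eq: "A ^^ Suc k \<circ> id_op = A \<circ> (A ^^ k \<circ> id_op)" by (simp add: o_assoc)
  show ?case unfolding eq by (rule comp_bounded[OF Suc.prems Suc.IH[OF Suc.prems]])
qed

text \<open>This makes the definite description of \<open>\<phi>(T)\<close> meaningful.\<close>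

lemma op_norm_limit_unique:
  assumes A: "\<And>F. A F \<in> bounded_ops" and P: "P \<in> bounded_ops" and P': "P' \<in> bounded_ops" and G: "G \<noteq> bot"
    and l: "((\<lambda>F. op_norm (\<lambda>x. A F x - P x)) \<longlongrightarrow> 0) G"
    and l': "((\<lambda>F. op_norm (\<lambda>x. A F x - P' x)) \<longlongrightarrow> 0) G"
  shows "P = P'"
proof
  fix x
  show "P x = P' x"
  proof (cases "x \<in> H")
    case True
    have b: "(\<lambda>x. A F x - R x) \<in> bounded_ops" if "R \<in> bounded_ops" for F R
      using minus_scaled_bounded[OF A[of F] that, of 1] by simp
    have le: "hnorm (P x - P' x) \<le> (op_norm (\<lambda>x. A F x - P x) + op_norm (\<lambda>x. A F x - P' x)) * hnorm x" for F
    proof -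
      have "hnorm (P x - P' x) \<le> hnorm (P x - A F x) + hnorm (A F x - P' x)"
        using True by (intro hnorm_triangle_diff) (simp_all add: op_H[OF P] op_H[OF P'] op_H[OF A])
      also have "hnorm (P x - A F x) = hnorm (A F x - P x)"
        using True by (intro hnorm_diff_commute) (simp_all add: op_H[OF P] op_H[OF A])
      finally show ?thesis using op_norm_upper[OF b[OF P] True, of F] op_norm_upper[OF b[OF P'] True, of F]
        by (simp add: distrib_right)
    qed
    have "((\<lambda>F. (op_norm (\<lambda>x. A F x - P x) + op_norm (\<lambda>x. A F x - P' x)) * hnorm x) \<longlongrightarrow> (0 + 0) * hnorm x) G"
      by (intro tendsto_intros l l')
    then have "hnorm (P x - P' x) \<le> (0 + 0) * hnorm x"
      by (rule tendsto_lowerbound[OF _ always_eventually[OF allI[OF le]] G])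
    moreover have PH: "P x - P' x \<in> H" using True by (simp add: op_H[OF P] op_H[OF P'])
    ultimately have "hnorm (P x - P' x) = 0" using hnorm_nonneg[OF PH] by simp
    then show ?thesis using hnorm_eq_0[OF PH] by simp
  next
    case False
    then show ?thesis by (simp add: op_outside[OF P] op_outside[OF P'])
  qed
qed

lemma hnorm_tendsto:
  assumes "\<And>k. z k \<in> H" "v \<in> H" "((\<lambda>k. hnorm (z k - v)) \<longlongrightarrow> 0) G"
  shows "((\<lambda>k. hnorm (z k)) \<longlongrightarrow> hnorm v) G"
proof (rule tendsto_sandwich)
  show "((\<lambda>k. hnorm v - hnorm (z k - v)) \<longlongrightarrow> hnorm v) G" "((\<lambda>k. hnorm v + hnorm (z k - v)) \<longlongrightarrow> hnorm v) G"
    using tendsto_diff[OF tendsto_const[of "hnorm v"] assms(3)] tendsto_add[OF tendsto_const[of "hnorm v"] assms(3)] by simp_all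
  have "hnorm v \<le> hnorm (v - z k) + hnorm (z k)" for k
    using hnorm_triangle[of "v - z k" "z k"] assms by simp
  then show "\<forall>\<^sub>F k in G. hnorm v - hnorm (z k - v) \<le> hnorm (z k)"
    using hnorm_diff_commute[OF assms(1,2)] by (intro always_eventually allI) (simp add: algebra_simps)
  have "hnorm (z k) \<le> hnorm (z k - v) + hnorm v" for k
    using hnorm_triangle[of "z k - v" v] assms by simp
  then show "\<forall>\<^sub>F k in G. hnorm (z k) \<le> hnorm v + hnorm (z k - v)"
    by (intro always_eventually allI) (simp add: algebra_simps)
qed

lemma op_tendsto:
  assumes A: "A \<in> bounded_ops" and "\<And>k. z k \<in> H" "v \<in> H" "((\<lambda>k. hnorm (z k - v)) \<longlongrightarrow> 0) G"
  shows "((\<lambda>k. hnorm (A (z k) - A v)) \<longlongrightarrow> 0) G"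
proof (rule tendsto_sandwich[OF _ _ tendsto_const])
  show "((\<lambda>k. op_norm A * hnorm (z k - v)) \<longlongrightarrow> 0) G"
    using tendsto_mult[OF tendsto_const[of "op_norm A"] assms(4)] by simp
  show "\<forall>\<^sub>F k in G. hnorm (A (z k) - A v) \<le> op_norm A * hnorm (z k - v)"
    using op_norm_upper[OF A, of "z _ - v"] assms by (intro always_eventually allI) (simp add: op_diff[OF A])
  show "\<forall>\<^sub>F k in G. 0 \<le> hnorm (A (z k) - A v)"
    using assms by (intro always_eventually allI hnorm_nonneg) (simp add: op_H[OF A])
qed

end

text \<open>The reciprocal weights solve \<open>(r\<^sup>2 + 1) / w\<^sub>n = r\<^sup>2 / w\<^sub>n\<^sub>+\<^sub>1 + 1 / w\<^sub>n\<^sub>-\<^sub>1\<close> for \<open>n \<noteq> 0\<close>, while at \<open>n = 0\<close> the two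
sides differ by \<open>1 - r\<^sup>2\<close>. Hence only \<open>b 0\<close> and the values next to both ends survive.\<close>

lemma H2_weight_telescope:
  fixes b :: "int \<Rightarrow> real"
  assumes r: "0 < r"
  shows "(\<Sum>n\<in>{- int N..int N}. ((r\<^sup>2 + 1) * b n - r\<^sup>2 * b (n - 1) - b (n + 1)) / H2_weight r n)
     = (1 - r\<^sup>2) * b 0 - b (int N + 1) + r\<^sup>2 * b (int N) - r ^ (2 * (N + 1)) * b (- int N - 1) + r\<^sup>2 * r ^ (2 * N) * b (- int N)"
proof (induction N)
  case 0
  show ?case by (simp add: H2_weight_def algebra_simps power2_eq_square)
next
  case (Suc N)
  define f where "f n = ((r\<^sup>2 + 1) * b n - r\<^sup>2 * b (n - 1) - b (n + 1)) / H2_weight r n" for n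
  define X where "X = r ^ (2 * N)"
  have set: "{- int (Suc N)..int (Suc N)} = insert (int N + 1) (insert (- int N - 1) {- int N..int N})" by auto
  have "sum f {- int (Suc N)..int (Suc N)} = f (int N + 1) + (f (- int N - 1) + sum f {- int N..int N})"
    unfolding set by (subst sum.insert; simp)
  moreover have "f (int N + 1) = (r\<^sup>2 + 1) * b (int N + 1) - r\<^sup>2 * b (int N) - b (int N + 2)"
    by (simp add: f_def H2_weight_def add.commute)
  moreover have "f (- int N - 1) = ((r\<^sup>2 + 1) * b (- int N - 1) - r\<^sup>2 * b (- int N - 2) - b (- int N)) * (r\<^sup>2 * X)"
  proof -
    have "2 * (- int N - 1) = - int (2 * Suc N)" by simp
    then have "r powi (2 * (- int N - 1)) = inverse (r ^ (2 * Suc N))" by (simp only: power_int_minus power_int_of_nat)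
    also have "r ^ (2 * Suc N) = r\<^sup>2 * X" by (simp add: X_def power2_eq_square)
    finally have "H2_weight r (- int N - 1) = inverse (r\<^sup>2 * X)" by (simp add: H2_weight_def)
    moreover have "- int N - 1 - 1 = - int N - 2" "- int N - 1 + 1 = - int N" by simp_all
    ultimately show ?thesis unfolding f_def divide_inverse by (simp only:) simp
  qed
  moreover have "sum f {- int N..int N} = (1 - r\<^sup>2) * b 0 - b (int N + 1) + r\<^sup>2 * b (int N) - (r\<^sup>2 * X) * b (- int N - 1) + r\<^sup>2 * X * b (- int N)"
    using Suc.IH unfolding f_def X_def by (simp add: power2_eq_square)
  moreover have "r ^ (2 * (Suc N + 1)) = r\<^sup>2 * (r\<^sup>2 * X)" "r ^ (2 * Suc N) = r\<^sup>2 * X"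
    by (simp_all add: X_def power2_eq_square)
  moreover have "int (Suc N) + 1 = int N + 2" "int (Suc N) = int N + 1" "- int (Suc N) - 1 = - int N - 2" "- int (Suc N) = - int N - 1"
    by simp_all
  ultimately show ?case unfolding f_def[symmetric] by (simp only:) (simp add: algebra_simps)
qed

context class_F_operator
begin

lemma op_powi_bounded: "op_powi T n \<in> bounded_ops"
  unfolding op_powi_def using power_id_op_bounded[OF T_bounded] power_id_op_bounded[OF Ti_bounded] by simp

context
  fixes \<phi> assumes \<phi>: "\<phi> holomorphic_on annulus r"
begin

lemma coefficient_bound:
  obtains \<beta> where "\<beta> summable_on UNIV" "\<And>n. 0 \<le> \<beta> n"
    "\<And>n x y. x \<in> H \<Longrightarrow> y \<in> H \<Longrightarrow> cmod (laurent_coeff r \<phi> n * ip (zpow T Ti n x) y) \<le> \<beta> n * (hnorm x * hnorm y)"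
proof -
  obtain K t u where K: "0 \<le> K" and t: "r < t" "t < 1" and u: "r < u" "u < 1"
    and b: "\<And>n x. x \<in> H \<Longrightarrow> hnorm (zpow S Si n x) \<le> K * (t powi n + u powi n) * hnorm x"
    by (rule zpow_S_bound) blast
  define \<beta> where "\<beta> n = cmod (laurent_coeff r \<phi> n) * (K * (t powi n + u powi n))" for n
  have s: "(\<lambda>n. cmod (laurent_coeff r \<phi> n) * t powi n) summable_on UNIV" if "r < t" "t < 1" for t
    by (rule laurent_abs_summable) (use laurent_coeff_has_sum[OF \<phi> r] that r in \<open>auto simp: annulus_def intro: has_sum_imp_summable\<close>)
  have "(\<lambda>n. K * (cmod (laurent_coeff r \<phi> n) * t powi n + cmod (laurent_coeff r \<phi> n) * u powi n)) summable_on UNIV"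
    using s[OF t] s[OF u] by (intro summable_on_cmult_right summable_on_add)
  then have 1: "\<beta> summable_on UNIV" unfolding \<beta>_def by (simp add: algebra_simps)
  have 2: "0 \<le> \<beta> n" for n unfolding \<beta>_def using K t u r by simp
  have 3: "cmod (laurent_coeff r \<phi> n * ip (zpow T Ti n x) y) \<le> \<beta> n * (hnorm x * hnorm y)" if x: "x \<in> H" and y: "y \<in> H" for n x y
  proof -
    have "cmod (ip (zpow T Ti n x) y) \<le> hnorm x * hnorm (zpow S Si n y)"
      unfolding zpow_adjoint[OF x y] by (rule cauchy_schwarz[OF x S.zpow_H[OF y]])
    also have "\<dots> \<le> hnorm x * (K * (t powi n + u powi n) * hnorm y)" using b[OF y] x by (intro mult_left_mono) auto
    finally have "cmod (laurent_coeff r \<phi> n) * cmod (ip (zpow T Ti n x) y) \<le> cmod (laurent_coeff r \<phi> n) * (hnorm x * (K * (t powi n + u powi n) * hnorm y))"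
      by (intro mult_left_mono) auto
    then show ?thesis unfolding \<beta>_def norm_mult by (simp add: mult_ac)
  qed
  show ?thesis by (rule that[OF 1 2 3])
qed

text \<open>The form \<open>\<Sum> a\<^sub>n \<langle>T\<^sup>n x, y\<rangle>\<close> converges absolutely and defines an operator. The tails of the dominating
series \<open>\<beta>\<close> estimate the distance of the partial sums from it, which identifies it as the limit in the
operator norm.\<close>

lemma fun_calc_exists:
  obtains \<beta> where "fun_calc r \<phi> T \<in> bounded_ops"
    "\<And>x y. x \<in> H \<Longrightarrow> y \<in> H \<Longrightarrow> ((\<lambda>n. laurent_coeff r \<phi> n * ip (zpow T Ti n x) y) has_sum ip (fun_calc r \<phi> T x) y) UNIV"
    "\<beta> summable_on UNIV"
    "\<And>F x. finite F \<Longrightarrow> x \<in> H \<Longrightarrow>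
       hnorm ((\<Sum>n\<in>F. smul (cnj (laurent_coeff r \<phi> n)) (zpow S Si n x)) - adjoint_op (fun_calc r \<phi> T) x) \<le> (infsum \<beta> UNIV - sum \<beta> F) * hnorm x"
proof -
  obtain \<beta> where \<beta>: "\<beta> summable_on UNIV" "\<And>n. 0 \<le> \<beta> n"
    and le: "\<And>n x y. x \<in> H \<Longrightarrow> y \<in> H \<Longrightarrow> cmod (laurent_coeff r \<phi> n * ip (zpow T Ti n x) y) \<le> \<beta> n * (hnorm x * hnorm y)"
    by (rule coefficient_bound) blast
  define B where "B x y = (\<Sum>\<^sub>\<infinity>n. laurent_coeff r \<phi> n * ip (zpow T Ti n x) y)" for x y
  have B: "((\<lambda>n. laurent_coeff r \<phi> n * ip (zpow T Ti n x) y) has_sum B x y) UNIV" if "x \<in> H" "y \<in> H" for x y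
  proof -
    have "(\<lambda>n. \<beta> n * (hnorm x * hnorm y)) summable_on UNIV" using \<beta>(1) by (rule summable_on_cmult_left)
    then have "(\<lambda>n. cmod (laurent_coeff r \<phi> n * ip (zpow T Ti n x) y)) summable_on UNIV"
      by (rule summable_on_comparison_test) (use le[OF that] in auto)
    then have "(\<lambda>n. laurent_coeff r \<phi> n * ip (zpow T Ti n x) y) summable_on UNIV" by (rule abs_summable_summable)
    then show ?thesis unfolding B_def by (rule has_sum_infsum)
  qed
  have BI: "B x y = s" if "((\<lambda>n. laurent_coeff r \<phi> n * ip (zpow T Ti n x) y) has_sum s) UNIV" for x y s
    unfolding B_def using that by (rule infsumI)
  define E where "E F = infsum \<beta> UNIV - sum \<beta> F" for F
  have E0: "0 \<le> E F" if "finite F" for F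
    unfolding E_def using finite_sum_le_infsum[OF \<beta>(1) that] \<beta>(2) by simp
  have tail: "cmod (B x y - (\<Sum>n\<in>F. laurent_coeff r \<phi> n * ip (zpow T Ti n x) y)) \<le> E F * (hnorm x * hnorm y)"
    if "x \<in> H" "y \<in> H" "finite F" for x y F
    unfolding E_def by (rule has_sum_tail_bound[OF B[OF that(1,2)] \<beta>(1) that(3) le[OF that(1,2)]])
  have "\<exists>P\<in>bounded_ops. \<forall>x\<in>H. \<forall>y\<in>H. ip (P x) y = B x y"
  proof (rule operator_of_bounded_form)
    fix x y z :: 'v and c :: complex assume H: "x \<in> H" "z \<in> H"
    have zH: "zpow T Ti n z \<in> H" "zpow S Si n z \<in> H" for n using H T.zpow_H S.zpow_H by auto
    show "B (smul c x) z = c * B x z"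
      by (rule BI) (use has_sum_cmult_right[OF B[OF H], of c] H zH in \<open>simp add: zpow_adjoint s_smul mult.left_commute\<close>)
    show "B z (smul c x) = cnj c * B z x"
      by (rule BI) (use has_sum_cmult_right[OF B[OF H(2,1)], of "cnj c"] H zH in \<open>simp add: s_smul_right mult.left_commute\<close>)
    show "cmod (B x z) \<le> infsum \<beta> UNIV * hnorm x * hnorm z"
      using tail[OF H, of "{}"] by (simp add: E_def mult.assoc)
    assume y: "y \<in> H"
    show "B (x + y) z = B x z + B y z"
      by (rule BI) (use has_sum_add[OF B[OF H] B[OF y H(2)]] H y zH in \<open>simp add: zpow_adjoint s_add distrib_left\<close>)
    show "B z (x + y) = B z x + B z y"
      by (rule BI) (use has_sum_add[OF B[OF H(2,1)] B[OF H(2) y]] H y zH in \<open>simp add: s_add_right distrib_left\<close>)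
  next
    show "0 \<le> infsum \<beta> UNIV" using E0[of "{}"] by (simp add: E_def)
  qed
  then obtain P where P: "P \<in> bounded_ops" "\<And>x y. x \<in> H \<Longrightarrow> y \<in> H \<Longrightarrow> ip (P x) y = B x y" by blast
  define A where "A F x = (\<Sum>n\<in>F. smul (laurent_coeff r \<phi> n) (op_powi T n x))" for F x
  have A: "A F \<in> bounded_ops" for F unfolding A_def by (rule sum_bounded) (rule op_powi_bounded)
  have ipA: "ip (A F x) y = (\<Sum>n\<in>F. laurent_coeff r \<phi> n * ip (zpow T Ti n x) y)" if "x \<in> H" "y \<in> H" for F x y
    using that by (simp add: A_def op_powi_zpow s_sum s_smul T.zpow_H)
  have AP: "(\<lambda>x. A F x - P x) \<in> bounded_ops" for F using minus_scaled_bounded[OF A P(1), of F 1] by simp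
  have "op_norm (\<lambda>x. A F x - P x) \<le> E F" if F: "finite F" for F
  proof (rule op_norm_least[OF E0[OF F]])
    fix x assume x: "x \<in> H"
    show "hnorm (A F x - P x) \<le> E F * hnorm x"
    proof (rule hnorm_leI)
      fix y assume y: "y \<in> H"
      have "cmod (ip (A F x - P x) y) = cmod (B x y - (\<Sum>n\<in>F. laurent_coeff r \<phi> n * ip (zpow T Ti n x) y))"
        using x y by (simp add: s_diff op_H[OF A] op_H[OF P(1)] ipA P(2) norm_minus_commute)
      then show "cmod (ip (A F x - P x) y) \<le> E F * hnorm x * hnorm y" using tail[OF x y F] by (simp add: mult.assoc)
    qed (use x E0[OF F] op_H[OF AP x] in simp_all)
  qed
  then have "\<forall>\<^sub>F F in finite_subsets_at_top UNIV. op_norm (\<lambda>x. A F x - P x) \<le> E F"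
    by (intro eventually_finite_subsets_at_top_weakI)
  then have lim: "((\<lambda>F. op_norm (\<lambda>x. A F x - P x)) \<longlongrightarrow> 0) (finite_subsets_at_top UNIV)"
    by (rule tendsto_sandwich[OF always_eventually[OF allI[OF op_norm_nonneg[OF AP]]] _ tendsto_const])
       (unfold E_def, rule infsum_minus_partial_tendsto[OF \<beta>(1)])
  have fc: "fun_calc r \<phi> T = P"
    unfolding fun_calc_def A_def[symmetric]
  proof (rule the_equality)
    show "P \<in> bounded_ops \<and> ((\<lambda>F. op_norm (\<lambda>x. A F x - P x)) \<longlongrightarrow> 0) (finite_subsets_at_top UNIV)" using P lim by simp
    fix P' assume P': "P' \<in> bounded_ops \<and> ((\<lambda>F. op_norm (\<lambda>x. A F x - P' x)) \<longlongrightarrow> 0) (finite_subsets_at_top UNIV)"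
    show "P' = P"
      by (rule op_norm_limit_unique[OF A _ P(1) finite_subsets_at_top_neq_bot[of UNIV] _ lim]) (use P' in auto)
  qed
  have adj: "hnorm ((\<Sum>n\<in>F. smul (cnj (laurent_coeff r \<phi> n)) (zpow S Si n x)) - adjoint_op P x) \<le> E F * hnorm x" if F: "finite F" and x: "x \<in> H" for F x
  proof (rule hnorm_leI)
    define z where "z = (\<Sum>n\<in>F. smul (cnj (laurent_coeff r \<phi> n)) (zpow S Si n x))"
    have zH: "z \<in> H" using x by (simp add: z_def S.zpow_H)
    have aH: "adjoint_op P x \<in> H" by (rule op_H[OF adjoint_op_bounded[OF P(1)] x])
    fix y assume y: "y \<in> H"
    have "ip y z = (\<Sum>n\<in>F. laurent_coeff r \<phi> n * ip (zpow T Ti n y) x)"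
      using x y by (simp add: z_def s_sum_right s_smul_right S.zpow_H zpow_adjoint)
    moreover have "ip y (adjoint_op P x) = B y x" using adjoint_op_ip[OF P(1) y x] P(2)[OF y x] by simp
    ultimately have "cmod (ip y (z - adjoint_op P x)) \<le> E F * (hnorm y * hnorm x)"
      using tail[OF y x F] zH aH y by (simp add: s_diff_right norm_minus_commute)
    moreover have "cmod (ip (z - adjoint_op P x) y) = cmod (ip y (z - adjoint_op P x))"
      using ip_cnj[of "z - adjoint_op P x" y] zH aH y by simp
    ultimately show "cmod (ip (z - adjoint_op P x) y) \<le> E F * hnorm x * hnorm y" by (simp add: mult_ac)
  qed (use x E0[OF F] op_H[OF adjoint_op_bounded[OF P(1)] x] S.zpow_H in simp_all)
  show ?thesis
  proof (rule that[of \<beta>])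
    show "fun_calc r \<phi> T \<in> bounded_ops" unfolding fc by (rule P(1))
    show "\<beta> summable_on UNIV" by (rule \<beta>(1))
    show "((\<lambda>n. laurent_coeff r \<phi> n * ip (zpow T Ti n x) y) has_sum ip (fun_calc r \<phi> T x) y) UNIV" if "x \<in> H" "y \<in> H" for x y
      unfolding fc P(2)[OF that] by (rule B[OF that])
    show "hnorm ((\<Sum>n\<in>F. smul (cnj (laurent_coeff r \<phi> n)) (zpow S Si n x)) - adjoint_op (fun_calc r \<phi> T) x) \<le> (infsum \<beta> UNIV - sum \<beta> F) * hnorm x"
      if "finite F" "x \<in> H" for F x
      unfolding fc using adj[OF that] by (simp add: E_def)
  qed
qed

lemma fun_calc_bounded: "fun_calc r \<phi> T \<in> bounded_ops"
  by (rule fun_calc_exists) assumption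

end

definition defect :: "'v \<Rightarrow> 'v \<Rightarrow> complex" where
  "defect x y = of_real (r\<^sup>2 + 1) * ip x y - of_real (r\<^sup>2) * ip (Si x) (Si y) - ip (S x) (S y)"

lemma defect_self: "x \<in> H \<Longrightarrow> Re (defect x x) = (r\<^sup>2 + 1) * (hnorm x)\<^sup>2 - r\<^sup>2 * (hnorm (Si x))\<^sup>2 - (hnorm (S x))\<^sup>2"
  by (simp add: defect_def ip_self ops_H)

sublocale D: semi_inner_space smul H defect
proof
  show "subspace H" by (rule subspace_H)
  fix x y z :: 'v and c :: complex
  show "x \<in> H \<Longrightarrow> y \<in> H \<Longrightarrow> z \<in> H \<Longrightarrow> defect (x + y) z = defect x z + defect y z"
    by (simp add: defect_def s_add op_add[OF S_bounded] op_add[OF Si_bounded] ops_H algebra_simps)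
  show "x \<in> H \<Longrightarrow> y \<in> H \<Longrightarrow> defect (smul c x) y = c * defect x y"
    by (simp add: defect_def s_smul op_smul[OF S_bounded] op_smul[OF Si_bounded] ops_H algebra_simps)
  show "x \<in> H \<Longrightarrow> y \<in> H \<Longrightarrow> defect y x = cnj (defect x y)"
    by (simp add: defect_def ops_H ip_cnj[of y x] ip_cnj[of "S y" "S x"] ip_cnj[of "Si y" "Si x"])
  show "x \<in> H \<Longrightarrow> 0 \<le> Re (defect x x)"
    using defect_nonneg[of x] by (simp add: defect_self)
qed

text \<open>The exponential decay of the powers removes the boundary terms of the telescoping sum.\<close>

lemma defect_sum_limit:
  assumes x: "x \<in> H"
  shows "(\<lambda>N. \<Sum>n\<in>{- int N..int N}. Re (defect (zpow S Si n x) (zpow S Si n x)) / H2_weight r n) \<longlonglongrightarrow> (1 - r\<^sup>2) * (hnorm x)\<^sup>2"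
proof -
  define b where "b n = (hnorm (zpow S Si n x))\<^sup>2" for n
  have d: "Re (defect (zpow S Si n x) (zpow S Si n x)) = (r\<^sup>2 + 1) * b n - r\<^sup>2 * b (n - 1) - b (n + 1)" for n
    using x by (simp add: defect_self S.zpow_H S.zpow_Suc S.zpow_pred b_def)
  obtain K \<rho> where K: "0 \<le> K" and \<rho>: "r < \<rho>" "\<rho> < 1"
    and dec: "\<And>n x. x \<in> H \<Longrightarrow> hnorm ((S ^^ n) x) \<le> K * \<rho> ^ n * hnorm x"
    "\<And>n x. x \<in> H \<Longrightarrow> r ^ n * hnorm ((Si ^^ n) x) \<le> K * \<rho> ^ n * hnorm x"
    by (rule powers_decay) blast
  have "(\<lambda>N. K * \<rho> ^ N * hnorm x) \<longlonglongrightarrow> K * 0 * hnorm x"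
    using \<rho> r by (intro tendsto_intros LIMSEQ_power_zero) auto
  from tendsto_power[OF this, of 2] have l: "(\<lambda>N. (K * \<rho> ^ N * hnorm x)\<^sup>2) \<longlonglongrightarrow> 0" by simp
  have up: "(\<lambda>N. b (int N)) \<longlonglongrightarrow> 0"
    by (rule tendsto_sandwich[OF _ _ tendsto_const l])
       (use dec(1)[OF x] x in \<open>auto simp: b_def zpow_def S.funpow_closed intro!: always_eventually power_mono\<close>)
  have down: "(\<lambda>N. r ^ (2 * N) * b (- int N)) \<longlonglongrightarrow> 0"
  proof (rule tendsto_sandwich[OF _ _ tendsto_const l])
    have "r ^ (2 * N) * b (- int N) = (r ^ N * hnorm ((Si ^^ N) x))\<^sup>2" for N
    proof -
      have "zpow S Si (- int N) x = (Si ^^ N) x" by (cases "N = 0") (auto simp: zpow_def)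
      then show ?thesis by (simp add: b_def power_mult_distrib mult.commute[of 2] flip: power_mult)
    qed
    moreover have "(r ^ N * hnorm ((Si ^^ N) x))\<^sup>2 \<le> (K * \<rho> ^ N * hnorm x)\<^sup>2" for N
      using dec(2)[OF x] r x by (intro power_mono mult_nonneg_nonneg) (auto simp: S.funpow_closed)
    ultimately show "\<forall>\<^sub>F N in sequentially. r ^ (2 * N) * b (- int N) \<le> (K * \<rho> ^ N * hnorm x)\<^sup>2" by simp
  qed (auto simp: b_def)
  have up': "(\<lambda>N. b (int N + 1)) \<longlonglongrightarrow> 0" using LIMSEQ_Suc[OF up] by (simp add: add.commute)
  have down': "(\<lambda>N. r ^ (2 * (N + 1)) * b (- int N - 1)) \<longlonglongrightarrow> 0"
  proof -
    have "- int (Suc N) = - int N - 1" for N by simp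
    then show ?thesis using LIMSEQ_Suc[OF down] by (simp only: Suc_eq_plus1)
  qed
  have "(\<lambda>N. (1 - r\<^sup>2) * b 0 - b (int N + 1) + r\<^sup>2 * b (int N) - r ^ (2 * (N + 1)) * b (- int N - 1) + r\<^sup>2 * (r ^ (2 * N) * b (- int N)))
     \<longlonglongrightarrow> (1 - r\<^sup>2) * b 0 - 0 + r\<^sup>2 * 0 - 0 + r\<^sup>2 * 0"
    by (intro tendsto_intros up up' down down')
  then show ?thesis unfolding d H2_weight_telescope[OF r(1)] by (simp add: b_def mult.assoc)
qed

text \<open>The vectors \<open>z n\<close> arise from the \<open>u j\<close> by the adjoint of multiplication by \<open>\<phi>\<close>. In the coordinates of a
Gram factorization the claim is a sum of scalar instances of \<open>multiplier_adjoint_bound\<close>.\<close>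

lemma defect_combination_bound:
  assumes \<phi>: "\<phi> \<in> H_infty r" and F: "finite F" and J: "finite J" and u: "\<And>j. j \<in> J \<Longrightarrow> u j \<in> H"
    and z: "\<And>n. z n = (\<Sum>j\<in>J. smul (cnj (laurent_coeff r \<phi> (j - n))) (u j))"
  shows "(\<Sum>n\<in>F. Re (defect (z n) (z n)) / H2_weight r n) \<le> (Mult_norm r \<phi>)\<^sup>2 * (\<Sum>j\<in>J. Re (defect (u j) (u j)) / H2_weight r j)"
proof -
  obtain d :: nat and c where c: "\<And>i j. i \<in> J \<Longrightarrow> j \<in> J \<Longrightarrow> defect (u i) (u j) = (\<Sum>l<d. c i l * cnj (c j l))"
    using D.gram_factorization[of J u, OF J u] by blast
  define g where "g n l = (\<Sum>j\<in>J. cnj (laurent_coeff r \<phi> (j - n)) * c j l)" for n l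
  have zz: "Re (defect (z n) (z n)) = (\<Sum>l<d. (cmod (g n l))\<^sup>2)" for n
  proof -
    let ?\<alpha> = "\<lambda>j. cnj (laurent_coeff r \<phi> (j - n))"
    have "defect (z n) (z n) = (\<Sum>i\<in>J. \<Sum>j\<in>J. ?\<alpha> i * (cnj (?\<alpha> j) * defect (u i) (u j)))"
      unfolding z using u by (simp add: D.s_sum D.s_sum_right D.s_smul D.s_smul_right sum_distrib_left mult.left_commute)
         (rule sum.swap)
    also have "\<dots> = (\<Sum>i\<in>J. \<Sum>j\<in>J. \<Sum>l<d. (?\<alpha> i * c i l) * cnj (?\<alpha> j * c j l))"
      using c by (simp add: sum_distrib_left mult_ac)
    also have "\<dots> = (\<Sum>l<d. \<Sum>i\<in>J. \<Sum>j\<in>J. (?\<alpha> i * c i l) * cnj (?\<alpha> j * c j l))"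
      by (subst sum.swap[of _ "{..<d}"]) (intro sum.cong refl sum.swap)
    also have "\<dots> = (\<Sum>l<d. g n l * cnj (g n l))"
      unfolding g_def cnj_sum by (simp add: sum_product)
    also have "\<dots> = of_real (\<Sum>l<d. (cmod (g n l))\<^sup>2)" by (simp only: complex_norm_square[symmetric] of_real_sum)
    finally show ?thesis by simp
  qed
  have uu: "Re (defect (u j) (u j)) = (\<Sum>l<d. (cmod (c j l))\<^sup>2)" if "j \<in> J" for j
    unfolding c[OF that that] by (simp add: complex_norm_square[symmetric] flip: of_real_sum of_real_power)
  have "(\<Sum>n\<in>F. Re (defect (z n) (z n)) / H2_weight r n) = (\<Sum>l<d. \<Sum>n\<in>F. (cmod (g n l))\<^sup>2 / H2_weight r n)"
    unfolding zz sum_divide_distrib by (rule sum.swap)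
  also have "\<dots> \<le> (\<Sum>l<d. (Mult_norm r \<phi>)\<^sup>2 * (\<Sum>j\<in>J. (cmod (c j l))\<^sup>2 / H2_weight r j))"
    unfolding g_def by (intro sum_mono multiplier_adjoint_bound r \<phi> F J)
  also have "\<dots> = (Mult_norm r \<phi>)\<^sup>2 * (\<Sum>j\<in>J. \<Sum>l<d. (cmod (c j l))\<^sup>2 / H2_weight r j)"
    by (subst sum.swap) (simp add: sum_distrib_left)
  also have "\<dots> = (Mult_norm r \<phi>)\<^sup>2 * (\<Sum>j\<in>J. Re (defect (u j) (u j)) / H2_weight r j)"
    by (simp add: uu sum_divide_distrib)
  finally show ?thesis .
qed

lemma symmetric_interval_exhausts:
  "filterlim (\<lambda>K. {- int K - n..int K - n}) (finite_subsets_at_top UNIV) sequentially"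
  unfolding filterlim_finite_subsets_at_top
proof (intro allI impI)
  fix X :: "int set" assume X: "finite X \<and> X \<subseteq> UNIV"
  define M where "M = (\<Sum>x\<in>X. nat \<bar>x\<bar>) + nat \<bar>n\<bar>"
  have "X \<subseteq> {- int K - n..int K - n}" if K: "M \<le> K" for K
  proof
    fix x assume "x \<in> X"
    then have "nat \<bar>x\<bar> \<le> (\<Sum>x\<in>X. nat \<bar>x\<bar>)" using X by (intro member_le_sum) auto
    then have "nat \<bar>x\<bar> + nat \<bar>n\<bar> \<le> K" using K by (simp add: M_def)
    then show "x \<in> {- int K - n..int K - n}" by auto
  qed
  then show "\<forall>\<^sub>F K in sequentially. finite {- int K - n..int K - n} \<and> X \<subseteq> {- int K - n..int K - n} \<and> {- int K - n..int K - n} \<subseteq> UNIV"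
    unfolding eventually_sequentially by blast
qed

lemma zpow_S_linear:
  assumes f: "\<And>i. i \<in> F \<Longrightarrow> f i \<in> H"
  shows "zpow S Si n (\<Sum>i\<in>F. smul (c i) (f i)) = (\<Sum>i\<in>F. smul (c i) (zpow S Si n (f i)))"
proof (rule ip_eqI)
  fix z assume z: "z \<in> H"
  have sym: "ip (zpow S Si n y) z = ip y (zpow T Ti n z)" if "y \<in> H" for y
    using zpow_adjoint[OF z that] ip_cnj[OF z S.zpow_H[OF that]] ip_cnj[OF T.zpow_H[OF z] that] by metis
  show "ip (zpow S Si n (\<Sum>i\<in>F. smul (c i) (f i))) z = ip (\<Sum>i\<in>F. smul (c i) (zpow S Si n (f i))) z"
    using f z by (simp add: sym s_sum s_smul S.zpow_H T.zpow_H)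
qed (use f in \<open>simp_all add: S.zpow_H\<close>)

text \<open>With \<open>y\<close> the image of \<open>x\<close> under the adjoint of \<open>\<phi>(T)\<close>, the sequence \<open>S\<^sup>n y\<close> is the image of \<open>S\<^sup>n x\<close> under
the adjoint of multiplication by \<open>\<phi>\<close>. Both sequences have squared norm \<open>(1 - r\<^sup>2)\<close> times that of \<open>y\<close> and
of \<open>x\<close>. Finite sections of the sequences make the bound on combinations applicable.\<close>

theorem fun_calc_norm_upper:
  assumes \<phi>: "\<phi> \<in> H_infty r"
  shows "op_norm (fun_calc r \<phi> T) \<le> Mult_norm r \<phi>"
proof -
  define M where "M = Mult_norm r \<phi>"
  have hol: "\<phi> holomorphic_on annulus r" using \<phi> by (simp add: H_infty_def)
  have M0: "0 \<le> M" unfolding M_def by (rule Mult_norm_nonneg[OF r \<phi>])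
  have r2: "0 < 1 - r\<^sup>2" using r by (simp add: power_less_one_iff)
  obtain \<beta> where P: "fun_calc r \<phi> T \<in> bounded_ops" and \<beta>: "\<beta> summable_on UNIV"
    and lim: "\<And>F x. finite F \<Longrightarrow> x \<in> H \<Longrightarrow>
       hnorm ((\<Sum>n\<in>F. smul (cnj (laurent_coeff r \<phi> n)) (zpow S Si n x)) - adjoint_op (fun_calc r \<phi> T) x) \<le> (infsum \<beta> UNIV - sum \<beta> F) * hnorm x"
    by (rule fun_calc_exists[OF hol]) (rule that)
  show ?thesis unfolding M_def[symmetric]
  proof (rule op_norm_le_adjoint[OF P M0])
    fix x assume x: "x \<in> H"
    define y where "y = adjoint_op (fun_calc r \<phi> T) x"
    have yH: "y \<in> H" unfolding y_def by (rule op_H[OF adjoint_op_bounded[OF P] x])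
    define u where "u n = zpow S Si n x" for n
    have uH: "u n \<in> H" for n unfolding u_def by (rule S.zpow_H[OF x])
    define v where "v n = zpow S Si n y" for n
    have vH: "v n \<in> H" for n unfolding v_def by (rule S.zpow_H[OF yH])
    \<comment> \<open>Partial sums of the series for \<open>v n\<close>, over a window that does not move with \<open>n\<close>: only finitely
        many vectors \<open>u j\<close> occur for all \<open>n\<close> at once.\<close>
    define z where "z K n = (\<Sum>j\<in>{- int K..int K}. smul (cnj (laurent_coeff r \<phi> (j - n))) (u j))" for K n
    have zH: "z K n \<in> H" for K n unfolding z_def using uH by simp
    have zv: "(\<lambda>K. hnorm (z K n - v n)) \<longlonglongrightarrow> 0" for n
    proof -
      define p where "p K = (\<Sum>m\<in>{- int K - n..int K - n}. smul (cnj (laurent_coeff r \<phi> m)) (zpow S Si m x))" for K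
      have pH: "p K \<in> H" for K unfolding p_def using x by (simp add: S.zpow_H)
      have zp: "z K n = zpow S Si n (p K)" for K
      proof -
        have "zpow S Si n (p K) = (\<Sum>m\<in>{- int K - n..int K - n}. smul (cnj (laurent_coeff r \<phi> m)) (u (n + m)))"
          unfolding p_def u_def using x by (simp add: zpow_S_linear S.zpow_H S.zpow_add)
        also have "\<dots> = z K n" unfolding z_def
          by (rule sum.reindex_bij_witness[of _ "\<lambda>j. j - n" "\<lambda>m. n + m"]) auto
        finally show ?thesis by simp
      qed
      have e: "(\<lambda>K. (infsum \<beta> UNIV - sum \<beta> {- int K - n..int K - n}) * hnorm x) \<longlonglongrightarrow> 0 * hnorm x"
        by (intro tendsto_mult tendsto_const filterlim_compose[OF infsum_minus_partial_tendsto[OF \<beta>] symmetric_interval_exhausts])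
      have py: "(\<lambda>K. hnorm (p K - y)) \<longlonglongrightarrow> 0"
      proof (rule tendsto_sandwich[OF _ _ tendsto_const])
        show "(\<lambda>K. (infsum \<beta> UNIV - sum \<beta> {- int K - n..int K - n}) * hnorm x) \<longlonglongrightarrow> 0" using e by simp
        show "\<forall>\<^sub>F K in sequentially. hnorm (p K - y) \<le> (infsum \<beta> UNIV - sum \<beta> {- int K - n..int K - n}) * hnorm x"
          unfolding p_def y_def using lim[OF _ x] by (intro always_eventually allI) simp
      qed (use pH yH in simp)
      define Z where "Z = (if 0 \<le> n then S ^^ nat n \<circ> id_op else Si ^^ nat (- n) \<circ> id_op)"
      have Z: "Z \<in> bounded_ops"
        unfolding Z_def
        by (cases "0 \<le> n") (simp_all only: if_True if_False power_id_op_bounded[OF S_bounded] power_id_op_bounded[OF Si_bounded])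
      have zp_op: "zpow S Si n w = Z w" if "w \<in> H" for w
        using that by (simp add: Z_def zpow_def id_op_def)
      show ?thesis
        using op_tendsto[OF Z pH yH py] unfolding v_def zp zp_op[OF yH] zp_op[OF pH] .
    qed
    have bound: "(\<Sum>n\<in>{- int N..int N}. Re (defect (v n) (v n)) / H2_weight r n) \<le> M\<^sup>2 * ((1 - r\<^sup>2) * (hnorm x)\<^sup>2)" for N
    proof -
      have zlim: "(\<lambda>K. Re (defect (z K n) (z K n))) \<longlonglongrightarrow> Re (defect (v n) (v n))" for n
        unfolding defect_self[OF zH] defect_self[OF vH]
        by (intro tendsto_intros hnorm_tendsto zH vH zv ops_H op_tendsto[OF S_bounded] op_tendsto[OF Si_bounded])
      have l1: "(\<lambda>K. \<Sum>n\<in>{- int N..int N}. Re (defect (z K n) (z K n)) / H2_weight r n) \<longlonglongrightarrow> (\<Sum>n\<in>{- int N..int N}. Re (defect (v n) (v n)) / H2_weight r n)"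
        using H2_weight_pos[OF r(1)] by (intro tendsto_sum tendsto_divide zlim tendsto_const) (metis less_irrefl)
      have ineq: "(\<Sum>n\<in>{- int N..int N}. Re (defect (z K n) (z K n)) / H2_weight r n) \<le> M\<^sup>2 * (\<Sum>j\<in>{- int K..int K}. Re (defect (u j) (u j)) / H2_weight r j)" for K
        unfolding M_def by (rule defect_combination_bound[OF \<phi>]) (use uH in \<open>auto simp: z_def\<close>)
      have l2: "(\<lambda>K. M\<^sup>2 * (\<Sum>j\<in>{- int K..int K}. Re (defect (u j) (u j)) / H2_weight r j)) \<longlonglongrightarrow> M\<^sup>2 * ((1 - r\<^sup>2) * (hnorm x)\<^sup>2)"
        unfolding u_def by (intro tendsto_mult tendsto_const defect_sum_limit[OF x])
      show ?thesis by (rule LIMSEQ_le[OF l1 l2]) (intro exI[of _ 0] allI impI ineq)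
    qed
    have "(1 - r\<^sup>2) * (hnorm y)\<^sup>2 \<le> M\<^sup>2 * ((1 - r\<^sup>2) * (hnorm x)\<^sup>2)"
      using defect_sum_limit[OF yH] bound unfolding v_def by (intro LIMSEQ_le_const2) auto
    then have "(1 - r\<^sup>2) * (hnorm y)\<^sup>2 \<le> (1 - r\<^sup>2) * (M * hnorm x)\<^sup>2" by (simp add: power_mult_distrib mult_ac)
    then have "(hnorm y)\<^sup>2 \<le> (M * hnorm x)\<^sup>2" using r2 by (simp only: mult_le_cancel_left_pos)
    then show "hnorm (adjoint_op (fun_calc r \<phi> T) x) \<le> M * hnorm x"
      unfolding y_def[symmetric] by (rule power2_le_imp_le) (use M0 x in simp)
  qed
qed

end


section \<open>Weighted square-summable sequences\<close>

text \<open>The sequences of Laurent coefficients of the functions in \<open>H2 r\<close>.\<close>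

definition l2 :: "real \<Rightarrow> (int \<Rightarrow> complex) set" where
  "l2 r = {g. (\<lambda>n. H2_weight r n * (cmod (g n))\<^sup>2) summable_on UNIV}"

definition l2_smul :: "complex \<Rightarrow> (int \<Rightarrow> complex) \<Rightarrow> int \<Rightarrow> complex" where
  "l2_smul c g = (\<lambda>n. c * g n)"

definition l2_ip :: "real \<Rightarrow> (int \<Rightarrow> complex) \<Rightarrow> (int \<Rightarrow> complex) \<Rightarrow> complex" where
  "l2_ip r f g = (\<Sum>\<^sub>\<infinity>n. of_real (H2_weight r n) * f n * cnj (g n))"

abbreviation l2_norm :: "real \<Rightarrow> (int \<Rightarrow> complex) \<Rightarrow> real" where
  "l2_norm r \<equiv> complex_inner_space.hnorm (l2_ip r)"

lemma vector_space_l2_smul: "vector_space l2_smul"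
  by unfold_locales (simp_all add: l2_smul_def fun_eq_iff algebra_simps)

context
  fixes r :: real assumes r: "0 < r"
begin

lemma weight_pos: "0 < H2_weight r n" using r by (rule H2_weight_pos)
lemma weight_nonneg: "0 \<le> H2_weight r n" using weight_pos less_imp_le by blast

lemma l2_add: assumes "f \<in> l2 r" "g \<in> l2 r" shows "f + g \<in> l2 r"
proof -
  have "(\<lambda>n. 2 * (H2_weight r n * (cmod (f n))\<^sup>2) + 2 * (H2_weight r n * (cmod (g n))\<^sup>2)) summable_on UNIV"
    using assms unfolding l2_def by (intro summable_on_add summable_on_cmult_right) auto
  then have "(\<lambda>n. H2_weight r n * (cmod (f n + g n))\<^sup>2) summable_on UNIV"
  proof (rule summable_on_comparison_test)
    fix n
    have "(cmod (f n + g n))\<^sup>2 \<le> (cmod (f n) + cmod (g n))\<^sup>2" by (intro power_mono norm_triangle_ineq) auto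
    also have "\<dots> \<le> 2 * (cmod (f n))\<^sup>2 + 2 * (cmod (g n))\<^sup>2"
      using zero_le_power2[of "cmod (f n) - cmod (g n)"] by (simp add: power2_sum power2_diff)
    finally have "H2_weight r n * (cmod (f n + g n))\<^sup>2 \<le> H2_weight r n * (2 * (cmod (f n))\<^sup>2 + 2 * (cmod (g n))\<^sup>2)"
      using weight_nonneg by (intro mult_left_mono)
    then show "H2_weight r n * (cmod (f n + g n))\<^sup>2 \<le> 2 * (H2_weight r n * (cmod (f n))\<^sup>2) + 2 * (H2_weight r n * (cmod (g n))\<^sup>2)"
      by (simp add: algebra_simps)
  qed (simp_all add: weight_nonneg)
  then show ?thesis by (simp add: l2_def)
qed

lemma l2_scale: "f \<in> l2 r \<Longrightarrow> l2_smul c f \<in> l2 r"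
  using summable_on_cmult_right[of "\<lambda>n. H2_weight r n * (cmod (f n))\<^sup>2" UNIV "(cmod c)\<^sup>2"]
  by (simp add: l2_def l2_smul_def norm_mult power_mult_distrib mult.left_commute)

lemma l2_ip_has_sum:
  assumes "f \<in> l2 r" "g \<in> l2 r"
  shows "((\<lambda>n. of_real (H2_weight r n) * f n * cnj (g n)) has_sum l2_ip r f g) UNIV"
proof -
  have "(\<lambda>n. H2_weight r n * (cmod (f n))\<^sup>2 + H2_weight r n * (cmod (g n))\<^sup>2) summable_on UNIV"
    using assms unfolding l2_def by (intro summable_on_add) auto
  then have "(\<lambda>n. cmod (of_real (H2_weight r n) * f n * cnj (g n))) summable_on UNIV"
  proof (rule summable_on_comparison_test)
    fix n
    have "cmod (f n) * cmod (g n) \<le> (cmod (f n))\<^sup>2 + (cmod (g n))\<^sup>2"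
    proof -
      have "0 \<le> cmod (f n) * cmod (g n)" by simp
      then show ?thesis using zero_le_power2[of "cmod (f n) - cmod (g n)"] unfolding power2_diff by linarith
    qed
    from mult_left_mono[OF this less_imp_le[OF weight_pos[of n]]]
    show "cmod (of_real (H2_weight r n) * f n * cnj (g n)) \<le> H2_weight r n * (cmod (f n))\<^sup>2 + H2_weight r n * (cmod (g n))\<^sup>2"
      using weight_pos[of n] by (simp add: norm_mult distrib_left mult.assoc)
  qed auto
  then have "(\<lambda>n. of_real (H2_weight r n) * f n * cnj (g n)) summable_on UNIV" by (rule abs_summable_summable)
  then show ?thesis unfolding l2_ip_def by (rule has_sum_infsum)
qed

lemma l2_ip_eqI: "((\<lambda>n. of_real (H2_weight r n) * f n * cnj (g n)) has_sum s) UNIV \<Longrightarrow> l2_ip r f g = s"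
  unfolding l2_ip_def by (rule infsumI)

lemma l2_ip_self:
  assumes f: "f \<in> l2 r"
  shows "((\<lambda>n. H2_weight r n * (cmod (f n))\<^sup>2) has_sum Re (l2_ip r f f)) UNIV" "Im (l2_ip r f f) = 0"
proof -
  have eq: "of_real (H2_weight r n) * f n * cnj (f n) = of_real (H2_weight r n * (cmod (f n))\<^sup>2)" for n
    by (simp only: mult.assoc complex_norm_square[symmetric] of_real_mult)
  have "((\<lambda>n. H2_weight r n * (cmod (f n))\<^sup>2) has_sum (\<Sum>\<^sub>\<infinity>n. H2_weight r n * (cmod (f n))\<^sup>2)) UNIV" (is "(_ has_sum ?s) _")
    using f by (simp add: l2_def)
  then have "((\<lambda>n. complex_of_real (H2_weight r n * (cmod (f n))\<^sup>2)) has_sum of_real ?s) UNIV" by (rule has_sum_of_real)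
  then have "l2_ip r f f = of_real ?s" unfolding eq[symmetric] by (rule l2_ip_eqI)
  then show "((\<lambda>n. H2_weight r n * (cmod (f n))\<^sup>2) has_sum Re (l2_ip r f f)) UNIV" "Im (l2_ip r f f) = 0"
    using f by (simp_all add: l2_def)
qed

lemma l2_inner: "complex_inner_space l2_smul (l2 r) (l2_ip r)"
proof -
  interpret vector_space l2_smul by (rule vector_space_l2_smul)
  show ?thesis
  proof
    show "subspace (l2 r)"
      by (rule subspaceI) (auto simp: l2_add l2_scale, simp add: l2_def)
    fix f g h :: "int \<Rightarrow> complex" and c :: complex
    show "l2_ip r (f + g) h = l2_ip r f h + l2_ip r g h" if "f \<in> l2 r" "g \<in> l2 r" "h \<in> l2 r"
      by (rule l2_ip_eqI) (use has_sum_add[OF l2_ip_has_sum[OF that(1,3)] l2_ip_has_sum[OF that(2,3)]] in \<open>simp add: algebra_simps\<close>)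
    show "l2_ip r (l2_smul c f) g = c * l2_ip r f g" if "f \<in> l2 r" "g \<in> l2 r"
      by (rule l2_ip_eqI) (use has_sum_cmult_right[OF l2_ip_has_sum[OF that], of c] in \<open>simp add: l2_smul_def mult_ac\<close>)
    show "l2_ip r g f = cnj (l2_ip r f g)" if "f \<in> l2 r" "g \<in> l2 r"
    proof (rule l2_ip_eqI)
      have "((\<lambda>n. cnj (of_real (H2_weight r n) * f n * cnj (g n))) has_sum cnj (l2_ip r f g)) UNIV"
        using l2_ip_has_sum[OF that] by (simp only: has_sum_cnj_iff)
      then show "((\<lambda>n. of_real (H2_weight r n) * g n * cnj (f n)) has_sum cnj (l2_ip r f g)) UNIV" by (simp add: mult_ac)
    qed
    show "0 \<le> Re (l2_ip r f f)" if "f \<in> l2 r"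
      by (rule has_sum_nonneg[OF l2_ip_self(1)[OF that]]) (simp_all add: weight_nonneg)
    show "f = 0" if f: "f \<in> l2 r" and 0: "l2_ip r f f = 0"
    proof
      fix n
      have "H2_weight r n * (cmod (f n))\<^sup>2 \<le> 0"
        using finite_sum_le_has_sum[OF l2_ip_self(1)[OF f], of "{n}"] 0 by (simp add: weight_nonneg)
      then show "f n = 0 n" using weight_pos[of n] by (simp add: mult_le_0_iff)
    qed
  qed
qed

interpretation l2: complex_inner_space l2_smul "l2 r" "l2_ip r" by (rule l2_inner)

lemma l2_coordinate: assumes "f \<in> l2 r" shows "H2_weight r n * (cmod (f n))\<^sup>2 \<le> (l2_norm r f)\<^sup>2"
  using finite_sum_le_has_sum[OF l2_ip_self(1)[OF assms], of "{n}"] assms by (simp add: weight_nonneg l2.hnorm_square)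

lemma l2_partial_bound:
  assumes "\<And>F. finite F \<Longrightarrow> (\<Sum>n\<in>F. H2_weight r n * (cmod (f n))\<^sup>2) \<le> C\<^sup>2" "0 \<le> C"
  shows "f \<in> l2 r" "l2_norm r f \<le> C"
proof -
  have "(\<lambda>n. H2_weight r n * (cmod (f n))\<^sup>2) summable_on UNIV"
  proof (rule nonneg_bdd_above_summable_on)
    show "bdd_above (sum (\<lambda>n. H2_weight r n * (cmod (f n))\<^sup>2) ` {F. F \<subseteq> UNIV \<and> finite F})"
      by (rule bdd_aboveI2) (use assms in blast)
  qed (simp_all add: weight_nonneg)
  then show f: "f \<in> l2 r" by (simp add: l2_def)
  have "(l2_norm r f)\<^sup>2 \<le> C\<^sup>2"
    unfolding l2.hnorm_square[OF f] using has_sum_le_finite_sums[OF l2_ip_self(1)[OF f]] assms(1) by blast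
  then show "l2_norm r f \<le> C" by (rule power2_le_imp_le) (rule assms(2))
qed

lemma l2_hilbert: "complex_hilbert_space l2_smul (l2 r) (l2_ip r)"
proof (unfold_locales)
  fix X :: "nat \<Rightarrow> int \<Rightarrow> complex"
  assume X: "\<And>n. X n \<in> l2 r" and cau: "\<And>e. e > 0 \<Longrightarrow> \<exists>M. \<forall>m\<ge>M. \<forall>n\<ge>M. l2_norm r (X m - X n) < e"
  have "convergent (\<lambda>m. X m n)" for n
  proof (rule Cauchy_convergent, rule metric_CauchyI)
    fix e :: real assume e: "0 < e"
    then have "0 < e * sqrt (H2_weight r n)" using weight_pos[of n] by simp
    from cau[OF this] obtain M where M: "\<And>k l. k \<ge> M \<Longrightarrow> l \<ge> M \<Longrightarrow> l2_norm r (X k - X l) < e * sqrt (H2_weight r n)" by blast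
    have "dist (X k n) (X l n) < e" if "k \<ge> M" "l \<ge> M" for k l
    proof -
      have "H2_weight r n * (cmod ((X k - X l) n))\<^sup>2 \<le> (l2_norm r (X k - X l))\<^sup>2"
        by (rule l2_coordinate[OF l2.H_diff[OF X X]])
      also have "\<dots> < (e * sqrt (H2_weight r n))\<^sup>2"
        using M[OF that] by (intro power_strict_mono l2.hnorm_nonneg l2.H_diff X) auto
      also have "\<dots> = H2_weight r n * e\<^sup>2" using weight_pos[of n] by (simp add: power_mult_distrib)
      finally have "(cmod ((X k - X l) n))\<^sup>2 < e\<^sup>2" using weight_pos[of n] by simp
      then have "cmod ((X k - X l) n) < e" by (rule power2_less_imp_less) (use e in simp)
      then show ?thesis by (simp add: dist_norm)
    qed
    then show "\<exists>M. \<forall>m\<ge>M. \<forall>k\<ge>M. dist (X m n) (X k n) < e" by blast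
  qed
  then obtain g where g: "\<And>n. (\<lambda>m. X m n) \<longlonglongrightarrow> g n" unfolding convergent_def by metis
  have close: "\<exists>M. \<forall>m\<ge>M. X m - g \<in> l2 r \<and> l2_norm r (X m - g) \<le> e" if e: "0 < e" for e
  proof -
    from cau[OF e] obtain M where M: "\<And>k l. k \<ge> M \<Longrightarrow> l \<ge> M \<Longrightarrow> l2_norm r (X k - X l) < e" by blast
    have part: "(\<Sum>n\<in>F. H2_weight r n * (cmod ((X m - g) n))\<^sup>2) \<le> e\<^sup>2" if m: "m \<ge> M" and F: "finite F" for m F
    proof (rule LIMSEQ_le_const2)
      show "(\<lambda>k. \<Sum>n\<in>F. H2_weight r n * (cmod (X m n - X k n))\<^sup>2) \<longlonglongrightarrow> (\<Sum>n\<in>F. H2_weight r n * (cmod ((X m - g) n))\<^sup>2)"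
        using g by (auto intro!: tendsto_intros)
      have "(\<Sum>n\<in>F. H2_weight r n * (cmod (X m n - X k n))\<^sup>2) \<le> e\<^sup>2" if k: "k \<ge> M" for k
      proof -
        have D: "X m - X k \<in> l2 r" by (rule l2.H_diff[OF X X])
        have "(\<Sum>n\<in>F. H2_weight r n * (cmod ((X m - X k) n))\<^sup>2) \<le> Re (l2_ip r (X m - X k) (X m - X k))"
          by (rule finite_sum_le_has_sum[OF l2_ip_self(1)[OF D] F]) (simp_all add: weight_nonneg)
        also have "\<dots> = (l2_norm r (X m - X k))\<^sup>2" by (rule l2.hnorm_square[OF D, symmetric])
        also have "\<dots> \<le> e\<^sup>2" using M[OF m k] l2.hnorm_nonneg[OF D] by (intro power_mono) auto
        finally show ?thesis by simp
      qed
      then show "\<exists>N. \<forall>k\<ge>N. (\<Sum>n\<in>F. H2_weight r n * (cmod (X m n - X k n))\<^sup>2) \<le> e\<^sup>2" by blast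
    qed
    show ?thesis using l2_partial_bound[OF part less_imp_le[OF e]] by blast
  qed
  have gl: "g \<in> l2 r"
  proof -
    obtain m where m: "X m - g \<in> l2 r" using close[of 1] by auto
    have "X m - (X m - g) = g" by (simp add: fun_eq_iff)
    then show ?thesis using l2.H_diff[OF X[of m] m] by (simp only:)
  qed
  have "(\<lambda>m. l2_norm r (X m - g)) \<longlonglongrightarrow> 0"
  proof (rule LIMSEQ_I)
    fix e :: real assume e: "0 < e"
    obtain M where M: "\<And>m. m \<ge> M \<Longrightarrow> l2_norm r (X m - g) \<le> e / 2" using close[of "e / 2"] e by auto
    have "norm (l2_norm r (X m - g) - 0) < e" if "m \<ge> M" for m
      using M[OF that] l2.hnorm_nonneg[OF l2.H_diff[OF X gl], of m] e by auto
    then show "\<exists>M. \<forall>m\<ge>M. norm (l2_norm r (X m - g) - 0) < e" by blast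
  qed
  then show "\<exists>g\<in>l2 r. (\<lambda>n. l2_norm r (X n - g)) \<longlonglongrightarrow> 0" using gl by blast
qed

end

section \<open>Kernel vectors\<close>

text \<open>The coefficients of the reproducing kernel at \<open>\<mu>\<close>.\<close>

definition kernel_vector :: "real \<Rightarrow> complex \<Rightarrow> int \<Rightarrow> complex" where
  "kernel_vector r \<mu> n = cnj \<mu> powi n / of_real (H2_weight r n)"

text \<open>The reproducing kernel at \<open>(\<nu>, \<mu>)\<close> as a function of \<open>t = \<nu> cnj \<mu>\<close>.\<close>

definition kernel_fun :: "real \<Rightarrow> complex \<Rightarrow> complex" where
  "kernel_fun r t = of_real (1 - r\<^sup>2) / ((1 - t) * (1 - of_real (r\<^sup>2) / t))"

lemma cnj_powi: "cnj (z powi n) = cnj z powi n"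
  by (simp add: power_int_def)

lemma kernel_has_sum:
  assumes r: "0 < r" and t: "r\<^sup>2 < cmod t" "cmod t < 1"
  shows "((\<lambda>n. t powi n / of_real (H2_weight r n)) has_sum kernel_fun r t) UNIV"
proof -
  have t0: "t \<noteq> 0" and t1: "t \<noteq> 1" using t by auto
  define q where "q = of_real (r\<^sup>2) / t"
  have q: "cmod q < 1" unfolding q_def using t by (simp add: norm_divide divide_less_eq norm_power)
  have q1: "q \<noteq> 1" using q by auto
  have geo: "((\<lambda>k. x ^ k) has_sum (1 / (1 - x))) UNIV" if "cmod x < 1" for x :: complex
    by (rule norm_summable_imp_has_sum) (use that in \<open>auto simp: norm_power intro: summable_geometric geometric_sums\<close>)
  have "((\<lambda>n. t powi n / of_real (H2_weight r n)) has_sum (1 / (1 - t) + q * (1 / (1 - q)))) UNIV"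
  proof (rule has_sum_int_split)
    show "((\<lambda>k. t powi int k / of_real (H2_weight r (int k))) has_sum 1 / (1 - t)) UNIV"
      using geo[OF t(2)] by (simp add: H2_weight_def)
    have "t powi (- int k - 1) / of_real (H2_weight r (- int k - 1)) = q * q ^ k" for k
    proof -
      have e: "- int k - 1 = - int (Suc k)" "2 * - int (Suc k) = - int (2 * Suc k)" by simp_all
      have "H2_weight r (- int k - 1) = inverse (r ^ (2 * Suc k))"
        unfolding H2_weight_def e(1) by (simp only: e(2) power_int_minus power_int_of_nat) simp
      moreover have "t powi (- int k - 1) = inverse (t ^ Suc k)" unfolding e(1) by (simp only: power_int_minus power_int_of_nat)
      moreover have "q * q ^ k = of_real (r ^ (2 * Suc k)) / t ^ Suc k"
        unfolding q_def power_Suc[symmetric] power_divide power_mult by simp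
      ultimately show ?thesis by (simp add: divide_inverse)
    qed
    then show "((\<lambda>k. t powi (- int k - 1) / of_real (H2_weight r (- int k - 1))) has_sum q * (1 / (1 - q))) UNIV"
      using has_sum_cmult_right[OF geo[OF q], of q] by simp
  qed
  moreover have "1 / (1 - t) + q * (1 / (1 - q)) = kernel_fun r t"
  proof -
    have "1 / (1 - t) + q * (1 / (1 - q)) = (1 - q * t) / ((1 - t) * (1 - q))"
      using t1 q1 by (simp add: field_simps)
    also have "q * t = of_real (r\<^sup>2)" using t0 by (simp add: q_def)
    finally show ?thesis unfolding kernel_fun_def q_def by simp
  qed
  ultimately show ?thesis by simp
qed

lemma annulus_product:
  assumes "0 < r" "\<nu> \<in> annulus r" "\<mu> \<in> annulus r"
  shows "r\<^sup>2 < cmod (\<nu> * cnj \<mu>)" "cmod (\<nu> * cnj \<mu>) < 1"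
proof -
  have l: "r < cmod \<nu>" "cmod \<nu> < 1" "r < cmod \<mu>" "cmod \<mu> < 1" using assms by (auto simp: annulus_def)
  show "r\<^sup>2 < cmod (\<nu> * cnj \<mu>)" unfolding norm_mult power2_eq_square complex_mod_cnj
    using l assms(1) by (intro mult_strict_mono) auto
  have "cmod \<nu> * cmod \<mu> < 1 * 1" using l assms(1) by (intro mult_strict_mono) auto
  then show "cmod (\<nu> * cnj \<mu>) < 1" by (simp add: norm_mult)
qed

lemma kernel_vector_l2:
  assumes r: "0 < r" and \<mu>: "\<mu> \<in> annulus r"
  shows "kernel_vector r \<mu> \<in> l2 r"
proof -
  have "(\<lambda>n. cmod ((\<mu> * cnj \<mu>) powi n / of_real (H2_weight r n))) summable_on UNIV"
    using kernel_has_sum[OF r annulus_product[OF r \<mu> \<mu>]]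
    by (simp only: has_sum_imp_summable flip: summable_on_iff_abs_summable_on_complex)
  moreover have "cmod ((\<mu> * cnj \<mu>) powi n / of_real (H2_weight r n)) = H2_weight r n * (cmod (kernel_vector r \<mu> n))\<^sup>2" for n
    using H2_weight_pos[OF r, of n]
    by (simp add: kernel_vector_def norm_divide norm_power_int norm_mult power_divide power_int_mult_distrib power2_eq_square)
  ultimately show ?thesis by (simp add: l2_def)
qed

lemma kernel_vector_reproduces:
  assumes r: "0 < r" and g: "g \<in> l2 r" and \<mu>: "\<mu> \<in> annulus r"
  shows "((\<lambda>n. g n * \<mu> powi n) has_sum l2_ip r g (kernel_vector r \<mu>)) UNIV"
proof -
  have "of_real (H2_weight r n) * g n * cnj (kernel_vector r \<mu> n) = g n * \<mu> powi n" for n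
    using H2_weight_pos[OF r, of n] by (simp add: kernel_vector_def cnj_powi)
  then show ?thesis using l2_ip_has_sum[OF r g kernel_vector_l2[OF r \<mu>]] by (simp only:)
qed

lemma kernel_vector_ip:
  assumes r: "0 < r" and \<nu>: "\<nu> \<in> annulus r" and \<mu>: "\<mu> \<in> annulus r"
  shows "l2_ip r (kernel_vector r \<mu>) (kernel_vector r \<nu>) = kernel_fun r (\<nu> * cnj \<mu>)"
proof -
  have "kernel_vector r \<mu> n * \<nu> powi n = (\<nu> * cnj \<mu>) powi n / of_real (H2_weight r n)" for n
    by (simp add: kernel_vector_def power_int_mult_distrib)
  then show ?thesis
    using kernel_vector_reproduces[OF r kernel_vector_l2[OF r \<mu>] \<nu>] kernel_has_sum[OF r annulus_product[OF r \<nu> \<mu>]]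
    by (simp add: has_sum_unique)
qed

text \<open>A sequence orthogonal to all kernel vectors is the coefficient sequence of the zero function.\<close>

lemma kernel_vectors_dense:
  assumes r: "0 < r" "r < 1" and g: "g \<in> l2 r" and e: "0 < e"
  obtains \<Lambda> c where "finite \<Lambda>" "\<Lambda> \<subseteq> annulus r" "l2_norm r ((\<Sum>\<mu>\<in>\<Lambda>. l2_smul (c \<mu>) (kernel_vector r \<mu>)) - g) < e"
proof -
  interpret l2: complex_hilbert_space l2_smul "l2 r" "l2_ip r" by (rule l2_hilbert[OF r(1)])
  define K where "K = l2.span (kernel_vector r ` annulus r)"
  have K: "l2.subspace K" unfolding K_def by (rule l2.subspace_span)
  have "K \<subseteq> l2 r"
    unfolding K_def by (rule l2.span_minimal[OF image_subsetI l2.sub]) (rule kernel_vector_l2[OF r(1)])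
  note K = K this
  obtain h where h: "h \<in> l2 r" "\<And>e. e > 0 \<Longrightarrow> \<exists>k\<in>K. l2_norm r (k - h) < e" "\<And>k. k \<in> K \<Longrightarrow> l2_ip r (g - h) k = 0"
    using l2.projection[OF K g] by blast
  have gh: "g - h \<in> l2 r" using g h by simp
  have "(g - h) n = 0" for n
  proof (rule laurent_zero_unique)
    show "0 < (r + 1) / 2" using r by simp
    fix z :: complex assume "cmod z = (r + 1) / 2"
    then have z: "z \<in> annulus r" using r by (simp add: annulus_def)
    then have "kernel_vector r z \<in> K" unfolding K_def by (intro l2.span_base) auto
    then show "((\<lambda>n. (g - h) n * z powi n) has_sum 0) UNIV"
      using kernel_vector_reproduces[OF r(1) gh z] h(3) by simp
  qed
  then have "h = g" by (simp add: fun_eq_iff)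
  then obtain k where k: "k \<in> K" "l2_norm r (k - g) < e" using h(2) e by blast
  obtain A q where A: "finite A" "A \<subseteq> kernel_vector r ` annulus r" "k = (\<Sum>a\<in>A. l2_smul (q a) a)"
    using k(1) unfolding K_def l2.span_explicit by blast
  obtain \<Lambda> where \<Lambda>: "\<Lambda> \<subseteq> annulus r" "inj_on (kernel_vector r) \<Lambda>" "A = kernel_vector r ` \<Lambda>"
    using A(2) unfolding subset_image_inj by blast
  have "finite \<Lambda>" using A(1) \<Lambda> finite_image_iff by blast
  moreover have "k = (\<Sum>\<mu>\<in>\<Lambda>. l2_smul (q (kernel_vector r \<mu>)) (kernel_vector r \<mu>))"
    unfolding A(3) \<Lambda>(3) by (subst sum.reindex[OF \<Lambda>(2)]) simp
  ultimately show ?thesis using that[of \<Lambda> "\<lambda>\<mu>. q (kernel_vector r \<mu>)"] \<Lambda>(1) k(2) by simp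
qed

section \<open>Finite-dimensional models\<close>

lemma lagrange_functional:
  fixes f :: "'b \<Rightarrow> complex"
  assumes "finite B" "inj_on f B" "b \<in> B"
  obtains p where "\<And>b'. b' \<in> B \<Longrightarrow> poly p (f b') = (if b' = b then 1 else 0)"
proof -
  define q where "q = (\<Prod>b'\<in>B - {b}. [:- f b', 1:])"
  have q: "poly q x = (\<Prod>b'\<in>B - {b}. x - f b')" for x by (simp add: q_def poly_prod)
  have nz: "poly q (f b) \<noteq> 0" unfolding q using assms by (auto simp: inj_on_def)
  have "poly (smult (1 / poly q (f b)) q) (f b') = (if b' = b then 1 else 0)" if "b' \<in> B" for b'
    using nz assms(1) that by (auto simp: q)
  then show ?thesis using that by blast
qed

text \<open>The span of \<open>B\<close> receives the inner product that makes \<open>b\<close> a copy of the reproducing kernel at \<open>pt b\<close>.\<close>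

locale kernel_model = vector_space smul
  for smul :: "complex \<Rightarrow> 'v::ab_group_add \<Rightarrow> 'v" +
  fixes r :: real and B :: "'v set" and pt :: "'v \<Rightarrow> complex"
  assumes r: "0 < r" "r < 1" and fin: "finite B" and ind: "independent B"
    and inj: "inj_on pt B" and pt: "b \<in> B \<Longrightarrow> pt b \<in> annulus r"
begin

sublocale l2: complex_hilbert_space l2_smul "l2 r" "l2_ip r" by (rule l2_hilbert[OF r(1)])

abbreviation "rep \<equiv> representation B"
abbreviation "H \<equiv> span B"

definition J :: "'v \<Rightarrow> int \<Rightarrow> complex" where
  "J x = (\<Sum>b\<in>B. l2_smul (rep x b) (kernel_vector r (pt b)))"

definition ip :: "'v \<Rightarrow> 'v \<Rightarrow> complex" where
  "ip x y = l2_ip r (J x) (J y)"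

lemma kernel_vector_pt_l2: "b \<in> B \<Longrightarrow> kernel_vector r (pt b) \<in> l2 r"
  by (rule kernel_vector_l2[OF r(1) pt])

lemma J_l2: "J x \<in> l2 r"
  unfolding J_def by (intro l2.H_sum l2.H_smul kernel_vector_pt_l2)

lemma J_add: "x \<in> H \<Longrightarrow> y \<in> H \<Longrightarrow> J (x + y) = J x + J y"
  by (simp add: J_def representation_add[OF ind] l2.scale_left_distrib sum.distrib)

lemma J_smul: "x \<in> H \<Longrightarrow> J (smul c x) = l2_smul c (J x)"
  by (simp add: J_def representation_scale[OF ind] l2.scale_sum_right)

lemma expand: "x \<in> H \<Longrightarrow> (\<Sum>b\<in>B. smul (rep x b) b) = x"
  by (rule sum_representation_eq[OF ind _ fin]) auto

lemma rep_combination: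
  assumes b: "b \<in> B"
  shows "rep (\<Sum>b\<in>B. smul (c b) b) b = c b"
proof -
  have "rep (\<Sum>b\<in>B. smul (c b) b) b = (\<Sum>b'\<in>B. rep (smul (c b') b') b)"
    by (simp add: representation_sum[OF ind] span_base span_scale)
  also have "\<dots> = (\<Sum>b'\<in>B. c b' * (if b' = b then 1 else 0))"
    by (intro sum.cong refl) (simp add: representation_scale[OF ind] span_base representation_basis[OF ind])
  also have "\<dots> = (\<Sum>b'\<in>B. if b' = b then c b' else 0)" by (intro sum.cong refl) simp
  finally show ?thesis using b fin by simp
qed

lemma combination_H [simp]: "(\<Sum>b\<in>B. smul (c b) b) \<in> H"
  by (intro span_sum span_scale span_base)

lemma J_combination: "J (\<Sum>b\<in>B. smul (c b) b) = (\<Sum>b\<in>B. l2_smul (c b) (kernel_vector r (pt b)))"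
  unfolding J_def by (intro sum.cong refl) (simp add: rep_combination)

lemma J_nonneg_index: "J x (int n) = (\<Sum>b\<in>B. rep x b * cnj (pt b) ^ n)"
proof -
  have "(\<Sum>b\<in>B. g b) k = (\<Sum>b\<in>B. g b k)" for g :: "'v \<Rightarrow> int \<Rightarrow> complex" and k
    by (induction B rule: infinite_finite_induct) auto
  then show ?thesis by (simp add: J_def l2_smul_def kernel_vector_def H2_weight_def)
qed

text \<open>Lagrange interpolation at the points \<open>cnj (pt b)\<close> writes a coordinate of \<open>x\<close> as a fixed finite
combination of the entries of \<open>J x\<close> with nonnegative index. Definiteness and completeness of the model
both follow from this bound.\<close>

lemma coordinate_bound:
  assumes b: "b \<in> B"
  shows "\<exists>C\<ge>0. \<forall>x. cmod (rep x b) \<le> C * l2_norm r (J x)"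
proof -
  have "inj_on (\<lambda>b. cnj (pt b)) B" using inj by (auto simp: inj_on_def)
  then obtain p where p: "\<And>b'. b' \<in> B \<Longrightarrow> poly p (cnj (pt b')) = (if b' = b then 1 else 0)"
    using lagrange_functional[OF fin _ b] by blast
  have eq: "rep x b = (\<Sum>i\<le>degree p. coeff p i * J x (int i))" for x
  proof -
    have "(\<Sum>i\<le>degree p. coeff p i * J x (int i)) = (\<Sum>b'\<in>B. rep x b' * poly p (cnj (pt b')))"
      unfolding J_nonneg_index poly_altdef sum_distrib_left by (subst sum.swap) (simp add: mult_ac)
    also have "\<dots> = (\<Sum>b'\<in>B. rep x b' * (if b' = b then 1 else 0))" by (intro sum.cong refl) (simp add: p)
    also have "\<dots> = (\<Sum>b'\<in>B. if b' = b then rep x b' else 0)" by (intro sum.cong refl) simp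
    finally show ?thesis using b fin by simp
  qed
  have coord: "cmod (J x (int i)) \<le> l2_norm r (J x)" for x i
  proof (rule power2_le_imp_le)
    show "(cmod (J x (int i)))\<^sup>2 \<le> (l2_norm r (J x))\<^sup>2"
      using l2_coordinate[OF r(1) J_l2, of "int i" x] by (simp add: H2_weight_def)
  qed (rule l2.hnorm_nonneg[OF J_l2])
  have "cmod (rep x b) \<le> (\<Sum>i\<le>degree p. cmod (coeff p i)) * l2_norm r (J x)" for x
    unfolding eq sum_distrib_right
    by (rule order_trans[OF norm_sum]) (auto simp: norm_mult intro!: sum_mono mult_left_mono coord)
  then show ?thesis by (intro exI[of _ "\<Sum>i\<le>degree p. cmod (coeff p i)"]) (auto intro: sum_nonneg)
qed

sublocale complex_inner_space smul H ip
proof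
  show "subspace H" by (rule subspace_span)
  fix x y z :: 'v and c :: complex
  show "x \<in> H \<Longrightarrow> y \<in> H \<Longrightarrow> z \<in> H \<Longrightarrow> ip (x + y) z = ip x z + ip y z"
    by (simp add: ip_def J_add l2.s_add J_l2)
  show "x \<in> H \<Longrightarrow> y \<in> H \<Longrightarrow> ip (smul c x) y = c * ip x y"
    by (simp add: ip_def J_smul l2.s_smul J_l2)
  show "x \<in> H \<Longrightarrow> y \<in> H \<Longrightarrow> ip y x = cnj (ip x y)"
    unfolding ip_def by (intro l2.s_cnj J_l2)
  show "x \<in> H \<Longrightarrow> 0 \<le> Re (ip x x)"
    unfolding ip_def by (intro l2.s_nonneg J_l2)
  show "x = 0" if x: "x \<in> H" and 0: "ip x x = 0"
  proof -
    have "l2_norm r (J x) = 0" using 0 by (simp add: l2.hnorm_def ip_def)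
    note null = this
    have zero: "rep x b = 0" if b: "b \<in> B" for b
    proof -
      obtain C where "\<And>x. cmod (rep x b) \<le> C * l2_norm r (J x)" using coordinate_bound[OF b] by blast
      from this[of x] show ?thesis unfolding null by simp
    qed
    have "(\<Sum>b\<in>B. smul (rep x b) b) = 0" by (rule sum.neutral) (simp add: zero)
    then show ?thesis unfolding expand[OF x] .
  qed
qed

lemma hnorm_J: "hnorm x = l2_norm r (J x)"
  by (simp add: hnorm_def l2.hnorm_def ip_def)

lemma hnorm_le_coordinates: "x \<in> H \<Longrightarrow> hnorm x \<le> (\<Sum>b\<in>B. cmod (rep x b) * hnorm b)"
proof -
  assume x: "x \<in> H"
  have "hnorm (\<Sum>b\<in>B. smul (rep x b) b) \<le> (\<Sum>b\<in>B. hnorm (smul (rep x b) b))"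
    by (rule hnorm_sum) (simp add: span_base)
  also have "\<dots> = (\<Sum>b\<in>B. cmod (rep x b) * hnorm b)"
    by (intro sum.cong refl hnorm_smul) (simp add: span_base)
  finally show ?thesis by (simp add: expand[OF x])
qed

sublocale complex_hilbert_space smul H ip
proof
  fix X :: "nat \<Rightarrow> 'v"
  assume X: "\<And>n. X n \<in> H" and cau: "\<And>e. e > 0 \<Longrightarrow> \<exists>M. \<forall>m\<ge>M. \<forall>n\<ge>M. hnorm (X m - X n) < e"
  have "convergent (\<lambda>m. rep (X m) b)" if b: "b \<in> B" for b
  proof (rule Cauchy_convergent, rule metric_CauchyI)
    fix e :: real assume e: "0 < e"
    obtain C where C: "C \<ge> 0" "\<And>x. cmod (rep x b) \<le> C * hnorm x" using coordinate_bound[OF b] by (auto simp: hnorm_J)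
    have "0 < e / (C + 1)" using e C by simp
    from cau[OF this] obtain M where M: "\<And>k l. k \<ge> M \<Longrightarrow> l \<ge> M \<Longrightarrow> hnorm (X k - X l) < e / (C + 1)" by blast
    have "dist (rep (X k) b) (rep (X l) b) < e" if "k \<ge> M" "l \<ge> M" for k l
    proof -
      have "dist (rep (X k) b) (rep (X l) b) = cmod (rep (X k - X l) b)"
        by (simp add: dist_norm representation_diff[OF ind X X])
      also have "\<dots> \<le> C * hnorm (X k - X l)" by (rule C(2))
      also have "\<dots> \<le> (C + 1) * hnorm (X k - X l)" using X by (intro mult_right_mono) (auto simp: H_diff)
      also have "\<dots> < (C + 1) * (e / (C + 1))" using M[OF that] C by (intro mult_strict_left_mono) auto
      also have "\<dots> = e" using C by simp
      finally show ?thesis .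
    qed
    then show "\<exists>M. \<forall>m\<ge>M. \<forall>n\<ge>M. dist (rep (X m) b) (rep (X n) b) < e" by blast
  qed
  then have "\<forall>b\<in>B. \<exists>l. (\<lambda>m. rep (X m) b) \<longlonglongrightarrow> l" by (auto simp: convergent_def)
  then obtain c where c: "\<And>b. b \<in> B \<Longrightarrow> (\<lambda>m. rep (X m) b) \<longlonglongrightarrow> c b" by metis
  define x where "x = (\<Sum>b\<in>B. smul (c b) b)"
  have xH: "x \<in> H" by (simp add: x_def)
  have "(\<lambda>m. hnorm (X m - x)) \<longlonglongrightarrow> 0"
  proof (rule tendsto_sandwich[OF _ _ tendsto_const])
    have "(\<lambda>m. \<Sum>b\<in>B. cmod (rep (X m) b - c b) * hnorm b) \<longlonglongrightarrow> (\<Sum>b\<in>B. cmod (c b - c b) * hnorm b)"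
      by (intro tendsto_intros c)
    then show "(\<lambda>m. \<Sum>b\<in>B. cmod (rep (X m) b - c b) * hnorm b) \<longlonglongrightarrow> 0" by simp
    have "hnorm (X m - x) \<le> (\<Sum>b\<in>B. cmod (rep (X m) b - c b) * hnorm b)" for m
    proof -
      have "rep (X m - x) b = rep (X m) b - c b" if "b \<in> B" for b
        using representation_diff[OF ind xH X, of m] rep_combination[OF that, of c] by (simp add: x_def)
      then show ?thesis using hnorm_le_coordinates[OF H_diff[OF X xH], of m] by (simp cong: sum.cong)
    qed
    then show "\<forall>\<^sub>F m in sequentially. hnorm (X m - x) \<le> (\<Sum>b\<in>B. cmod (rep (X m) b - c b) * hnorm b)" by simp
    show "\<forall>\<^sub>F m in sequentially. 0 \<le> hnorm (X m - x)" using X xH by (simp add: H_diff)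
  qed
  then show "\<exists>x\<in>H. (\<lambda>n. hnorm (X n - x)) \<longlonglongrightarrow> 0" using xH by blast
qed

definition diag_op :: "('v \<Rightarrow> complex) \<Rightarrow> 'v \<Rightarrow> 'v" where
  "diag_op f x = (if x \<in> H then \<Sum>b\<in>B. smul (f b * rep x b) b else 0)"

lemma diag_op_H: "diag_op f x \<in> H"
  by (simp add: diag_op_def span_zero)

lemma rep_diag_op: "x \<in> H \<Longrightarrow> b \<in> B \<Longrightarrow> rep (diag_op f x) b = f b * rep x b"
  by (simp add: diag_op_def rep_combination)

lemma diag_op_bounded: "diag_op f \<in> bounded_ops"
proof -
  obtain C where C: "\<And>b. b \<in> B \<Longrightarrow> C b \<ge> 0" "\<And>b x. b \<in> B \<Longrightarrow> cmod (rep x b) \<le> C b * hnorm x"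
    using coordinate_bound unfolding hnorm_J by metis
  show ?thesis
  proof (rule bounded_opsI[where K = "\<Sum>b\<in>B. cmod (f b) * C b * hnorm b"])
    fix x assume x: "x \<in> H"
    have "hnorm (diag_op f x) \<le> (\<Sum>b\<in>B. cmod (rep (diag_op f x) b) * hnorm b)"
      by (rule hnorm_le_coordinates[OF diag_op_H])
    also have "\<dots> \<le> (\<Sum>b\<in>B. cmod (f b) * (C b * hnorm x) * hnorm b)"
      using C(2) by (intro sum_mono mult_right_mono) (auto simp: rep_diag_op[OF x] norm_mult span_base intro!: mult_left_mono)
    finally show "hnorm (diag_op f x) \<le> (\<Sum>b\<in>B. cmod (f b) * C b * hnorm b) * hnorm x"
      by (simp add: sum_distrib_left mult_ac)
  next
    fix x y assume x: "x \<in> H" and y: "y \<in> H"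
    show "diag_op f (x + y) = diag_op f x + diag_op f y"
      using x y by (simp add: diag_op_def span_add representation_add[OF ind y x] distrib_left scale_left_distrib sum.distrib)
  next
    fix c x assume x: "x \<in> H"
    show "diag_op f (smul c x) = smul c (diag_op f x)"
      using x by (simp add: diag_op_def span_scale representation_scale[OF ind x] scale_sum_right mult.left_commute)
  qed (rule diag_op_H, simp add: diag_op_def)
qed

lemma diag_op_D: "x \<in> H \<Longrightarrow> diag_op f (diag_op g x) = diag_op (\<lambda>b. f b * g b) x"
proof -
  assume x: "x \<in> H"
  have "diag_op f (diag_op g x) = (\<Sum>b\<in>B. smul (f b * rep (diag_op g x) b) b)" by (simp add: diag_op_def[of f] diag_op_H)
  also have "\<dots> = diag_op (\<lambda>b. f b * g b) x" using x by (simp add: rep_diag_op diag_op_def[of "\<lambda>b. f b * g b"] mult.assoc)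
  finally show ?thesis .
qed

lemma diag_op_inverse:
  assumes "x \<in> H" "\<And>b. b \<in> B \<Longrightarrow> f b \<noteq> 0"
  shows "diag_op f (diag_op (\<lambda>b. 1 / f b) x) = x" "diag_op (\<lambda>b. 1 / f b) (diag_op f x) = x"
  using assms by (simp_all add: diag_op_D) (simp_all add: diag_op_def expand)

lemma diag_op_basis: "b \<in> B \<Longrightarrow> diag_op f b = smul (f b) b"
proof -
  assume b: "b \<in> B"
  have "diag_op f b = (\<Sum>b'\<in>B. if b' = b then smul (f b) b else 0)"
    unfolding diag_op_def using b by (auto simp: span_base representation_basis[OF ind] intro!: sum.cong)
  then show ?thesis using b fin by simp
qed

lemma adjoint_diag_op_inverse:
  assumes "\<And>b. b \<in> B \<Longrightarrow> f b \<noteq> 0"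
  shows "adjoint_op (diag_op (\<lambda>b. 1 / f b)) \<circ> adjoint_op (diag_op f) = id_op"
    "adjoint_op (diag_op f) \<circ> adjoint_op (diag_op (\<lambda>b. 1 / f b)) = id_op"
proof -
  have a: "adjoint_op (diag_op g) x \<in> H" if "x \<in> H" for g x using op_H[OF adjoint_op_bounded[OF diag_op_bounded] that] .
  show "adjoint_op (diag_op (\<lambda>b. 1 / f b)) \<circ> adjoint_op (diag_op f) = id_op"
    by (rule bounded_ops_ext[OF comp_bounded[OF adjoint_op_bounded[OF diag_op_bounded] adjoint_op_bounded[OF diag_op_bounded]] id_op_bounded])
       (simp add: adjoint_op_ip'[OF diag_op_bounded] a diag_op_H diag_op_inverse(1)[OF _ assms] id_op_def)
  show "adjoint_op (diag_op f) \<circ> adjoint_op (diag_op (\<lambda>b. 1 / f b)) = id_op"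
    by (rule bounded_ops_ext[OF comp_bounded[OF adjoint_op_bounded[OF diag_op_bounded] adjoint_op_bounded[OF diag_op_bounded]] id_op_bounded])
       (simp add: adjoint_op_ip'[OF diag_op_bounded] a diag_op_H diag_op_inverse(2)[OF _ assms] id_op_def)
qed

lemma invertible_adjoint_diag_op: "(\<And>b. b \<in> B \<Longrightarrow> f b \<noteq> 0) \<Longrightarrow> invertible_op (adjoint_op (diag_op f))"
  unfolding invertible_op_def using adjoint_diag_op_inverse[of f] adjoint_op_bounded[OF diag_op_bounded] by blast

text \<open>The kernel at \<open>\<mu>\<close> is an eigenvector, for \<open>cnj \<mu>\<close>, of the adjoint of the shift \<open>f \<mapsto> z f\<close>. Thus \<open>T\<close> is the
compression of the shift to the span of the kernels.\<close>

definition T :: "'v \<Rightarrow> 'v" where "T = adjoint_op (diag_op (\<lambda>b. cnj (pt b)))"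

lemma pt_nz: "b \<in> B \<Longrightarrow> cnj (pt b) \<noteq> 0"
  using pt r by (force simp: annulus_def)

lemma T_bounded: "T \<in> bounded_ops"
  unfolding T_def by (rule adjoint_op_bounded[OF diag_op_bounded])

lemma T_invertible: "invertible_op T"
  unfolding T_def by (rule invertible_adjoint_diag_op[OF pt_nz])

lemma adjoint_T: "adjoint_op T = diag_op (\<lambda>b. cnj (pt b))"
  by (rule adjoint_op_eqI[OF T_bounded diag_op_bounded]) (simp add: T_def adjoint_op_ip[OF diag_op_bounded])

lemma adjoint_inverse_T: "adjoint_op (inverse_op T) = diag_op (\<lambda>b. 1 / cnj (pt b))"
proof (rule adjoint_op_eqI[OF inverse_op_bounded[OF T_bounded T_invertible] diag_op_bounded])
  fix x y assume x: "x \<in> H" and y: "y \<in> H"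
  define z where "z = inverse_op T y"
  have z: "z \<in> H" "T z = y" using y op_H[OF inverse_op_bounded[OF T_bounded T_invertible] y] inverse_op_right[OF T_bounded T_invertible y] by (auto simp: z_def)
  have "ip (diag_op (\<lambda>b. 1 / cnj (pt b)) x) (T z) = ip (diag_op (\<lambda>b. cnj (pt b)) (diag_op (\<lambda>b. 1 / cnj (pt b)) x)) z"
    unfolding T_def by (rule adjoint_op_ip[OF diag_op_bounded diag_op_H z(1), symmetric])
  then show "ip (diag_op (\<lambda>b. 1 / cnj (pt b)) x) y = ip x (inverse_op T y)"
    using z diag_op_inverse(1)[OF x pt_nz] by (simp add: z_def)
qed

text \<open>For \<open>c\<close> off the annulus, \<open>T - c\<close> is the adjoint of a diagonal operator with nonzero entries.\<close>

lemma spectrum_T: "spectrum_op T \<subseteq> annulus r"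
proof
  fix c assume c: "c \<in> spectrum_op T"
  show "c \<in> annulus r"
  proof (rule ccontr)
    assume "c \<notin> annulus r"
    then have nz: "cnj (pt b) - cnj c \<noteq> 0" if "b \<in> B" for b using pt[OF that] by auto
    have "(\<lambda>x. T x - smul c (id_op x)) = adjoint_op (diag_op (\<lambda>b. cnj (pt b) - cnj c))"
    proof (rule adjoint_op_eqI[symmetric, OF diag_op_bounded minus_scaled_bounded[OF T_bounded id_op_bounded]])
      fix x y assume x: "x \<in> H" and y: "y \<in> H"
      have "diag_op (\<lambda>b. cnj (pt b) - cnj c) y = diag_op (\<lambda>b. cnj (pt b)) y - smul (cnj c) y"
      proof -
        have "smul (cnj c) y = (\<Sum>b\<in>B. smul (cnj c * rep y b) b)" using expand[OF y] by (metis (no_types, lifting) scale_scale scale_sum_right sum.cong)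
        then show ?thesis using y by (simp add: diag_op_def left_diff_distrib scale_left_diff_distrib sum_subtractf)
      qed
      then show "ip (T x - smul c (id_op x)) y = ip x (diag_op (\<lambda>b. cnj (pt b) - cnj c) y)"
        using x y by (simp add: s_diff s_diff_right s_smul s_smul_right id_op_def op_H[OF adjoint_op_bounded[OF diag_op_bounded]] diag_op_H T_def adjoint_op_ip'[OF diag_op_bounded])
    qed
    then have "invertible_op (\<lambda>x. T x - smul c (id_op x))" using invertible_adjoint_diag_op[OF nz] by simp
    then show False using c by (simp add: spectrum_op_def)
  qed
qed

lemma ip_kernel:
  "ip x y = (\<Sum>b\<in>B. \<Sum>b'\<in>B. rep x b * cnj (rep y b') * kernel_fun r (pt b' * cnj (pt b)))"
  unfolding ip_def J_def
  by (simp add: l2.s_sum l2.s_sum_right l2.s_smul l2.s_smul_right kernel_vector_pt_l2 kernel_vector_ip[OF r(1) pt pt] sum_distrib_left mult_ac)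
     (intro sum.swap)

text \<open>With \<open>t = pt b' cnj (pt b)\<close>, the function \<open>r\<^sup>2 + 1 - r\<^sup>2 / t - t\<close> behind the class condition factors as
\<open>(1 - t) (1 - r\<^sup>2 / t)\<close>, the denominator of the kernel.\<close>

lemma kernel_fun_identity:
  assumes "b \<in> B" "b' \<in> B"
  shows "(of_real (r\<^sup>2 + 1) - of_real (r\<^sup>2) * (1 / cnj (pt b) * cnj (1 / cnj (pt b'))) - cnj (pt b) * cnj (cnj (pt b'))) * kernel_fun r (pt b' * cnj (pt b)) = of_real (1 - r\<^sup>2)"
proof -
  define t where "t = pt b' * cnj (pt b)"
  have t: "r\<^sup>2 < cmod t" "cmod t < 1" unfolding t_def using annulus_product[OF r(1) pt[OF assms(2)] pt[OF assms(1)]] by auto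
  have t0: "t \<noteq> 0" and t1: "1 - t \<noteq> 0" using t by auto
  have t2: "1 - of_real (r\<^sup>2) / t \<noteq> 0"
  proof
    assume "1 - of_real (r\<^sup>2) / t = 0"
    then have "t = of_real (r\<^sup>2)" using t0 by (simp add: field_simps)
    then show False using t by (simp add: norm_power)
  qed
  have "of_real (r\<^sup>2 + 1) - of_real (r\<^sup>2) * (1 / cnj (pt b) * cnj (1 / cnj (pt b'))) - cnj (pt b) * cnj (cnj (pt b')) = (1 - t) * (1 - of_real (r\<^sup>2) / t)"
    using t0 by (simp add: t_def field_simps)
  then show ?thesis unfolding kernel_fun_def t_def[symmetric] using t1 t2 by simp
qed

text \<open>After multiplication by the kernel, the coefficients of the defect form are all equal to \<open>1 - r\<^sup>2\<close>, so the
form is a multiple of a single square.\<close>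

lemma defect_T:
  assumes x: "x \<in> H"
  shows "of_real (r\<^sup>2 + 1) * ip x x - of_real (r\<^sup>2) * ip (diag_op (\<lambda>b. 1 / cnj (pt b)) x) (diag_op (\<lambda>b. 1 / cnj (pt b)) x)
      - ip (diag_op (\<lambda>b. cnj (pt b)) x) (diag_op (\<lambda>b. cnj (pt b)) x) = of_real ((1 - r\<^sup>2) * (cmod (\<Sum>b\<in>B. rep x b))\<^sup>2)"
proof -
  have "of_real (r\<^sup>2 + 1) * ip x x - of_real (r\<^sup>2) * ip (diag_op (\<lambda>b. 1 / cnj (pt b)) x) (diag_op (\<lambda>b. 1 / cnj (pt b)) x)
      - ip (diag_op (\<lambda>b. cnj (pt b)) x) (diag_op (\<lambda>b. cnj (pt b)) x)
    = (\<Sum>b\<in>B. \<Sum>b'\<in>B. rep x b * cnj (rep x b') * ((of_real (r\<^sup>2 + 1) - of_real (r\<^sup>2) * (1 / cnj (pt b) * cnj (1 / cnj (pt b'))) - cnj (pt b) * cnj (cnj (pt b'))) * kernel_fun r (pt b' * cnj (pt b))))"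
    unfolding ip_kernel sum_distrib_left sum_subtractf[symmetric]
    by (intro sum.cong refl) (simp add: rep_diag_op[OF x] algebra_simps)
  also have "\<dots> = (\<Sum>b\<in>B. \<Sum>b'\<in>B. rep x b * cnj (rep x b') * of_real (1 - r\<^sup>2))"
    by (intro sum.cong refl arg_cong2[of _ _ _ _ "(*)"] kernel_fun_identity)
  also have "\<dots> = (\<Sum>b\<in>B. \<Sum>b'\<in>B. rep x b * cnj (rep x b')) * of_real (1 - r\<^sup>2)"
    by (simp only: sum_distrib_right)
  also have "\<dots> = of_real (1 - r\<^sup>2) * ((\<Sum>b\<in>B. rep x b) * cnj (\<Sum>b\<in>B. rep x b))"
    by (simp only: cnj_sum sum_product mult.commute)
  also have "\<dots> = of_real ((1 - r\<^sup>2) * (cmod (\<Sum>b\<in>B. rep x b))\<^sup>2)"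
    by (simp only: complex_norm_square[symmetric] of_real_mult)
  finally show ?thesis .
qed

lemma T_class_F: "T \<in> class_F_on r"
proof -
  have "op_le (\<lambda>x. smul (of_real (r\<^sup>2)) (inverse_op T (adjoint_op (inverse_op T) x)) + T (adjoint_op T x))
           (\<lambda>x. smul (of_real (r\<^sup>2 + 1)) (id_op x))"
    unfolding op_le_def adjoint_T adjoint_inverse_T
  proof
    fix x assume x: "x \<in> H"
    have Ti: "ip (inverse_op T (diag_op g x)) x = ip (diag_op g x) (diag_op (\<lambda>b. 1 / cnj (pt b)) x)" for g
      using adjoint_op_ip[OF inverse_op_bounded[OF T_bounded T_invertible] diag_op_H x] by (simp add: adjoint_inverse_T)
    have TT: "ip (T (diag_op g x)) x = ip (diag_op g x) (diag_op (\<lambda>b. cnj (pt b)) x)" for g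
      using adjoint_op_ip[OF T_bounded diag_op_H x] by (simp add: adjoint_T)
    have "ip (smul (of_real (r\<^sup>2 + 1)) (id_op x) - (smul (of_real (r\<^sup>2)) (inverse_op T (diag_op (\<lambda>b. 1 / cnj (pt b)) x)) + T (diag_op (\<lambda>b. cnj (pt b)) x))) x
       = of_real ((1 - r\<^sup>2) * (cmod (\<Sum>b\<in>B. rep x b))\<^sup>2)"
      using x op_H[OF inverse_op_bounded[OF T_bounded T_invertible] diag_op_H] op_H[OF T_bounded diag_op_H]
      by (subst defect_T[OF x, symmetric])
         (simp add: id_op_def s_diff s_add s_smul H_smul H_add Ti TT del: of_real_add of_real_power)
    moreover have "0 \<le> (1 - r\<^sup>2) * (cmod (\<Sum>b\<in>B. rep x b))\<^sup>2" using r by (simp add: power_le_one)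
    ultimately show "ip (smul (of_real (r\<^sup>2 + 1)) (id_op x) - (smul (of_real (r\<^sup>2)) (inverse_op T (diag_op (\<lambda>b. 1 / cnj (pt b)) x)) + T (diag_op (\<lambda>b. cnj (pt b)) x))) x \<in> \<real>
       \<and> 0 \<le> Re (ip (smul (of_real (r\<^sup>2 + 1)) (id_op x) - (smul (of_real (r\<^sup>2)) (inverse_op T (diag_op (\<lambda>b. 1 / cnj (pt b)) x)) + T (diag_op (\<lambda>b. cnj (pt b)) x))) x)"
      by (simp only: Reals_of_real Re_complex_of_real)
  qed
  then show ?thesis unfolding class_F_on_def using T_bounded T_invertible spectrum_T by blast
qed

sublocale F: class_F_operator smul H ip r T
  by unfold_locales (use r T_class_F in auto)

lemma zpow_basis: assumes b: "b \<in> B" shows "zpow (adjoint_op T) (adjoint_op (inverse_op T)) n b = smul (cnj (pt b) powi n) b"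
proof -
  have "(diag_op f ^^ k) b = smul (f b ^ k) b" for f k
    by (induction k) (simp_all add: op_smul[OF diag_op_bounded] span_base b diag_op_basis mult.commute)
  then show ?thesis unfolding adjoint_T adjoint_inverse_T
    by (simp add: zpow_def power_int_def power_one_over inverse_eq_divide)
qed

text \<open>Every \<open>b\<close> is an eigenvector of all powers of the adjoint of \<open>T\<close>, and the series for \<open>\<phi>(T)\<close> sums the
eigenvalues to a value of \<open>\<phi>\<close>.\<close>

lemma fun_calc_eigenvector:
  assumes \<phi>: "\<phi> holomorphic_on annulus r" and b: "b \<in> B"
  shows "adjoint_op (fun_calc r \<phi> T) b = smul (cnj (\<phi> (pt b))) b"
proof (rule ip_eqI)
  have bH: "b \<in> H" using b by (rule span_base)
  have P: "fun_calc r \<phi> T \<in> bounded_ops" by (rule F.fun_calc_bounded[OF \<phi>])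
  show "adjoint_op (fun_calc r \<phi> T) b \<in> H" by (rule op_H[OF adjoint_op_bounded[OF P] bH])
  show "smul (cnj (\<phi> (pt b))) b \<in> H" using bH by (rule span_scale)
  fix x assume x: "x \<in> H"
  have PH: "fun_calc r \<phi> T x \<in> H" by (rule op_H[OF P x])
  have "((\<lambda>n. laurent_coeff r \<phi> n * ip (zpow T (inverse_op T) n x) b) has_sum ip (fun_calc r \<phi> T x) b) UNIV"
    by (rule F.fun_calc_exists[OF \<phi>]) (use x bH in blast)
  moreover have "ip (zpow T (inverse_op T) n x) b = pt b powi n * ip x b" for n
    using x bH by (simp add: F.zpow_adjoint zpow_basis[OF b] s_smul_right cnj_powi)
  ultimately have "((\<lambda>n. laurent_coeff r \<phi> n * pt b powi n * ip x b) has_sum ip (fun_calc r \<phi> T x) b) UNIV"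
    by (simp add: mult.assoc)
  moreover have "((\<lambda>n. laurent_coeff r \<phi> n * pt b powi n * ip x b) has_sum \<phi> (pt b) * ip x b) UNIV"
    by (rule has_sum_cmult_left[OF laurent_coeff_has_sum[OF \<phi> r pt[OF b]]])
  ultimately have e: "ip (fun_calc r \<phi> T x) b = \<phi> (pt b) * ip x b" by (rule has_sum_unique)
  have "ip (adjoint_op (fun_calc r \<phi> T) b) x = ip b (fun_calc r \<phi> T x)" by (rule adjoint_op_ip'[OF P bH x])
  also have "\<dots> = cnj (\<phi> (pt b)) * ip b x"
    using e ip_cnj[OF PH bH] ip_cnj[OF x bH] by simp
  finally show "ip (adjoint_op (fun_calc r \<phi> T) b) x = ip (smul (cnj (\<phi> (pt b))) b) x"
    using bH x by (simp add: s_smul)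
qed

lemma kernel_combination_bound:
  assumes \<phi>: "\<phi> holomorphic_on annulus r"
  shows "l2_norm r (\<Sum>b\<in>B. l2_smul (c b * cnj (\<phi> (pt b))) (kernel_vector r (pt b)))
     \<le> op_norm (fun_calc r \<phi> T) * l2_norm r (\<Sum>b\<in>B. l2_smul (c b) (kernel_vector r (pt b)))"
proof -
  define x where "x = (\<Sum>b\<in>B. smul (c b) b)"
  have P: "fun_calc r \<phi> T \<in> bounded_ops" by (rule F.fun_calc_bounded[OF \<phi>])
  note A = adjoint_op_bounded[OF P]
  have "adjoint_op (fun_calc r \<phi> T) x = (\<Sum>b\<in>B. smul (c b * cnj (\<phi> (pt b))) b)"
    unfolding x_def by (simp add: op_sum[OF A] op_smul[OF A] span_base span_scale fun_calc_eigenvector[OF \<phi>])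
  then have "hnorm (\<Sum>b\<in>B. smul (c b * cnj (\<phi> (pt b))) b) \<le> op_norm (fun_calc r \<phi> T) * hnorm x"
    using adjoint_hnorm_le[OF P op_norm_nonneg[OF P] op_norm_upper[OF P], of x] by (simp add: x_def)
  then show ?thesis unfolding x_def hnorm_J J_combination .
qed

end


section \<open>The multiplier norm as a supremum\<close>

lemma (in vector_space) exists_independent_card:
  assumes "\<And>B. finite B \<Longrightarrow> span B \<noteq> UNIV"
  shows "\<exists>B. finite B \<and> independent B \<and> card B = n"
proof (induction n)
  case 0
  show ?case by (intro exI[of _ "{}"]) (simp add: independent_empty)
next
  case (Suc n)
  then obtain B where B: "finite B" "independent B" "card B = n" by blast
  obtain x where x: "x \<notin> span B" using assms[OF B(1)] by blast
  then have "x \<notin> B" using span_base by blast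
  then show ?case using B x by (intro exI[of _ "insert x B"]) (simp add: independent_insertI)
qed

lemma class_F_kernel_model:
  fixes smul :: "complex \<Rightarrow> 'v::ab_group_add \<Rightarrow> 'v"
  assumes r: "0 < r" "r < 1" and V: "vector_space smul" "\<And>B. finite B \<Longrightarrow> module.span smul B \<noteq> UNIV"
    and \<phi>: "\<phi> \<in> H_infty r" and \<Lambda>: "finite \<Lambda>" "\<Lambda> \<subseteq> annulus r"
  obtains X where "X \<in> class_F smul r" "0 \<le> fun_calc_norm smul r \<phi> X"
    "\<And>c. l2_norm r (\<Sum>\<mu>\<in>\<Lambda>. l2_smul (c \<mu> * cnj (\<phi> \<mu>)) (kernel_vector r \<mu>))
       \<le> fun_calc_norm smul r \<phi> X * l2_norm r (\<Sum>\<mu>\<in>\<Lambda>. l2_smul (c \<mu>) (kernel_vector r \<mu>))"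
proof -
  interpret V: vector_space smul by (rule V(1))
  obtain B where B: "finite B" "V.independent B" "card B = card \<Lambda>"
    using V.exists_independent_card[OF V(2)] by blast
  obtain pt where bij: "bij_betw pt B \<Lambda>" using finite_same_card_bij[OF B(1) \<Lambda>(1) B(3)] by blast
  interpret kernel_model smul r B pt
    by unfold_locales (use r B bij \<Lambda>(2) in \<open>auto simp: bij_betw_def\<close>)
  have hol: "\<phi> holomorphic_on annulus r" using \<phi> by (simp add: H_infty_def)
  define X where "X = (V.span B, ip, T)"
  have norm: "fun_calc_norm smul r \<phi> X = op_norm (fun_calc r \<phi> T)" by (simp add: fun_calc_norm_def X_def)
  have "X \<in> class_F smul r"
    unfolding class_F_def X_def using T_class_F complex_hilbert_space_axioms by simp
  moreover have "0 \<le> fun_calc_norm smul r \<phi> X"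
    unfolding norm by (rule op_norm_nonneg[OF F.fun_calc_bounded[OF hol]])
  moreover have "l2_norm r (\<Sum>\<mu>\<in>\<Lambda>. l2_smul (c \<mu> * cnj (\<phi> \<mu>)) (kernel_vector r \<mu>))
       \<le> fun_calc_norm smul r \<phi> X * l2_norm r (\<Sum>\<mu>\<in>\<Lambda>. l2_smul (c \<mu>) (kernel_vector r \<mu>))" for c
    using kernel_combination_bound[OF hol, of "\<lambda>b. c (pt b)"]
    unfolding norm sum.reindex_bij_betw[OF bij, symmetric] .
  ultimately show ?thesis by (rule that)
qed

text \<open>For a combination \<open>h\<close> of kernels, \<open>\<langle>\<phi> f, h\<rangle> = \<langle>f, h'\<rangle>\<close>, where \<open>h'\<close> carries the factors \<open>cnj (\<phi> \<mu>)\<close>; the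
models bound the norm of \<open>h'\<close> by \<open>\<sigma>\<close> times that of \<open>h\<close>. Letting \<open>h\<close> approach \<open>\<phi> f\<close> gives
\<open>\<parallel>\<phi> f\<parallel>\<^sup>2 \<le> \<sigma> \<parallel>f\<parallel> \<parallel>\<phi> f\<parallel>\<close>.\<close>

lemma Mult_norm_le_sup_class_F:
  fixes smul :: "complex \<Rightarrow> 'v::ab_group_add \<Rightarrow> 'v"
  assumes r: "0 < r" "r < 1" and V: "vector_space smul" "\<And>B. finite B \<Longrightarrow> module.span smul B \<noteq> UNIV"
    and \<phi>: "\<phi> \<in> H_infty r"
    and \<sigma>: "0 \<le> \<sigma>" "\<And>X. X \<in> class_F smul r \<Longrightarrow> fun_calc_norm smul r \<phi> X \<le> \<sigma>"
  shows "Mult_norm r \<phi> \<le> \<sigma>"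
  unfolding Mult_norm_def
proof (rule cSUP_least)
  have "(\<lambda>z. 0) \<in> {f \<in> H2 r. H2_norm r f \<le> 1}" by (simp add: zero_H2 r)
  then show "{f \<in> H2 r. H2_norm r f \<le> 1} \<noteq> {}" by blast
  interpret l2: complex_hilbert_space l2_smul "l2 r" "l2_ip r" by (rule l2_hilbert[OF r(1)])
  fix f assume "f \<in> {f \<in> H2 r. H2_norm r f \<le> 1}"
  then have f: "f \<in> H2 r" and f1: "H2_norm r f \<le> 1" by auto
  have coeffs: "laurent_coeff r h \<in> l2 r" "l2_norm r (laurent_coeff r h) = H2_norm r h"
    "\<And>\<mu>. \<mu> \<in> annulus r \<Longrightarrow> l2_ip r (laurent_coeff r h) (kernel_vector r \<mu>) = h \<mu>" if h: "h \<in> H2 r" for h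
  proof -
    show l: "laurent_coeff r h \<in> l2 r" using h by (simp add: l2_def H2_def)
    have "(l2_norm r (laurent_coeff r h))\<^sup>2 = (H2_norm r h)\<^sup>2"
      unfolding H2_norm_square[OF r(1)] l2.hnorm_square[OF l] using l2_ip_self(1)[OF r(1) l] by (simp add: infsumI)
    then show "l2_norm r (laurent_coeff r h) = H2_norm r h"
      by (rule power2_eq_imp_eq) (rule l2.hnorm_nonneg[OF l], rule H2_norm_nonneg[OF r(1)])
    fix \<mu> assume \<mu>: "\<mu> \<in> annulus r"
    have hol: "h holomorphic_on annulus r" using h by (simp add: H2_def)
    show "l2_ip r (laurent_coeff r h) (kernel_vector r \<mu>) = h \<mu>"
      by (rule has_sum_unique[OF kernel_vector_reproduces[OF r(1) l \<mu>] laurent_coeff_has_sum[OF hol r \<mu>]])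
  qed
  define g where "g = (\<lambda>z. \<phi> z * f z)"
  have g: "g \<in> H2 r" unfolding g_def by (rule H_infty_multiplication(1)[OF r \<phi> f])
  define u where "u = laurent_coeff r f"
  define v where "v = laurent_coeff r g"
  define N where "N = H2_norm r g"
  have u: "u \<in> l2 r" "l2_norm r u \<le> 1" and v: "v \<in> l2 r" "l2_norm r v = N"
    using coeffs[OF f] coeffs[OF g] f1 by (auto simp: u_def v_def N_def)
  have N0: "0 \<le> N" unfolding N_def by (rule H2_norm_nonneg[OF r(1)])
  have approx: "N * N \<le> \<sigma> * N + (\<sigma> + N) * e" if e: "0 < e" for e
  proof -
    obtain \<Lambda> c where \<Lambda>: "finite \<Lambda>" "\<Lambda> \<subseteq> annulus r"
      and close: "l2_norm r ((\<Sum>\<mu>\<in>\<Lambda>. l2_smul (c \<mu>) (kernel_vector r \<mu>)) - v) < e"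
      by (rule kernel_vectors_dense[OF r v(1) e])
    have k: "kernel_vector r \<mu> \<in> l2 r" if "\<mu> \<in> \<Lambda>" for \<mu> using that \<Lambda>(2) by (intro kernel_vector_l2[OF r(1)]) auto
    define h where "h = (\<Sum>\<mu>\<in>\<Lambda>. l2_smul (c \<mu>) (kernel_vector r \<mu>))"
    define h' where "h' = (\<Sum>\<mu>\<in>\<Lambda>. l2_smul (c \<mu> * cnj (\<phi> \<mu>)) (kernel_vector r \<mu>))"
    have hH: "h \<in> l2 r" "h' \<in> l2 r" unfolding h_def h'_def by (intro l2.H_sum l2.H_smul k; assumption)+
    have hv: "h - v \<in> l2 r" by (rule l2.H_diff[OF hH(1) v(1)])
    obtain X where X: "X \<in> class_F smul r"
      "\<And>c. l2_norm r (\<Sum>\<mu>\<in>\<Lambda>. l2_smul (c \<mu> * cnj (\<phi> \<mu>)) (kernel_vector r \<mu>))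
       \<le> fun_calc_norm smul r \<phi> X * l2_norm r (\<Sum>\<mu>\<in>\<Lambda>. l2_smul (c \<mu>) (kernel_vector r \<mu>))"
      by (rule class_F_kernel_model[OF r V \<phi> \<Lambda>]) (assumption | rule that)+
    have "l2_norm r h' \<le> \<sigma> * l2_norm r h"
      using order_trans[OF X(2)[of c] mult_right_mono[OF \<sigma>(2)[OF X(1)] l2.hnorm_nonneg[OF hH(1)[unfolded h_def]]]]
      by (simp only: h_def h'_def)
    have vh: "l2_ip r v h = l2_ip r u h'"
    proof -
      have "l2_ip r v h = (\<Sum>\<mu>\<in>\<Lambda>. cnj (c \<mu>) * g \<mu>)"
        unfolding h_def using k v(1) coeffs(3)[OF g] \<Lambda>(2)
        by (subst l2.s_sum_right) (auto simp: l2.s_smul_right v_def intro!: sum.cong l2.H_smul)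
      also have "\<dots> = (\<Sum>\<mu>\<in>\<Lambda>. cnj (c \<mu> * cnj (\<phi> \<mu>)) * f \<mu>)" by (simp add: g_def mult.assoc)
      also have "\<dots> = l2_ip r u h'"
        unfolding h'_def using k u(1) coeffs(3)[OF f] \<Lambda>(2)
        by (subst l2.s_sum_right) (auto simp: l2.s_smul_right u_def intro!: sum.cong l2.H_smul)
      finally show ?thesis .
    qed
    have "h = (h - v) + v" by simp
    then have hn: "l2_norm r h \<le> e + N"
      using l2.hnorm_triangle[OF hv v(1)] close v(2) by (simp add: h_def)
    have "N * N = cmod (l2_ip r v v)" using l2.ip_self[OF v(1)] v(2) by (simp add: power2_eq_square norm_mult)
    also have "l2_ip r v v = l2_ip r v h - l2_ip r v (h - v)"
      using v(1) hH(1) by (simp add: l2.s_diff_right)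
    also have "cmod \<dots> \<le> cmod (l2_ip r u h') + cmod (l2_ip r v (h - v))"
      unfolding vh by (rule norm_triangle_ineq4)
    also have "\<dots> \<le> 1 * (\<sigma> * (e + N)) + N * e"
    proof (rule add_mono)
      have "cmod (l2_ip r u h') \<le> l2_norm r u * l2_norm r h'" by (rule l2.cauchy_schwarz[OF u(1) hH(2)])
      also have "\<dots> \<le> 1 * (\<sigma> * (e + N))"
      proof (rule mult_mono[OF u(2)])
        have "\<sigma> * l2_norm r h \<le> \<sigma> * (e + N)" using hn \<sigma>(1) by (rule mult_left_mono)
        then show "l2_norm r h' \<le> \<sigma> * (e + N)" using \<open>l2_norm r h' \<le> \<sigma> * l2_norm r h\<close> by linarith
      qed (simp_all add: l2.hnorm_nonneg[OF hH(2)])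
      finally show "cmod (l2_ip r u h') \<le> 1 * (\<sigma> * (e + N))" .
      have "cmod (l2_ip r v (h - v)) \<le> l2_norm r v * l2_norm r (h - v)" by (rule l2.cauchy_schwarz[OF v(1) hv])
      also have "\<dots> \<le> N * e" unfolding v(2) using close N0 by (intro mult_left_mono) (auto simp: h_def)
      finally show "cmod (l2_ip r v (h - v)) \<le> N * e" .
    qed
    finally show ?thesis by (simp add: algebra_simps)
  qed
  have "N * N \<le> \<sigma> * N"
  proof (rule field_le_epsilon)
    fix e :: real assume e: "0 < e"
    have d: "0 < \<sigma> + N + 1" using \<sigma>(1) N0 by simp
    have "N * N \<le> \<sigma> * N + (\<sigma> + N) * (e / (\<sigma> + N + 1))" using e d by (intro approx) simp
    also have "(\<sigma> + N) * (e / (\<sigma> + N + 1)) \<le> (\<sigma> + N + 1) * (e / (\<sigma> + N + 1))"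
      using e d by (intro mult_right_mono) auto
    also have "\<dots> = e" using d by simp
    finally show "N * N \<le> \<sigma> * N + e" by simp
  qed
  then have "N \<le> \<sigma>" using N0 \<sigma>(1) by (cases "N = 0") auto
  then show "H2_norm r (\<lambda>z. \<phi> z * f z) \<le> \<sigma>" by (simp add: N_def g_def)
qed

lemma sup_class_F:
  fixes smul :: "complex \<Rightarrow> 'v::ab_group_add \<Rightarrow> 'v"
  assumes r: "0 < r" "r < 1" and V: "vector_space smul" "\<And>B. finite B \<Longrightarrow> module.span smul B \<noteq> UNIV"
    and \<phi>: "\<phi> \<in> H_infty r"
  shows "(SUP X\<in>class_F smul r. ereal (fun_calc_norm smul r \<phi> X)) = ereal (Mult_norm r \<phi>)"
proof (rule antisym)
  show "(SUP X\<in>class_F smul r. ereal (fun_calc_norm smul r \<phi> X)) \<le> ereal (Mult_norm r \<phi>)"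
  proof (rule SUP_least)
    fix X assume X: "X \<in> class_F smul r"
    obtain H ip T where HT: "X = (H, ip, T)" by (cases X)
    have "complex_hilbert_space smul H ip" "T \<in> complex_hilbert_space.class_F_on smul H ip r"
      using X by (auto simp: HT class_F_def)
    then interpret class_F_operator smul H ip r T
      by (intro class_F_operator.intro class_F_operator_axioms.intro r)
    show "ereal (fun_calc_norm smul r \<phi> X) \<le> ereal (Mult_norm r \<phi>)"
      using fun_calc_norm_upper[OF \<phi>] by (simp add: HT fun_calc_norm_def)
  qed
  obtain X0 where X0: "X0 \<in> class_F smul r" "0 \<le> fun_calc_norm smul r \<phi> X0"
    by (rule class_F_kernel_model[OF r V \<phi>, of "{}"]) auto
  show "ereal (Mult_norm r \<phi>) \<le> (SUP X\<in>class_F smul r. ereal (fun_calc_norm smul r \<phi> X))" (is "_ \<le> ?s")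
  proof (cases ?s)
    case (real \<sigma>)
    have le: "fun_calc_norm smul r \<phi> X \<le> \<sigma>" if "X \<in> class_F smul r" for X
      using SUP_upper[OF that, of "\<lambda>X. ereal (fun_calc_norm smul r \<phi> X)"] by (simp add: real)
    have "0 \<le> \<sigma>" using le[OF X0(1)] X0(2) by linarith
    from Mult_norm_le_sup_class_F[OF r V \<phi> this le] show ?thesis by (simp add: real)
  next
    case MInf
    then show ?thesis using SUP_upper[OF X0(1), of "\<lambda>X. ereal (fun_calc_norm smul r \<phi> X)"] by simp
  qed simp
qed

theorem theorem1p1:
  fixes r :: real
    and smul :: "complex \<Rightarrow> 'v::ab_group_add \<Rightarrow> 'v"
  assumes "0 < r" and "r < 1"
    and "vector_space smul"
    and "\<And>B. finite B \<Longrightarrow> module.span smul B \<noteq> UNIV"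
  shows "(\<forall>\<phi>\<in>H_infty r.
            \<phi> \<in> Mult r \<and>
            (SUP T\<in>class_F smul r. ereal (fun_calc_norm smul r \<phi> T)) = ereal (Mult_norm r \<phi>) \<and>
            Mult_norm r \<phi> \<le> sqrt 2 * H_infty_norm r \<phi>) \<and>
         \<not> (\<exists>C<sqrt 2. \<forall>\<phi>\<in>H_infty r. Mult_norm r \<phi> \<le> C * H_infty_norm r \<phi>)"
proof (intro conjI ballI)
  fix \<phi> assume \<phi>: "\<phi> \<in> H_infty r"
  show "\<phi> \<in> Mult r" by (rule H_infty_subset_Mult[OF assms(1,2) \<phi>])
  show "(SUP T\<in>class_F smul r. ereal (fun_calc_norm smul r \<phi> T)) = ereal (Mult_norm r \<phi>)"
    by (rule sup_class_F[OF assms \<phi>])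
  show "Mult_norm r \<phi> \<le> sqrt 2 * H_infty_norm r \<phi>" by (rule Mult_norm_le_sqrt2[OF assms(1,2) \<phi>])
next
  show "\<not> (\<exists>C<sqrt 2. \<forall>\<phi>\<in>H_infty r. Mult_norm r \<phi> \<le> C * H_infty_norm r \<phi>)"
    using sqrt2_sharp[OF assms(1,2)] by (meson not_less)
qed

end
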